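(* Let $A=kQ/I$ be a gentle algebra. Then the following are equivalent: (i) $A$ is Auslander-Gorenstein. (ii) For every vertex $v\in Q_0$, $\deg^{\mathrm{in}}(v)=2$ if and only if $\deg^{\mathrm{out}}(v)=2$.
   Context: $k$ is a field, $Q=(Q_0,Q_1,s,t)$ is a finite quiver, $I\subset kQ$ is an admissible ideal, $A=kQ/I$ (finite-dimensional). Arrows are composed left to right. $\deg^{\mathrm{in}}(v)$ and $\deg^{\mathrm{out}}(v)$ are the numbers of arrows ending, respectively starting, at $v$. Modules are finite-dimensional right $A$-modules. $A$ is gentle if: every vertex has at most 2 incoming and at most 2 outgoing arrows; for any arrows $a_1\ne a_2$ and $b$ with $t(a_1)=t(a_2)=s(b)$ we have $|\{a_1b,a_2b\}\cap I|=1$; for any arrows $a$ and $b_1\neq b_2$ with $t(a)=s(b_1)=s(b_2)$ we have $|\{ab_1,ab_2\}\cap I|=1$; and $I$ is generated by a set of paths of length 2. Let $0\to A_A\to I^0\to I^1\to\cdots$ be a minimal injective resolution of the regular module. For $n\ge 1$, $A$ is $n$-Gorenstein if $\operatorname{pdim} I^i\le i$ for all $0\le i<n$. $A$ is Auslander-Gorenstein if it is $n$-Gorenstein for all $n\ge1$ and $\operatorname{idim}A_A<\infty$. *)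

theory Defs
  imports
    "HOL-Algebra.Ideal_Product"
    "HOL-Algebra.QuotRing"
    "HOL-Algebra.Module"
    "HOL-Library.Extended_Nat"
    "Graph_Theory.Arc_Walk"
begin

section \<open>Path algebras and bound quiver algebras\<close>

text \<open>
  A finite quiver is a finite directed multigraph with loops allowed, i.e. a \<^locale>\<open>fin_digraph\<close>;
  source and target of an arrow are its \<^const>\<open>tail\<close> and \<^const>\<open>head\<close>.
  A path is encoded as its starting vertex together with its list of arrows, so that
  \<open>(v, [])\<close> is the trivial path at \<open>v\<close>.
\<close>

definition quiver_paths :: "('v, 'a) pre_digraph \<Rightarrow> ('v \<times> 'a list) set" where
  "quiver_paths Q = {(u, p). \<exists>v. pre_digraph.awalk Q u p v}"

text \<open>
  The elements of the path algebra are the finitely supported functions on paths. The product is the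
  bilinear extension of the concatenation of paths (from left to right): the coefficient of a
  path in a product is the sum over all ways of cutting this path into two.
  The record type \<^typ>\<open>('k, 'r) module\<close> is used for \<open>k\<close>-algebras: it is a ring with a scalar
  multiplication.
\<close>

definition path_algebra ::
    "('v, 'a) pre_digraph \<Rightarrow> ('k::field, 'v \<times> 'a list \<Rightarrow> 'k) module" where
  "path_algebra Q =
     \<lparr>carrier = {x. finite {w. x w \<noteq> 0} \<and> {w. x w \<noteq> 0} \<subseteq> quiver_paths Q},
      mult = (\<lambda>x y (u, p). \<Sum>i\<le>length p.
                x (u, take i p) * y (pre_digraph.awlast Q u (take i p), drop i p)),
      one = (\<lambda>(u, p). if u \<in> verts Q \<and> p = [] then 1 else 0),
      zero = (\<lambda>w. 0),
      add = (\<lambda>x y w. x w + y w),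
      smult = (\<lambda>c x w. c * x w)\<rparr>"

definition path_elem :: "'v \<times> 'a list \<Rightarrow> 'v \<times> 'a list \<Rightarrow> 'k::field" where
  "path_elem w = (\<lambda>w'. if w' = w then 1 else 0)"

definition arrow_ideal :: "('v, 'a) pre_digraph \<Rightarrow> ('v \<times> 'a list \<Rightarrow> 'k::field) set" where
  "arrow_ideal Q = Idl\<^bsub>path_algebra Q\<^esub> {path_elem (tail Q a, [a]) | a. a \<in> arcs Q}"

text \<open>Powers of an ideal are taken in the monoid of ideals.\<close>

definition admissible_ideal ::
    "('v, 'a) pre_digraph \<Rightarrow> ('v \<times> 'a list \<Rightarrow> 'k::field) set \<Rightarrow> bool" where
  "admissible_ideal Q I \<longleftrightarrow>
     ideal I (path_algebra Q) \<and>
     I \<subseteq> arrow_ideal Q [^]\<^bsub>ideals_set (path_algebra Q)\<^esub> (2::nat) \<and>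
     (\<exists>m::nat. m \<ge> 2 \<and> arrow_ideal Q [^]\<^bsub>ideals_set (path_algebra Q)\<^esub> m \<subseteq> I)"

definition bound_quiver_algebra ::
    "('v, 'a) pre_digraph \<Rightarrow> ('v \<times> 'a list \<Rightarrow> 'k::field) set \<Rightarrow>
     ('k, ('v \<times> 'a list \<Rightarrow> 'k) set) module" where
  "bound_quiver_algebra Q I =
     (let R = path_algebra Q; A = R Quot I in
      \<lparr>carrier = carrier A, mult = mult A, one = one A, zero = zero A, add = add A,
       smult = (\<lambda>c X. \<Union>x\<in>X. I +>\<^bsub>R\<^esub> (c \<odot>\<^bsub>R\<^esub> x))\<rparr>)"

definition gentle ::
    "('v, 'a) pre_digraph \<Rightarrow> ('v \<times> 'a list \<Rightarrow> 'k::field) set \<Rightarrow> bool" where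
  "gentle Q I \<longleftrightarrow>
     (\<forall>v\<in>verts Q. in_degree Q v \<le> 2 \<and> out_degree Q v \<le> 2) \<and>
     (\<forall>a1\<in>arcs Q. \<forall>a2\<in>arcs Q. \<forall>b\<in>arcs Q.
        a1 \<noteq> a2 \<and> head Q a1 = tail Q b \<and> head Q a2 = tail Q b \<longrightarrow>
        card ({path_elem (tail Q a1, [a1, b]), path_elem (tail Q a2, [a2, b])} \<inter> I) = 1) \<and>
     (\<forall>a\<in>arcs Q. \<forall>b1\<in>arcs Q. \<forall>b2\<in>arcs Q.
        b1 \<noteq> b2 \<and> head Q a = tail Q b1 \<and> head Q a = tail Q b2 \<longrightarrow>
        card ({path_elem (tail Q a, [a, b1]), path_elem (tail Q a, [a, b2])} \<inter> I) = 1) \<and>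
     (\<exists>S \<subseteq> {(u, p) \<in> quiver_paths Q. length p = 2}.
        I = Idl\<^bsub>path_algebra Q\<^esub> (path_elem ` S))"


section \<open>Finite-dimensional right modules\<close>

text \<open>
  As for the library's modules over commutative rings, the multiplicative part of the
  underlying ring record of a right module is ignored.
\<close>

record ('r, 'm) rmod = "'m ring" +
  ract :: "'m \<Rightarrow> 'r \<Rightarrow> 'm" (infixl \<open>\<triangleleft>\<index>\<close> 70)

locale right_module = R: ring R + M: abelian_group M
  for R :: "('r, 'x) ring_scheme" (structure) and M :: "('r, 'm) rmod" (structure) +
  assumes ract_closed:
      "\<lbrakk>m \<in> carrier M; a \<in> carrier R\<rbrakk> \<Longrightarrow> m \<triangleleft>\<^bsub>M\<^esub> a \<in> carrier M"
    and ract_add_left: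
      "\<lbrakk>m \<in> carrier M; n \<in> carrier M; a \<in> carrier R\<rbrakk> \<Longrightarrow>
        (m \<oplus>\<^bsub>M\<^esub> n) \<triangleleft>\<^bsub>M\<^esub> a = m \<triangleleft>\<^bsub>M\<^esub> a \<oplus>\<^bsub>M\<^esub> n \<triangleleft>\<^bsub>M\<^esub> a"
    and ract_add_right:
      "\<lbrakk>m \<in> carrier M; a \<in> carrier R; b \<in> carrier R\<rbrakk> \<Longrightarrow>
        m \<triangleleft>\<^bsub>M\<^esub> (a \<oplus>\<^bsub>R\<^esub> b) = m \<triangleleft>\<^bsub>M\<^esub> a \<oplus>\<^bsub>M\<^esub> m \<triangleleft>\<^bsub>M\<^esub> b"
    and ract_mult:
      "\<lbrakk>m \<in> carrier M; a \<in> carrier R; b \<in> carrier R\<rbrakk> \<Longrightarrow>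
        m \<triangleleft>\<^bsub>M\<^esub> (a \<otimes>\<^bsub>R\<^esub> b) = (m \<triangleleft>\<^bsub>M\<^esub> a) \<triangleleft>\<^bsub>M\<^esub> b"
    and ract_one:
      "m \<in> carrier M \<Longrightarrow> m \<triangleleft>\<^bsub>M\<^esub> \<one>\<^bsub>R\<^esub> = m"

text \<open>The scalars act on a right module over a \<open>k\<close>-algebra through multiples of the unit.\<close>

definition fd_module :: "('k::field, 'r) module \<Rightarrow> ('r, 'm) rmod \<Rightarrow> bool" where
  "fd_module A M \<longleftrightarrow> right_module A M \<and>
     (\<exists>B \<subseteq> carrier M. finite B \<and>
        (\<forall>m\<in>carrier M. \<exists>c :: 'm \<Rightarrow> 'k.
           m = (\<Oplus>\<^bsub>M\<^esub>b\<in>B. b \<triangleleft>\<^bsub>M\<^esub> (c b \<odot>\<^bsub>A\<^esub> \<one>\<^bsub>A\<^esub>))))"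

definition regular_module :: "('k, 'r) module \<Rightarrow> ('r, 'r) rmod" where
  "regular_module A =
     \<lparr>carrier = carrier A, mult = mult A, one = one A, zero = zero A, add = add A, ract = mult A\<rparr>"

definition rmod_hom ::
    "('k, 'r) module \<Rightarrow> ('r, 'm) rmod \<Rightarrow> ('r, 'n) rmod \<Rightarrow> ('m \<Rightarrow> 'n) set" where
  "rmod_hom A M N =
     {f \<in> carrier M \<rightarrow> carrier N.
        (\<forall>x\<in>carrier M. \<forall>y\<in>carrier M. f (x \<oplus>\<^bsub>M\<^esub> y) = f x \<oplus>\<^bsub>N\<^esub> f y) \<and>
        (\<forall>x\<in>carrier M. \<forall>a\<in>carrier A. f (x \<triangleleft>\<^bsub>M\<^esub> a) = f x \<triangleleft>\<^bsub>N\<^esub> a)}"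

definition rsubmodule :: "('k, 'r) module \<Rightarrow> 'm set \<Rightarrow> ('r, 'm) rmod \<Rightarrow> bool" where
  "rsubmodule A U M \<longleftrightarrow> additive_subgroup U M \<and> U \<subseteq> carrier M \<and>
     (\<forall>u\<in>U. \<forall>a\<in>carrier A. u \<triangleleft>\<^bsub>M\<^esub> a \<in> U)"

definition essential_in :: "('k, 'r) module \<Rightarrow> 'm set \<Rightarrow> ('r, 'm) rmod \<Rightarrow> bool" where
  "essential_in A U M \<longleftrightarrow> rsubmodule A U M \<and>
     (\<forall>V. rsubmodule A V M \<and> V \<inter> U = {\<zero>\<^bsub>M\<^esub>} \<longrightarrow> V = {\<zero>\<^bsub>M\<^esub>})"

text \<open>
  HOL cannot quantify over all types within a formula. Every finite-dimensional module over a
  \<open>k\<close>-algebra is isomorphic to one whose elements are functions \<^typ>\<open>nat \<Rightarrow> 'k\<close> (coordinate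
  vectors of length \<open>n\<close>, supported below \<open>n\<close>). Letting modules range over this carrier type therefore
  covers the whole category of finite-dimensional modules up to isomorphism.
\<close>

type_synonym ('k, 'r) coord_rmod = "('r, nat \<Rightarrow> 'k) rmod"

definition projective_module :: "('k::field, 'r) module \<Rightarrow> ('r, 'm) rmod \<Rightarrow> bool" where
  "projective_module A P \<longleftrightarrow> fd_module A P \<and>
     (\<forall>(X :: ('k, 'r) coord_rmod) (Y :: ('k, 'r) coord_rmod).
        \<forall>f\<in>rmod_hom A X Y. \<forall>g\<in>rmod_hom A P Y.
        fd_module A X \<and> fd_module A Y \<and> f ` carrier X = carrier Y \<longrightarrow>
        (\<exists>h\<in>rmod_hom A P X. \<forall>p\<in>carrier P. f (h p) = g p))"

definition injective_module :: "('k::field, 'r) module \<Rightarrow> ('r, 'm) rmod \<Rightarrow> bool" where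
  "injective_module A E \<longleftrightarrow> fd_module A E \<and>
     (\<forall>(X :: ('k, 'r) coord_rmod) (Y :: ('k, 'r) coord_rmod).
        \<forall>f\<in>rmod_hom A X Y. \<forall>g\<in>rmod_hom A X E.
        fd_module A X \<and> fd_module A Y \<and> inj_on f (carrier X) \<longrightarrow>
        (\<exists>h\<in>rmod_hom A Y E. \<forall>x\<in>carrier X. h (f x) = g x))"


section \<open>Resolutions and homological dimensions\<close>

text \<open>The exact sequence \<open>\<dots> \<rightarrow> P 1 \<rightarrow> P 0 \<rightarrow> M \<rightarrow> 0\<close> with maps \<open>d i : P (i + 1) \<rightarrow> P i\<close> and
  augmentation \<open>e : P 0 \<rightarrow> M\<close>.\<close>

definition projective_resolution ::
    "('k::field, 'r) module \<Rightarrow> ('r, 'm) rmod \<Rightarrow> (nat \<Rightarrow> ('k, 'r) coord_rmod) \<Rightarrow>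
     ((nat \<Rightarrow> 'k) \<Rightarrow> 'm) \<Rightarrow> (nat \<Rightarrow> (nat \<Rightarrow> 'k) \<Rightarrow> (nat \<Rightarrow> 'k)) \<Rightarrow> bool" where
  "projective_resolution A M P e d \<longleftrightarrow>
     fd_module A M \<and> (\<forall>i. projective_module A (P i)) \<and>
     e \<in> rmod_hom A (P 0) M \<and> (\<forall>i. d i \<in> rmod_hom A (P (Suc i)) (P i)) \<and>
     e ` carrier (P 0) = carrier M \<and>
     d 0 ` carrier (P 1) = a_kernel (P 0) M e \<and>
     (\<forall>i. d (Suc i) ` carrier (P (Suc (Suc i))) = a_kernel (P (Suc i)) (P i) (d i))"

text \<open>The exact sequence \<open>0 \<rightarrow> M \<rightarrow> E 0 \<rightarrow> E 1 \<rightarrow> \<dots>\<close> with maps \<open>d i : E i \<rightarrow> E (i + 1)\<close> and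
  coaugmentation \<open>e : M \<rightarrow> E 0\<close>.\<close>

definition injective_resolution ::
    "('k::field, 'r) module \<Rightarrow> ('r, 'm) rmod \<Rightarrow> (nat \<Rightarrow> ('k, 'r) coord_rmod) \<Rightarrow>
     ('m \<Rightarrow> (nat \<Rightarrow> 'k)) \<Rightarrow> (nat \<Rightarrow> (nat \<Rightarrow> 'k) \<Rightarrow> (nat \<Rightarrow> 'k)) \<Rightarrow> bool" where
  "injective_resolution A M E e d \<longleftrightarrow>
     fd_module A M \<and> (\<forall>i. injective_module A (E i)) \<and>
     e \<in> rmod_hom A M (E 0) \<and> (\<forall>i. d i \<in> rmod_hom A (E i) (E (Suc i))) \<and>
     inj_on e (carrier M) \<and>
     e ` carrier M = a_kernel (E 0) (E 1) (d 0) \<and>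
     (\<forall>i. d i ` carrier (E i) = a_kernel (E (Suc i)) (E (Suc (Suc i))) (d (Suc i)))"

text \<open>Minimality: each term is an injective envelope of the corresponding cosyzygy, which is
  identified with the image of the preceding map.\<close>

definition minimal_injective_resolution ::
    "('k::field, 'r) module \<Rightarrow> ('r, 'm) rmod \<Rightarrow> (nat \<Rightarrow> ('k, 'r) coord_rmod) \<Rightarrow>
     ('m \<Rightarrow> (nat \<Rightarrow> 'k)) \<Rightarrow> (nat \<Rightarrow> (nat \<Rightarrow> 'k) \<Rightarrow> (nat \<Rightarrow> 'k)) \<Rightarrow> bool" where
  "minimal_injective_resolution A M E e d \<longleftrightarrow>
     injective_resolution A M E e d \<and>
     essential_in A (e ` carrier M) (E 0) \<and>
     (\<forall>i. essential_in A (d i ` carrier (E i)) (E (Suc i)))"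

text \<open>The dimensions are \<open>\<infinity>\<close> if there is no finite resolution; zero modules get dimension 0.\<close>

definition pdim :: "('k::field, 'r) module \<Rightarrow> ('r, 'm) rmod \<Rightarrow> enat" where
  "pdim A M = Inf {enat n | n. \<exists>P e d. projective_resolution A M P e d \<and>
                                 (\<forall>i>n. carrier (P i) = {\<zero>\<^bsub>P i\<^esub>})}"

definition idim :: "('k::field, 'r) module \<Rightarrow> ('r, 'm) rmod \<Rightarrow> enat" where
  "idim A M = Inf {enat n | n. \<exists>E e d. injective_resolution A M E e d \<and>
                                 (\<forall>i>n. carrier (E i) = {\<zero>\<^bsub>E i\<^esub>})}"

text \<open>Minimal injective resolutions exist and are unique up to isomorphism, so it does not matter
  which one is taken.\<close>

definition n_gorenstein :: "nat \<Rightarrow> ('k::field, 'r) module \<Rightarrow> bool" where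
  "n_gorenstein n A \<longleftrightarrow>
     (\<exists>E e d. minimal_injective_resolution A (regular_module A) E e d \<and>
              (\<forall>i<n. pdim A (E i) \<le> enat i))"

definition auslander_gorenstein :: "('k::field, 'r) module \<Rightarrow> bool" where
  "auslander_gorenstein A \<longleftrightarrow>
     (\<forall>n\<ge>1. n_gorenstein n A) \<and> idim A (regular_module A) < \<infinity>"

end

theory Submission
  imports Defs
begin

text \<open>
  The algebra \<open>A\<close> has the paths without a subpath in \<open>I\<close> of length two as a basis, and gentleness makes
  the prolongation of such a path to the left or right unique. An indecomposable injective \<open>I(v)\<close>
  is dual to the paths ending at \<open>v\<close>, and an indecomposable projective \<open>P(u)\<close> is spanned by the paths
  starting at \<open>u\<close>.

  Under the degree condition, the injective envelope of \<open>A\<close> is the sum of the \<open>I(v)\<close> over the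
  right-maximal paths \<open>p\<close>, \<open>v\<close> being the end of \<open>p\<close>; these \<open>I(v)\<close> are uniserial and projective.
  The cokernel of \<open>P(u)\<close> is \<open>I(u)\<close> if two arrows start at \<open>u\<close>. Otherwise it is zero or embeds into
  \<open>I(w)\<close> for an arrow \<open>f : w \<rightarrow> u\<close> that begins no relation, and from there on the resolution runs
  backwards along the unique chain of relations \<open>\<dots>, g f\<close> ending in \<open>f\<close>. The chain is finite since an arrow
  on a cycle of relations begins a relation. Similarly, the projective resolution of \<open>I(w)\<close> for the source
  \<open>w\<close> of an arrow in such a chain runs forwards along the chain to \<open>f\<close>, which bounds
  its length by the position in the injective resolution.

  Conversely, only one injective and projective module \<open>E\<close> containing \<open>A\<close> is needed. If the degree
  condition fails at \<open>v\<close>, then there is an arrow ending (or starting) at \<open>v\<close> all of whose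
  products with arrows starting (or ending) at \<open>v\<close> vanish. Extending a suitable map from a right
  ideal to \<open>E\<close> gives elements of \<open>E\<close> that cannot exist in a submodule of a free module.
\<close>

section \<open>Modules over an algebra\<close>

text \<open>Projectivity, injectivity and resolutions are defined by quantifying over modules with
  carrier \<open>nat \<Rightarrow> 'k\<close>, while the natural modules here are families of
  coefficient functions on paths. This mismatch is bridged by coordinate copies: everything is
  constructed on paths and transported afterwards.

  The path basis replaces structure theory. No decomposition into indecomposables and no abstract
  envelopes occur: exactness is proved by writing down preimages coefficient by coefficient, and
  minimality by checking that functions supported on trivial paths, which form the socle, are killed
  by the next map.

  The degree condition acts chiefly through two consequences: at most one arrow enters the end of a
  right-maximal path, and at most one leaves the start of a left-maximal one. Signs appear where two
  maximal paths share a vertex: the signed sum over both is a difference, and its vanishing compares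
  the two values.\<close>

context right_module
begin

lemma ract_zero_right: "m \<in> carrier M \<Longrightarrow> m \<triangleleft>\<^bsub>M\<^esub> \<zero> = \<zero>\<^bsub>M\<^esub>"
proof -
  assume m: "m \<in> carrier M"
  have "m \<triangleleft>\<^bsub>M\<^esub> \<zero> \<oplus>\<^bsub>M\<^esub> m \<triangleleft>\<^bsub>M\<^esub> \<zero> = m \<triangleleft>\<^bsub>M\<^esub> \<zero>"
    using ract_add_right[OF m, of \<zero> \<zero>] by simp
  thus ?thesis
    using m ract_closed M.r_neg2 M.minus_closed by (metis M.add.r_cancel_one R.zero_closed)
qed

lemma ract_zero_left: "a \<in> carrier R \<Longrightarrow> \<zero>\<^bsub>M\<^esub> \<triangleleft>\<^bsub>M\<^esub> a = \<zero>\<^bsub>M\<^esub>"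
proof -
  assume a: "a \<in> carrier R"
  have "\<zero>\<^bsub>M\<^esub> \<triangleleft>\<^bsub>M\<^esub> a \<oplus>\<^bsub>M\<^esub> \<zero>\<^bsub>M\<^esub> \<triangleleft>\<^bsub>M\<^esub> a = \<zero>\<^bsub>M\<^esub> \<triangleleft>\<^bsub>M\<^esub> a"
    using ract_add_left[OF _ _ a, of "\<zero>\<^bsub>M\<^esub>" "\<zero>\<^bsub>M\<^esub>"] by simp
  thus ?thesis
    using a ract_closed by (metis M.add.r_cancel_one M.zero_closed)
qed

end

section \<open>Homomorphisms of right modules\<close>

lemma rmod_homI:
  assumes "\<And>x. x \<in> carrier M \<Longrightarrow> f x \<in> carrier N"
    and "\<And>x y. \<lbrakk>x \<in> carrier M; y \<in> carrier M\<rbrakk> \<Longrightarrow> f (x \<oplus>\<^bsub>M\<^esub> y) = f x \<oplus>\<^bsub>N\<^esub> f y"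
    and "\<And>x a. \<lbrakk>x \<in> carrier M; a \<in> carrier A\<rbrakk> \<Longrightarrow> f (x \<triangleleft>\<^bsub>M\<^esub> a) = f x \<triangleleft>\<^bsub>N\<^esub> a"
  shows "f \<in> rmod_hom A M N"
  using assms unfolding rmod_hom_def by auto

lemma rmod_homD:
  assumes "f \<in> rmod_hom A M N"
  shows "x \<in> carrier M \<Longrightarrow> f x \<in> carrier N"
    and "\<lbrakk>x \<in> carrier M; y \<in> carrier M\<rbrakk> \<Longrightarrow> f (x \<oplus>\<^bsub>M\<^esub> y) = f x \<oplus>\<^bsub>N\<^esub> f y"
    and "\<lbrakk>x \<in> carrier M; a \<in> carrier A\<rbrakk> \<Longrightarrow> f (x \<triangleleft>\<^bsub>M\<^esub> a) = f x \<triangleleft>\<^bsub>N\<^esub> a"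
  using assms unfolding rmod_hom_def by auto

lemma rmod_hom_compose:
  assumes "f \<in> rmod_hom A M N" "g \<in> rmod_hom A N L"
  shows "(\<lambda>x. g (f x)) \<in> rmod_hom A M L"
  by (rule rmod_homI) (simp_all add: rmod_homD[OF assms(1)] rmod_homD[OF assms(2)])

lemma rmod_hom_inv:
  assumes f: "f \<in> rmod_hom A M N" and bij: "bij_betw f (carrier M) (carrier N)"
    and M: "right_module A M"
  shows "inv_into (carrier M) f \<in> rmod_hom A N M"
proof -
  interpret M: right_module A M by fact
  let ?g = "inv_into (carrier M) f"
  have inj: "inj_on f (carrier M)" and im: "f ` carrier M = carrier N"
    using bij by (auto simp: bij_betw_def)
  have g: "?g y \<in> carrier M" "f (?g y) = y" if "y \<in> carrier N" for y
    using that im by (auto intro: inv_into_into f_inv_into_f)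
  have eqI: "?g y = x" if "x \<in> carrier M" "f x = y" for x y
    using that inj by auto
  show ?thesis
  proof (rule rmod_homI)
    fix x y assume "x \<in> carrier N" "y \<in> carrier N"
    thus "?g (x \<oplus>\<^bsub>N\<^esub> y) = ?g x \<oplus>\<^bsub>M\<^esub> ?g y"
      by (intro eqI) (auto simp: g rmod_homD[OF f])
  next
    fix x a assume "x \<in> carrier N" "a \<in> carrier A"
    thus "?g (x \<triangleleft>\<^bsub>N\<^esub> a) = ?g x \<triangleleft>\<^bsub>M\<^esub> a"
      by (intro eqI) (auto simp: g rmod_homD[OF f] M.ract_closed)
  qed (use g in auto)
qed

section \<open>Algebras over a field and the action of scalars\<close>

locale kalgebra = ring A for A :: "('k::field, 'r) module" (structure) +
  assumes smult_closed [simp, intro]: "a \<in> carrier A \<Longrightarrow> c \<odot> a \<in> carrier A"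
    and smult_add_left: "a \<in> carrier A \<Longrightarrow> (c + d) \<odot> a = c \<odot> a \<oplus> d \<odot> a"
    and smult_add_right:
      "\<lbrakk>a \<in> carrier A; b \<in> carrier A\<rbrakk> \<Longrightarrow> c \<odot> (a \<oplus> b) = c \<odot> a \<oplus> c \<odot> b"
    and smult_smult: "a \<in> carrier A \<Longrightarrow> c \<odot> (d \<odot> a) = (c * d) \<odot> a"
    and smult_one [simp]: "a \<in> carrier A \<Longrightarrow> 1 \<odot> a = a"
    and smult_lmult: "\<lbrakk>a \<in> carrier A; b \<in> carrier A\<rbrakk> \<Longrightarrow> (c \<odot> a) \<otimes> b = c \<odot> (a \<otimes> b)"
    and smult_rmult: "\<lbrakk>a \<in> carrier A; b \<in> carrier A\<rbrakk> \<Longrightarrow> a \<otimes> (c \<odot> b) = c \<odot> (a \<otimes> b)"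
begin

lemma smult_zero_left: "a \<in> carrier A \<Longrightarrow> 0 \<odot> a = \<zero>"
  using smult_add_left[of a 0 0] by (metis add.l_cancel_one add_0 smult_closed)

text \<open>A right module record has no scalar action of its own; multiples of the unit supply the
  vector space structure, and every homomorphism is automatically linear
  (\<open>rmod_hom_scal\<close>).\<close>

definition scal :: "('r, 'm) rmod \<Rightarrow> 'm \<Rightarrow> 'k \<Rightarrow> 'm" where
  "scal M m c = m \<triangleleft>\<^bsub>M\<^esub> (c \<odot> \<one>)"

context
  fixes M :: "('r, 'm) rmod"
  assumes M: "right_module A M"
begin

interpretation M: right_module A M by (rule M)

lemma scal_closed: "m \<in> carrier M \<Longrightarrow> scal M m c \<in> carrier M"
  by (simp add: scal_def M.ract_closed)

lemma scal_add:
  "\<lbrakk>m \<in> carrier M; n \<in> carrier M\<rbrakk> \<Longrightarrow> scal M (m \<oplus>\<^bsub>M\<^esub> n) c = scal M m c \<oplus>\<^bsub>M\<^esub> scal M n c"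
  by (simp add: scal_def M.ract_add_left)

lemma scal_add_right:
  "m \<in> carrier M \<Longrightarrow> scal M m (c + d) = scal M m c \<oplus>\<^bsub>M\<^esub> scal M m d"
  by (simp add: scal_def M.ract_add_right[symmetric] smult_add_left)

lemma scal_scal: "m \<in> carrier M \<Longrightarrow> scal M (scal M m c) d = scal M m (c * d)"
  by (simp add: scal_def M.ract_mult[symmetric] smult_lmult smult_rmult smult_smult mult.commute)

lemma scal_one: "m \<in> carrier M \<Longrightarrow> scal M m 1 = m"
  by (simp add: scal_def M.ract_one)

lemma scal_0: "m \<in> carrier M \<Longrightarrow> scal M m 0 = \<zero>\<^bsub>M\<^esub>"
  by (simp add: scal_def M.ract_zero_right smult_zero_left)

lemma scal_minus: "m \<in> carrier M \<Longrightarrow> scal M m (- 1) = \<ominus>\<^bsub>M\<^esub> m"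
  by (rule M.M.minus_equality[symmetric], simp_all add: scal_closed)
     (metis scal_add_right scal_one scal_0 add.commute add.right_inverse scal_closed M.M.a_comm)

lemma ract_scal:
  "\<lbrakk>m \<in> carrier M; a \<in> carrier A\<rbrakk> \<Longrightarrow> scal M (m \<triangleleft>\<^bsub>M\<^esub> a) c = m \<triangleleft>\<^bsub>M\<^esub> (c \<odot> a)"
  by (simp add: scal_def M.ract_mult[symmetric] smult_rmult)

end

lemma rmod_hom_scal:
  "\<lbrakk>f \<in> rmod_hom A M N; x \<in> carrier M\<rbrakk> \<Longrightarrow> f (scal M x c) = scal N (f x) c"
  by (simp add: scal_def rmod_homD(3))

end

lemma additive_zero:
  assumes "abelian_group M" "abelian_group N"
    and "\<And>x. x \<in> carrier M \<Longrightarrow> f x \<in> carrier N"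
    and "\<And>x y. \<lbrakk>x \<in> carrier M; y \<in> carrier M\<rbrakk> \<Longrightarrow> f (x \<oplus>\<^bsub>M\<^esub> y) = f x \<oplus>\<^bsub>N\<^esub> f y"
  shows "f \<zero>\<^bsub>M\<^esub> = \<zero>\<^bsub>N\<^esub>"
proof -
  interpret M: abelian_group M by fact
  interpret N: abelian_group N by fact
  have "f \<zero>\<^bsub>M\<^esub> \<oplus>\<^bsub>N\<^esub> f \<zero>\<^bsub>M\<^esub> = f \<zero>\<^bsub>M\<^esub>"
    using assms(4)[of "\<zero>\<^bsub>M\<^esub>" "\<zero>\<^bsub>M\<^esub>"] by simp
  thus ?thesis by (metis M.zero_closed N.add.r_cancel_one assms(3))
qed

text \<open>Additivity is all that the induction uses, and the generality matters:
  \<open>hom_from_F\<close> applies this to \<open>\<lambda>y. y \<triangleleft> a\<close>, which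
  need not be a homomorphism of right modules.\<close>

lemma additive_finsum:
  assumes "abelian_group M" "abelian_group N"
    and cl: "\<And>x. x \<in> carrier M \<Longrightarrow> f x \<in> carrier N"
    and add: "\<And>x y. \<lbrakk>x \<in> carrier M; y \<in> carrier M\<rbrakk> \<Longrightarrow> f (x \<oplus>\<^bsub>M\<^esub> y) = f x \<oplus>\<^bsub>N\<^esub> f y"
    and g: "g \<in> L \<rightarrow> carrier M"
  shows "f (\<Oplus>\<^bsub>M\<^esub>l\<in>L. g l) = (\<Oplus>\<^bsub>N\<^esub>l\<in>L. f (g l))"
proof -
  interpret M: abelian_group M by fact
  interpret N: abelian_group N by fact
  have z: "f \<zero>\<^bsub>M\<^esub> = \<zero>\<^bsub>N\<^esub>" by (rule additive_zero) (use assms in auto)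
  show ?thesis
  proof (cases "finite L")
    case True
    thus ?thesis using g
    proof (induction L)
      case (insert l L)
      have "g \<in> L \<rightarrow> carrier M" "g l \<in> carrier M" "(\<lambda>l. f (g l)) \<in> L \<rightarrow> carrier N"
        using insert.prems cl by auto
      thus ?case using insert by (simp add: add cl M.finsum_closed)
    qed (simp add: z)
  qed (simp add: z M.finsum_infinite N.finsum_infinite)
qed

lemma rmod_hom_zero:
  assumes "f \<in> rmod_hom A M N" "right_module A M" "right_module A N"
  shows "f \<zero>\<^bsub>M\<^esub> = \<zero>\<^bsub>N\<^esub>"
  by (rule additive_zero) (use assms in \<open>auto simp: rmod_homD right_module_def\<close>)

lemma rmod_hom_finsum:
  assumes "f \<in> rmod_hom A M N" "right_module A M" "right_module A N" "g \<in> L \<rightarrow> carrier M"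
  shows "f (\<Oplus>\<^bsub>M\<^esub>l\<in>L. g l) = (\<Oplus>\<^bsub>N\<^esub>l\<in>L. f (g l))"
  by (rule additive_finsum) (use assms in \<open>auto simp: rmod_homD right_module_def\<close>)

lemma rmod_hom_minus:
  assumes f: "f \<in> rmod_hom A M N" "right_module A M" "right_module A N" and x: "x \<in> carrier M"
  shows "f (\<ominus>\<^bsub>M\<^esub> x) = \<ominus>\<^bsub>N\<^esub> f x"
proof -
  interpret M: right_module A M by fact
  interpret N: right_module A N by fact
  have "f (\<ominus>\<^bsub>M\<^esub> x) \<oplus>\<^bsub>N\<^esub> f x = \<zero>\<^bsub>N\<^esub>"
    by (metis M.M.add.inv_closed M.M.l_neg f rmod_homD(2) rmod_hom_zero x)
  thus ?thesis by (metis M.M.add.inv_closed N.M.minus_equality f(1) rmod_homD(1) x)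
qed

lemma rmod_hom_inj:
  assumes f: "f \<in> rmod_hom A M N" "right_module A M" "right_module A N"
    and ker: "\<And>x. \<lbrakk>x \<in> carrier M; f x = \<zero>\<^bsub>N\<^esub>\<rbrakk> \<Longrightarrow> x = \<zero>\<^bsub>M\<^esub>"
  shows "inj_on f (carrier M)"
proof (rule inj_onI)
  interpret M: right_module A M by fact
  interpret N: right_module A N by fact
  fix x y assume xy: "x \<in> carrier M" "y \<in> carrier M" "f x = f y"
  have "f (x \<oplus>\<^bsub>M\<^esub> \<ominus>\<^bsub>M\<^esub> y) = \<zero>\<^bsub>N\<^esub>"
    using xy by (simp add: rmod_homD[OF f(1)] rmod_hom_minus[OF f] N.M.r_neg)
  hence "x \<oplus>\<^bsub>M\<^esub> \<ominus>\<^bsub>M\<^esub> y = \<zero>\<^bsub>M\<^esub>" using xy ker by auto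
  thus "x = y" using xy by (metis M.M.minus_equality M.M.minus_minus M.M.a_inv_closed)
qed

subsection \<open>Transport along bijections\<close>

text \<open>The fields \<open>mult\<close> and \<open>one\<close> stay undefined because a right
  module ignores the multiplicative part of its record.\<close>

definition transport :: "('m \<Rightarrow> 'n) \<Rightarrow> ('r, 'm) rmod \<Rightarrow> ('r, 'n) rmod" where
  "transport \<phi> M =
     \<lparr>carrier = \<phi> ` carrier M, mult = undefined, one = undefined, zero = \<phi> \<zero>\<^bsub>M\<^esub>,
      add = (\<lambda>x y. \<phi> (inv_into (carrier M) \<phi> x \<oplus>\<^bsub>M\<^esub> inv_into (carrier M) \<phi> y)),
      ract = (\<lambda>x a. \<phi> (inv_into (carrier M) \<phi> x \<triangleleft>\<^bsub>M\<^esub> a))\<rparr>"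

lemma right_module_transport:
  assumes M: "right_module A M" and inj: "inj_on \<phi> (carrier M)"
  shows "right_module A (transport \<phi> M)"
proof -
  interpret M: right_module A M by fact
  note [simp] = transport_def inj
  note [intro, simp] = M.ract_closed
  have "abelian_group (transport \<phi> M)"
  proof (rule abelian_groupI)
    fix x assume "x \<in> carrier (transport \<phi> M)"
    then obtain m where m: "m \<in> carrier M" "x = \<phi> m" by auto
    show "\<exists>y\<in>carrier (transport \<phi> M). y \<oplus>\<^bsub>transport \<phi> M\<^esub> x = \<zero>\<^bsub>transport \<phi> M\<^esub>"
      by (rule bexI[of _ "\<phi> (\<ominus>\<^bsub>M\<^esub> m)"]) (use m in \<open>auto simp: M.M.l_neg\<close>)
  qed (auto simp: M.M.a_ac)
  moreover have "right_module_axioms A (transport \<phi> M)"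
    by unfold_locales
       (auto simp: M.ract_add_left M.ract_add_right M.ract_mult M.ract_one)
  ultimately show ?thesis
    unfolding right_module_def using M.R.ring_axioms by auto
qed

lemma transport_hom:
  assumes "inj_on \<phi> (carrier M)"
  shows "\<phi> \<in> rmod_hom A M (transport \<phi> M)" "bij_betw \<phi> (carrier M) (carrier (transport \<phi> M))"
  using assms by (auto simp: rmod_hom_def transport_def bij_betw_def)

lemma fd_module_bij:
  assumes M: "fd_module A M" and N: "right_module A N"
    and f: "f \<in> rmod_hom A M N" and bij: "bij_betw f (carrier M) (carrier N)" and A: "kalgebra A"
  shows "fd_module A N"
proof -
  have Mr: "right_module A M" using M by (simp add: fd_module_def)
  interpret M: right_module A M by fact
  interpret N: right_module A N by fact
  interpret A: kalgebra A by fact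
  have inj: "inj_on f (carrier M)" and im: "f ` carrier M = carrier N"
    using bij by (auto simp: bij_betw_def)
  obtain B where B: "B \<subseteq> carrier M" "finite B"
    and gen: "\<And>m. m \<in> carrier M \<Longrightarrow> \<exists>c. m = (\<Oplus>\<^bsub>M\<^esub>b\<in>B. b \<triangleleft>\<^bsub>M\<^esub> (c b \<odot>\<^bsub>A\<^esub> \<one>\<^bsub>A\<^esub>))"
    using M unfolding fd_module_def by blast
  have "\<exists>d. n = (\<Oplus>\<^bsub>N\<^esub>b\<in>f ` B. b \<triangleleft>\<^bsub>N\<^esub> (d b \<odot>\<^bsub>A\<^esub> \<one>\<^bsub>A\<^esub>))" if n: "n \<in> carrier N" for n
  proof -
    obtain m where m: "m \<in> carrier M" "n = f m" using n im by auto
    obtain c where c: "m = (\<Oplus>\<^bsub>M\<^esub>b\<in>B. b \<triangleleft>\<^bsub>M\<^esub> (c b \<odot>\<^bsub>A\<^esub> \<one>\<^bsub>A\<^esub>))" using gen m by blast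
    \<comment> \<open>Coefficients are functions of the spanning elements themselves, so they are
      carried to the images through the inverse of \<open>f\<close>.\<close>
    let ?d = "\<lambda>y. c (inv_into (carrier M) f y)"
    have fB: "f b \<in> carrier N" "?d (f b) = c b" if "b \<in> B" for b
      using that B inj rmod_homD(1)[OF f] by auto
    have "n = (\<Oplus>\<^bsub>N\<^esub>b\<in>B. f (b \<triangleleft>\<^bsub>M\<^esub> (c b \<odot>\<^bsub>A\<^esub> \<one>\<^bsub>A\<^esub>)))"
      unfolding m(2) by (subst c, rule rmod_hom_finsum[OF f Mr N]) (use B in \<open>auto intro!: M.ract_closed\<close>)
    also have "\<dots> = (\<Oplus>\<^bsub>N\<^esub>b\<in>B. f b \<triangleleft>\<^bsub>N\<^esub> (?d (f b) \<odot>\<^bsub>A\<^esub> \<one>\<^bsub>A\<^esub>))"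
      by (rule N.M.finsum_cong') (use fB B in \<open>auto intro!: N.ract_closed simp: rmod_homD(3)[OF f]\<close>)
    also have "\<dots> = (\<Oplus>\<^bsub>N\<^esub>y\<in>f ` B. y \<triangleleft>\<^bsub>N\<^esub> (?d y \<odot>\<^bsub>A\<^esub> \<one>\<^bsub>A\<^esub>))"
      by (rule N.M.finsum_reindex[symmetric])
         (use fB B inj in \<open>auto intro!: N.ract_closed intro: inj_on_subset\<close>)
    finally show ?thesis by (rule exI[of _ ?d])
  qed
  moreover have "f ` B \<subseteq> carrier N" using B(1) im by blast
  ultimately show ?thesis
    unfolding fd_module_def using N B(2) by blast
qed

text \<open>A spanning set of \<open>n\<close> elements turns coefficient vectors into coordinates; no basis is
  needed, since the transported operations do not have to be pointwise.\<close>

lemma fd_module_coordinates: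
  fixes A :: "('k::field, 'r) module" and M :: "('r, 'm) rmod"
  assumes "fd_module A M" and A: "kalgebra A"
  obtains \<phi> :: "'m \<Rightarrow> nat \<Rightarrow> 'k" where "inj_on \<phi> (carrier M)"
proof -
  obtain B where B: "B \<subseteq> carrier M" "finite B"
    and gen: "\<forall>m\<in>carrier M. \<exists>c::'m \<Rightarrow> 'k. m = (\<Oplus>\<^bsub>M\<^esub>b\<in>B. b \<triangleleft>\<^bsub>M\<^esub> (c b \<odot>\<^bsub>A\<^esub> \<one>\<^bsub>A\<^esub>))"
    using assms unfolding fd_module_def by blast
  interpret M: right_module A M using assms by (simp add: fd_module_def)
  interpret A: kalgebra A by fact
  obtain c :: "'m \<Rightarrow> 'm \<Rightarrow> 'k"
    where c: "\<forall>m\<in>carrier M. m = (\<Oplus>\<^bsub>M\<^esub>b\<in>B. b \<triangleleft>\<^bsub>M\<^esub> (c m b \<odot>\<^bsub>A\<^esub> \<one>\<^bsub>A\<^esub>))"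
    using bchoice[OF gen] by blast
  obtain \<beta> :: "nat \<Rightarrow> 'm" and n where \<beta>: "B = \<beta> ` {i. i < n}"
    using finite_imp_nat_seg_image_inj_on[OF B(2)] by blast
  have "inj_on (\<lambda>m i. c m (\<beta> i)) (carrier M)"
  proof (rule inj_onI)
    fix x y assume xy: "x \<in> carrier M" "y \<in> carrier M" "(\<lambda>i. c x (\<beta> i)) = (\<lambda>i. c y (\<beta> i))"
    have cb: "c x b = c y b" if "b \<in> B" for b
      using that fun_cong[OF xy(3)] unfolding \<beta> by auto
    have "x = (\<Oplus>\<^bsub>M\<^esub>b\<in>B. b \<triangleleft>\<^bsub>M\<^esub> (c x b \<odot>\<^bsub>A\<^esub> \<one>\<^bsub>A\<^esub>))" using c xy by blast
    also have "\<dots> = (\<Oplus>\<^bsub>M\<^esub>b\<in>B. b \<triangleleft>\<^bsub>M\<^esub> (c y b \<odot>\<^bsub>A\<^esub> \<one>\<^bsub>A\<^esub>))"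
      by (rule M.M.finsum_cong') (use cb B in \<open>auto intro!: M.ract_closed\<close>)
    also have "\<dots> = y" using c xy by metis
    finally show "x = y" .
  qed
  thus ?thesis by (rule that)
qed

subsection \<open>Extension of functionals\<close>

context kalgebra
begin

definition subsp :: "('r, 'm) rmod \<Rightarrow> 'm set \<Rightarrow> bool" where
  "subsp M W \<longleftrightarrow> W \<subseteq> carrier M \<and> \<zero>\<^bsub>M\<^esub> \<in> W \<and> (\<forall>x\<in>W. \<forall>y\<in>W. x \<oplus>\<^bsub>M\<^esub> y \<in> W) \<and>
     (\<forall>x\<in>W. \<forall>c. scal M x c \<in> W)"

definition linear_on :: "('r, 'm) rmod \<Rightarrow> 'm set \<Rightarrow> ('m \<Rightarrow> 'k) \<Rightarrow> bool" where
  "linear_on M W f \<longleftrightarrow> (\<forall>x\<in>W. \<forall>y\<in>W. f (x \<oplus>\<^bsub>M\<^esub> y) = f x + f y) \<and>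
     (\<forall>x\<in>W. \<forall>c. f (scal M x c) = c * f x)"

lemma linear_onI:
  assumes "\<And>x y. \<lbrakk>x \<in> W; y \<in> W\<rbrakk> \<Longrightarrow> f (x \<oplus>\<^bsub>M\<^esub> y) = f x + f y"
    and "\<And>x c. x \<in> W \<Longrightarrow> f (scal M x c) = c * f x"
  shows "linear_on M W f"
  using assms by (simp add: linear_on_def)

lemma linear_onD:
  assumes "linear_on M W f"
  shows "\<lbrakk>x \<in> W; y \<in> W\<rbrakk> \<Longrightarrow> f (x \<oplus>\<^bsub>M\<^esub> y) = f x + f y"
    and "x \<in> W \<Longrightarrow> f (scal M x c) = c * f x"
  using assms by (auto simp: linear_on_def)

text \<open>Adjoining one vector: for \<open>b \<notin> W\<close> every element of
  \<open>W + k b\<close> is \<open>w + c b\<close> with a unique \<open>w\<close>, and the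
  functional is extended by zero on \<open>b\<close>.\<close>

lemma extend_functional_step:
  assumes M: "right_module A M" and W: "subsp M W" and f: "linear_on M W f" and b: "b \<in> carrier M"
  shows "\<exists>W' f'. subsp M W' \<and> insert b W \<subseteq> W' \<and> linear_on M W' f' \<and> (\<forall>w\<in>W. f' w = f w)"
proof (cases "b \<in> W")
  case True
  thus ?thesis using W f by blast
next
  case False
  interpret M: right_module A M by fact
  let ?s = "scal M"
  note [simp] = scal_closed[OF M] scal_scal[OF M] scal_add[OF M] b
  have Wc: "w \<in> carrier M" if "w \<in> W" for w using W that by (auto simp: subsp_def)
  have W0: "\<zero>\<^bsub>M\<^esub> \<in> W" and Wadd: "\<And>x y. x \<in> W \<Longrightarrow> y \<in> W \<Longrightarrow> x \<oplus>\<^bsub>M\<^esub> y \<in> W"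
    and Ws: "\<And>x c. x \<in> W \<Longrightarrow> ?s x c \<in> W" using W by (auto simp: subsp_def)
  \<comment> \<open>If \<open>c \<noteq> d\<close>, subtracting the two expressions puts
    \<open>(c - d) b\<close>, hence \<open>b\<close>, into \<open>W\<close>.\<close>
  have uniq: "w = v" if e: "w \<oplus>\<^bsub>M\<^esub> ?s b c = v \<oplus>\<^bsub>M\<^esub> ?s b d" and wv: "w \<in> W" "v \<in> W" for w v c d
  proof (cases "c = d")
    case True
    thus ?thesis using e wv by (simp add: Wc)
  next
    case ne: False
    have "?s b (c - d) = ?s b c \<oplus>\<^bsub>M\<^esub> ?s (?s b d) (-1)"
      using scal_add_right[OF M b, of c "- d"] by simp
    also have "\<dots> = ?s b c \<oplus>\<^bsub>M\<^esub> \<ominus>\<^bsub>M\<^esub> ?s b d" by (simp add: scal_minus[OF M] del: scal_scal)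
    also have "\<dots> = \<ominus>\<^bsub>M\<^esub> w \<oplus>\<^bsub>M\<^esub> (w \<oplus>\<^bsub>M\<^esub> ?s b c) \<oplus>\<^bsub>M\<^esub> \<ominus>\<^bsub>M\<^esub> ?s b d"
      using wv by (simp add: Wc M.M.a_assoc[symmetric] M.M.l_neg)
    also have "\<dots> = \<ominus>\<^bsub>M\<^esub> w \<oplus>\<^bsub>M\<^esub> v"
      unfolding e using wv by (simp add: Wc M.M.a_assoc M.M.r_neg)
    also have "\<dots> = ?s w (- 1) \<oplus>\<^bsub>M\<^esub> v" using wv by (simp add: scal_minus[OF M] Wc)
    finally have "?s b (c - d) \<in> W" using wv by (simp add: Wadd Ws)
    hence "?s (?s b (c - d)) (1 / (c - d)) \<in> W" by (rule Ws)
    moreover have "?s (?s b (c - d)) (1 / (c - d)) = b"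
      using ne by (simp add: scal_one[OF M])
    ultimately show ?thesis using False by simp
  qed
  let ?W = "{w \<oplus>\<^bsub>M\<^esub> ?s b c | w c. w \<in> W}"
  let ?f = "\<lambda>y. f (THE w. w \<in> W \<and> (\<exists>c. y = w \<oplus>\<^bsub>M\<^esub> ?s b c))"
  have fe: "?f (w \<oplus>\<^bsub>M\<^esub> ?s b c) = f w" if "w \<in> W" for w c
    by (rule arg_cong[where f = f], rule the_equality) (use that uniq in blast)+
  have ad: "(w \<oplus>\<^bsub>M\<^esub> ?s b c) \<oplus>\<^bsub>M\<^esub> (v \<oplus>\<^bsub>M\<^esub> ?s b d) = (w \<oplus>\<^bsub>M\<^esub> v) \<oplus>\<^bsub>M\<^esub> ?s b (c + d)"
    if "w \<in> W" "v \<in> W" for w v c d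
    using that by (simp add: Wc scal_add_right[OF M] M.M.a_ac)
  have sc: "?s (w \<oplus>\<^bsub>M\<^esub> ?s b c) d = ?s w d \<oplus>\<^bsub>M\<^esub> ?s b (c * d)" if "w \<in> W" for w c d
    using that by (simp add: Wc)
  have inW: "w = w \<oplus>\<^bsub>M\<^esub> ?s b 0" if "w \<in> W" for w
    using that by (simp add: scal_0[OF M] Wc)
  have "subsp M ?W"
    unfolding subsp_def
  proof (intro conjI ballI allI)
    show "\<zero>\<^bsub>M\<^esub> \<in> ?W" using inW[OF W0] W0 by blast
    fix x y c assume "x \<in> ?W"
    then obtain w d where x: "x = w \<oplus>\<^bsub>M\<^esub> ?s b d" "w \<in> W" by blast
    show "?s x c \<in> ?W" using sc[OF x(2)] Ws[OF x(2)] x by blast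
    assume "y \<in> ?W"
    then obtain v e where y: "y = v \<oplus>\<^bsub>M\<^esub> ?s b e" "v \<in> W" by blast
    show "x \<oplus>\<^bsub>M\<^esub> y \<in> ?W" using ad[OF x(2) y(2)] Wadd[OF x(2) y(2)] x y by blast
  qed (auto simp: Wc)
  moreover have "b \<in> ?W"
    using W0 scal_one[OF M b] M.M.l_zero[OF b] by (metis (mono_tags, lifting) mem_Collect_eq)
  moreover have "W \<subseteq> ?W" using inW by blast
  moreover have "linear_on M ?W ?f"
  proof (rule linear_onI)
    fix x y c assume "x \<in> ?W"
    then obtain w d where x: "x = w \<oplus>\<^bsub>M\<^esub> ?s b d" "w \<in> W" by blast
    show "?f (?s x c) = c * ?f x"
      unfolding x(1) sc[OF x(2)] fe[OF x(2)] fe[OF Ws[OF x(2)]] using linear_onD(2)[OF f x(2)] .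
    assume "y \<in> ?W"
    then obtain v e where y: "y = v \<oplus>\<^bsub>M\<^esub> ?s b e" "v \<in> W" by blast
    show "?f (x \<oplus>\<^bsub>M\<^esub> y) = ?f x + ?f y"
      unfolding x(1) y(1) ad[OF x(2) y(2)] fe[OF x(2)] fe[OF y(2)] fe[OF Wadd[OF x(2) y(2)]]
      using linear_onD(1)[OF f x(2) y(2)] .
  qed
  moreover have "?f w = f w" if "w \<in> W" for w
    using fe[OF that, of 0] inW[OF that] by simp
  ultimately show ?thesis
    by (intro exI[of _ ?W] exI[of _ ?f]) blast
qed

text \<open>Adjoining the finitely many elements of a spanning set one after another exhausts the
  module, so neither a basis nor Zorn's lemma is involved.\<close>

lemma extend_functional:
  assumes M: "fd_module A M" and W: "subsp M W" and f: "linear_on M W f"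
  shows "\<exists>g. linear_on M (carrier M) g \<and> (\<forall>w\<in>W. g w = f w)"
proof -
  have Mr: "right_module A M" using M by (simp add: fd_module_def)
  interpret M: right_module A M by fact
  obtain B where B: "B \<subseteq> carrier M" "finite B"
    and gen: "\<And>m. m \<in> carrier M \<Longrightarrow> \<exists>c. m = (\<Oplus>\<^bsub>M\<^esub>b\<in>B. b \<triangleleft>\<^bsub>M\<^esub> (c b \<odot> \<one>))"
    using M unfolding fd_module_def by blast
  have "\<exists>W' f'. subsp M W' \<and> B \<union> W \<subseteq> W' \<and> linear_on M W' f' \<and> (\<forall>w\<in>W. f' w = f w)"
    using B(2,1)
  proof (induction B)
    case empty
    thus ?case using W f by auto
  next
    case (insert b B)
    then obtain W' f' where *: "subsp M W'" "B \<union> W \<subseteq> W'" "linear_on M W' f'" "\<forall>w\<in>W. f' w = f w"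
      by auto
    obtain W'' f'' where **: "subsp M W''" "insert b W' \<subseteq> W''" "linear_on M W'' f''" "\<forall>w\<in>W'. f'' w = f' w"
      using extend_functional_step[OF Mr *(1,3), of b] insert.prems by blast
    show ?case
      using * ** by (intro exI[of _ W''] exI[of _ f'']) auto
  qed
  then obtain W' g where g: "subsp M W'" "B \<union> W \<subseteq> W'" "linear_on M W' g" "\<forall>w\<in>W. g w = f w"
    by blast
  have W': "W' \<subseteq> carrier M" "\<zero>\<^bsub>M\<^esub> \<in> W'" "\<And>x y. x \<in> W' \<Longrightarrow> y \<in> W' \<Longrightarrow> x \<oplus>\<^bsub>M\<^esub> y \<in> W'"
    "\<And>x c. x \<in> W' \<Longrightarrow> scal M x c \<in> W'" using g(1) by (auto simp: subsp_def)
  have sum: "(\<Oplus>\<^bsub>M\<^esub>b\<in>C. b \<triangleleft>\<^bsub>M\<^esub> (c b \<odot> \<one>)) \<in> W'" if "finite C" "C \<subseteq> W'" for C c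
    using that
  proof (induction C)
    case (insert b C)
    have "(\<lambda>b. b \<triangleleft>\<^bsub>M\<^esub> (c b \<odot> \<one>)) \<in> C \<rightarrow> carrier M" "b \<triangleleft>\<^bsub>M\<^esub> (c b \<odot> \<one>) \<in> carrier M"
      using insert.prems W'(1) by (auto intro!: M.ract_closed)
    thus ?case
      using insert W'(3,4) by (simp add: scal_def)
  qed (simp add: W')
  have "carrier M \<subseteq> W'" using gen sum[of B] g(2) B by (metis Un_subset_iff subsetI)
  hence "W' = carrier M" using W'(1) by blast
  thus ?thesis using g by blast
qed

text \<open>The field is injective over itself; the injectivity of the cofree modules
  \<open>C L \<tau>\<close> is derived from this.\<close>

lemma extend_functional_hom:
  assumes X: "right_module A X" and Y: "fd_module A Y" and f: "f \<in> rmod_hom A X Y"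
    and inj: "inj_on f (carrier X)" and l: "linear_on X (carrier X) l"
  obtains g where "linear_on Y (carrier Y) g" "\<And>x. x \<in> carrier X \<Longrightarrow> g (f x) = l x"
proof -
  have Yr: "right_module A Y" using Y by (simp add: fd_module_def)
  interpret X: right_module A X by fact
  interpret Y: right_module A Y by fact
  let ?W = "f ` carrier X" and ?l = "\<lambda>y. l (inv_into (carrier X) f y)"
  have lf: "?l (f x) = l x" if "x \<in> carrier X" for x using that inj by simp
  have scal_in: "scal Y (f x) c \<in> ?W" if "x \<in> carrier X" for x c
    using that rmod_hom_scal[OF f that, symmetric] scal_closed[OF X that] by auto
  have "subsp Y ?W"
    unfolding subsp_def
    using rmod_homD[OF f] rmod_hom_zero[OF f X Yr, symmetric] scal_in
    by (auto simp: rmod_homD(2)[OF f, symmetric])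
  moreover have "linear_on Y ?W ?l"
  proof (rule linear_onI)
    fix x y c assume "x \<in> ?W"
    then obtain u where u: "u \<in> carrier X" "x = f u" by blast
    show "?l (scal Y x c) = c * ?l x"
      unfolding u(2) rmod_hom_scal[OF f u(1), symmetric] lf[OF u(1)] lf[OF scal_closed[OF X u(1)]]
      using linear_onD(2)[OF l u(1)] .
    assume "y \<in> ?W"
    then obtain v where v: "v \<in> carrier X" "y = f v" by blast
    show "?l (x \<oplus>\<^bsub>Y\<^esub> y) = ?l x + ?l y"
      unfolding u(2) v(2) rmod_homD(2)[OF f u(1) v(1), symmetric] lf[OF u(1)] lf[OF v(1)]
        lf[OF X.M.a_closed[OF u(1) v(1)]]
      using linear_onD(1)[OF l u(1) v(1)] .
  qed
  ultimately obtain g where "linear_on Y (carrier Y) g" "\<forall>w\<in>?W. g w = ?l w"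
    using extend_functional[OF Y] by blast
  thus ?thesis using lf by (intro that) auto
qed

subsection \<open>Coordinate copies\<close>

lemma coordinate_copy:
  fixes M :: "('r, 'm) rmod"
  assumes M: "fd_module A M"
  obtains M' :: "('k, 'r) coord_rmod" and \<phi>
  where "\<phi> \<in> rmod_hom A M M'" "bij_betw \<phi> (carrier M) (carrier M')" "fd_module A M'"
proof -
  obtain \<phi> :: "'m \<Rightarrow> nat \<Rightarrow> 'k" where \<phi>: "inj_on \<phi> (carrier M)"
    using fd_module_coordinates[OF M kalgebra_axioms] .
  have Mr: "right_module A M" using M by (simp add: fd_module_def)
  note h = transport_hom(1)[OF \<phi>, of A] transport_hom(2)[OF \<phi>]
  show ?thesis
    using that[of \<phi> "transport \<phi> M"] h right_module_transport[OF Mr \<phi>]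
      fd_module_bij[OF M _ h(1) h(2) kalgebra_axioms] by blast
qed

section \<open>Projectivity and injectivity across carrier types\<close>

lemma projective_moduleD:
  fixes X Y :: "('k, 'r) coord_rmod"
  assumes "projective_module A P" "f \<in> rmod_hom A X Y" "g \<in> rmod_hom A P Y"
    "fd_module A X" "fd_module A Y" "f ` carrier X = carrier Y"
  shows "\<exists>h\<in>rmod_hom A P X. \<forall>p\<in>carrier P. f (h p) = g p"
  by (rule conjunct2[OF assms(1)[unfolded projective_module_def], rule_format]) (use assms in auto)

lemma injective_moduleD:
  fixes X Y :: "('k, 'r) coord_rmod"
  assumes "injective_module A E" "f \<in> rmod_hom A X Y" "g \<in> rmod_hom A X E"
    "fd_module A X" "fd_module A Y" "inj_on f (carrier X)"
  shows "\<exists>h\<in>rmod_hom A Y E. \<forall>x\<in>carrier X. h (f x) = g x"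
  by (rule conjunct2[OF assms(1)[unfolded injective_module_def], rule_format]) (use assms in auto)

lemma projective_module_bij:
  assumes P: "projective_module A P" and P': "right_module A P'"
    and f: "f \<in> rmod_hom A P P'" "bij_betw f (carrier P) (carrier P')"
  shows "projective_module A P'"
proof -
  have fdP: "fd_module A P" using P by (simp add: projective_module_def)
  hence Pr: "right_module A P" by (simp add: fd_module_def)
  let ?g = "inv_into (carrier P) f"
  have g: "?g \<in> rmod_hom A P' P" by (rule rmod_hom_inv[OF f Pr])
  have fg: "f (?g y) = y" "?g y \<in> carrier P" if "y \<in> carrier P'" for y
    using that f(2) by (auto simp: bij_betw_def f_inv_into_f inv_into_into)
  show ?thesis
    unfolding projective_module_def
  proof (intro conjI allI ballI impI)
    show "fd_module A P'" by (rule fd_module_bij[OF fdP P' f kalgebra_axioms])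
  next
    fix X Y :: "('k, 'r) coord_rmod" and u v
    assume u: "u \<in> rmod_hom A X Y" and v: "v \<in> rmod_hom A P' Y"
      and *: "fd_module A X \<and> fd_module A Y \<and> u ` carrier X = carrier Y"
    have "(\<lambda>x. v (f x)) \<in> rmod_hom A P Y" by (rule rmod_hom_compose[OF f(1) v])
    then obtain h where h: "h \<in> rmod_hom A P X" "\<forall>p\<in>carrier P. u (h p) = v (f p)"
      using projective_moduleD[OF P u] * by blast
    show "\<exists>h\<in>rmod_hom A P' X. \<forall>p\<in>carrier P'. u (h p) = v p"
      by (rule bexI[OF _ rmod_hom_compose[OF g h(1)]]) (use h(2) fg in auto)
  qed
qed

lemma injective_module_bij:
  assumes P: "injective_module A P" and P': "right_module A P'"
    and f: "f \<in> rmod_hom A P P'" "bij_betw f (carrier P) (carrier P')"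
  shows "injective_module A P'"
proof -
  have fdP: "fd_module A P" using P by (simp add: injective_module_def)
  hence Pr: "right_module A P" by (simp add: fd_module_def)
  let ?g = "inv_into (carrier P) f"
  have g: "?g \<in> rmod_hom A P' P" by (rule rmod_hom_inv[OF f Pr])
  have fg: "f (?g y) = y" "?g y \<in> carrier P" if "y \<in> carrier P'" for y
    using that f(2) by (auto simp: bij_betw_def f_inv_into_f inv_into_into)
  show ?thesis
    unfolding injective_module_def
  proof (intro conjI allI ballI impI)
    show "fd_module A P'" by (rule fd_module_bij[OF fdP P' f kalgebra_axioms])
  next
    fix X Y :: "('k, 'r) coord_rmod" and u v
    assume u: "u \<in> rmod_hom A X Y" and v: "v \<in> rmod_hom A X P'"
      and *: "fd_module A X \<and> fd_module A Y \<and> inj_on u (carrier X)"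
    have "(\<lambda>x. ?g (v x)) \<in> rmod_hom A X P" by (rule rmod_hom_compose[OF v g])
    then obtain h where h: "h \<in> rmod_hom A Y P" "\<forall>x\<in>carrier X. h (u x) = ?g (v x)"
      using injective_moduleD[OF P u] * by blast
    show "\<exists>h\<in>rmod_hom A Y P'. \<forall>x\<in>carrier X. h (u x) = v x"
      by (rule bexI[OF _ rmod_hom_compose[OF h(1) f(1)]]) (use h(2) fg rmod_homD(1)[OF v] in auto)
  qed
qed

text \<open>The definition tests against coordinate modules only. Copying \<open>X\<close> and
  \<open>Y\<close> there, lifting, and returning by the inverse isomorphism gives the lifting
  property for test modules of any carrier type.\<close>

lemma projective_lift:
  assumes P: "projective_module A P" and X: "fd_module A X" and Y: "fd_module A Y"
    and f: "f \<in> rmod_hom A X Y" "f ` carrier X = carrier Y" and g: "g \<in> rmod_hom A P Y"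
  obtains h where "h \<in> rmod_hom A P X" "\<And>p. p \<in> carrier P \<Longrightarrow> f (h p) = g p"
proof -
  obtain X' :: "('k, 'r) coord_rmod" and \<phi> where
    \<phi>: "\<phi> \<in> rmod_hom A X X'" "bij_betw \<phi> (carrier X) (carrier X')" and X': "fd_module A X'"
    using coordinate_copy[OF X] by metis
  obtain Y' :: "('k, 'r) coord_rmod" and \<psi> where
    \<psi>: "\<psi> \<in> rmod_hom A Y Y'" "bij_betw \<psi> (carrier Y) (carrier Y')" and Y': "fd_module A Y'"
    using coordinate_copy[OF Y] by metis
  let ?i = "inv_into (carrier X) \<phi>"
  have i: "?i \<in> rmod_hom A X' X"
    by (rule rmod_hom_inv[OF \<phi>]) (use X in \<open>simp add: fd_module_def\<close>)
  have im: "?i ` carrier X' = carrier X"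
    using \<phi>(2) bij_betw_inv_into bij_betw_imp_surj_on by blast
  have "(\<lambda>x. \<psi> (f (?i x))) \<in> rmod_hom A X' Y'"
    by (intro rmod_hom_compose[OF _ \<psi>(1)] rmod_hom_compose[OF i f(1)])
  moreover have "(\<lambda>x. \<psi> (f (?i x))) ` carrier X' = carrier Y'"
    using im f(2) \<psi>(2) unfolding bij_betw_def by (metis image_image)
  moreover have "(\<lambda>x. \<psi> (g x)) \<in> rmod_hom A P Y'" by (rule rmod_hom_compose[OF g \<psi>(1)])
  ultimately obtain h where h: "h \<in> rmod_hom A P X'" "\<forall>p\<in>carrier P. \<psi> (f (?i (h p))) = \<psi> (g p)"
    using projective_moduleD[OF P _ _ X' Y'] by blast
  show ?thesis
  proof (rule that)
    show "(\<lambda>p. ?i (h p)) \<in> rmod_hom A P X" by (rule rmod_hom_compose[OF h(1) i])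
    fix p assume p: "p \<in> carrier P"
    have "f (?i (h p)) \<in> carrier Y" "g p \<in> carrier Y"
      using p h(1) i f(1) g by (auto dest!: rmod_homD(1))
    thus "f (?i (h p)) = g p" using h(2) p \<psi>(2) by (auto simp: bij_betw_def inj_on_def)
  qed
qed

text \<open>The same transport for extensions; the copied map stays injective because both
  coordinate maps are bijections.\<close>

lemma injective_extend:
  assumes E: "injective_module A E" and X: "fd_module A X" and Y: "fd_module A Y"
    and f: "f \<in> rmod_hom A X Y" "inj_on f (carrier X)" and g: "g \<in> rmod_hom A X E"
  obtains h where "h \<in> rmod_hom A Y E" "\<And>x. x \<in> carrier X \<Longrightarrow> h (f x) = g x"
proof -
  obtain X' :: "('k, 'r) coord_rmod" and \<phi> where
    \<phi>: "\<phi> \<in> rmod_hom A X X'" "bij_betw \<phi> (carrier X) (carrier X')" and X': "fd_module A X'"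
    using coordinate_copy[OF X] by metis
  obtain Y' :: "('k, 'r) coord_rmod" and \<psi> where
    \<psi>: "\<psi> \<in> rmod_hom A Y Y'" "bij_betw \<psi> (carrier Y) (carrier Y')" and Y': "fd_module A Y'"
    using coordinate_copy[OF Y] by metis
  let ?i = "inv_into (carrier X) \<phi>"
  have i: "?i \<in> rmod_hom A X' X"
    by (rule rmod_hom_inv[OF \<phi>]) (use X in \<open>simp add: fd_module_def\<close>)
  have bi: "bij_betw ?i (carrier X') (carrier X)" by (rule bij_betw_inv_into[OF \<phi>(2)])
  have "(\<lambda>x. \<psi> (f (?i x))) \<in> rmod_hom A X' Y'"
    by (intro rmod_hom_compose[OF _ \<psi>(1)] rmod_hom_compose[OF i f(1)])
  moreover have "inj_on (\<lambda>x. \<psi> (f (?i x))) (carrier X')"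
  proof (rule inj_onI)
    fix x y assume xy: "x \<in> carrier X'" "y \<in> carrier X'" "\<psi> (f (?i x)) = \<psi> (f (?i y))"
    have c: "?i x \<in> carrier X" "?i y \<in> carrier X" using xy rmod_homD(1)[OF i] by auto
    have "f (?i x) = f (?i y)"
      using xy(3) c rmod_homD(1)[OF f(1)] \<psi>(2) by (auto simp: bij_betw_def inj_on_def)
    hence "?i x = ?i y" using c f(2) by (auto simp: inj_on_def)
    thus "x = y" using xy bi by (auto simp: bij_betw_def inj_on_def)
  qed
  moreover have "(\<lambda>x. g (?i x)) \<in> rmod_hom A X' E" by (rule rmod_hom_compose[OF i g])
  ultimately obtain h where h: "h \<in> rmod_hom A Y' E" "\<forall>x\<in>carrier X'. h (\<psi> (f (?i x))) = g (?i x)"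
    using injective_moduleD[OF E _ _ X' Y'] by blast
  show ?thesis
  proof (rule that)
    show "(\<lambda>p. h (\<psi> p)) \<in> rmod_hom A Y E" by (rule rmod_hom_compose[OF \<psi>(1) h(1)])
    fix x assume x: "x \<in> carrier X"
    then obtain x' where "x' \<in> carrier X'" "?i x' = x"
      by (metis bij_betw_imp_surj_on[OF bi] imageE)
    thus "h (\<psi> (f x)) = g x" using h(2) by auto
  qed
qed

subsection \<open>Projective dimension\<close>

text \<open>A bound together with its witnessing resolution: the infimum in \<open>pdim\<close> is
  awkward in inductions along exact sequences, and \<open>pdim_le\<close> converts back.\<close>

definition pd_le :: "nat \<Rightarrow> ('r, 'm) rmod \<Rightarrow> bool" where
  "pd_le n M \<longleftrightarrow> (\<exists>P e d. projective_resolution A M P e d \<and> (\<forall>i>n. carrier (P i) = {\<zero>\<^bsub>P i\<^esub>}))"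

lemma pdim_le: "pd_le n M \<Longrightarrow> pdim A M \<le> enat n"
  unfolding pdim_def pd_le_def by (rule Inf_lower) blast

text \<open>Resolutions are indexed by all natural numbers, so a finite one has to be padded with
  zero modules.\<close>

definition zero_rmod :: "('k, 'r) coord_rmod" where
  "zero_rmod = \<lparr>carrier = {\<lambda>_. 0}, mult = undefined, one = undefined, zero = \<lambda>_. 0,
     add = (\<lambda>_ _ _. 0), ract = (\<lambda>_ _ _. 0)\<rparr>"

lemma zero_rmod_simps [simp]:
  "carrier zero_rmod = {\<lambda>_. 0}" "\<zero>\<^bsub>zero_rmod\<^esub> = (\<lambda>_. 0)" "x \<oplus>\<^bsub>zero_rmod\<^esub> y = (\<lambda>_. 0)"
  "x \<triangleleft>\<^bsub>zero_rmod\<^esub> a = (\<lambda>_. 0)"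
  by (simp_all add: zero_rmod_def)

lemma right_module_zero_rmod: "right_module A zero_rmod"
  by (intro right_module.intro right_module_axioms.intro abelian_groupI ring_axioms) auto

lemma projective_zero_rmod: "projective_module A zero_rmod"
  unfolding projective_module_def
proof (intro conjI allI ballI impI)
  interpret Z: right_module A zero_rmod by (rule right_module_zero_rmod)
  show "fd_module A zero_rmod"
    unfolding fd_module_def using right_module_zero_rmod
    by (intro conjI exI[of _ "{}"]) auto
next
  fix X Y :: "('k, 'r) coord_rmod" and f g
  assume fg: "f \<in> rmod_hom A X Y" "g \<in> rmod_hom A zero_rmod Y"
    and *: "fd_module A X \<and> fd_module A Y \<and> f ` carrier X = carrier Y"
  hence XY: "right_module A X" "right_module A Y" by (auto simp: fd_module_def)
  interpret X: right_module A X by fact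
  have "(\<lambda>_. \<zero>\<^bsub>X\<^esub>) \<in> rmod_hom A zero_rmod X"
    by (rule rmod_homI) (auto simp: X.ract_zero_left)
  thus "\<exists>h\<in>rmod_hom A zero_rmod X. \<forall>p\<in>carrier zero_rmod. f (h p) = g p"
    by (rule bexI[rotated])
       (use rmod_hom_zero[OF fg(1) XY] rmod_hom_zero[OF fg(2) right_module_zero_rmod XY(2)] in simp)
qed

lemma a_kernel_eq: "a_kernel M N f = {x \<in> carrier M. f x = \<zero>\<^bsub>N\<^esub>}"
  by (simp add: a_kernel_def')

lemma pd_le_0:
  assumes P: "projective_module A P" and M: "right_module A M"
    and f: "f \<in> rmod_hom A P M" "bij_betw f (carrier P) (carrier M)"
  shows "pd_le 0 M"
proof -
  have M': "projective_module A M" by (rule projective_module_bij[OF P M f])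
  hence fdM: "fd_module A M" by (simp add: projective_module_def)
  obtain M' :: "('k, 'r) coord_rmod" and \<phi> where
    \<phi>: "\<phi> \<in> rmod_hom A M M'" "bij_betw \<phi> (carrier M) (carrier M')" and fdM': "fd_module A M'"
    using coordinate_copy[OF fdM] by metis
  have Mr': "right_module A M'" using fdM' by (simp add: fd_module_def)
  interpret M': right_module A M' by fact
  let ?i = "inv_into (carrier M) \<phi>"
  have i: "?i \<in> rmod_hom A M' M" by (rule rmod_hom_inv[OF \<phi> M])
  have bi: "bij_betw ?i (carrier M') (carrier M)" by (rule bij_betw_inv_into[OF \<phi>(2)])
  let ?P = "\<lambda>n::nat. if n = 0 then M' else zero_rmod"
  let ?d = "\<lambda>(n::nat) x::nat \<Rightarrow> 'k. if n = 0 then \<zero>\<^bsub>M'\<^esub> else (\<lambda>_. 0)"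
  have z: "?i \<zero>\<^bsub>M'\<^esub> = \<zero>\<^bsub>M\<^esub>" by (rule rmod_hom_zero[OF i Mr' M])
  have "projective_resolution A M ?P ?i ?d"
    unfolding projective_resolution_def
  proof (intro conjI allI)
    show "projective_module A (?P n)" for n
      using projective_zero_rmod projective_module_bij[OF M' Mr' \<phi>] by simp
    show "?d n \<in> rmod_hom A (?P (Suc n)) (?P n)" for n
      by (rule rmod_homI) (auto simp: M'.ract_zero_left)
    have "x = \<zero>\<^bsub>M'\<^esub>" if "x \<in> carrier M'" "?i x = \<zero>\<^bsub>M\<^esub>" for x
      using that z bi M'.M.zero_closed unfolding bij_betw_def inj_on_def by metis
    thus "?d 0 ` carrier (?P 1) = a_kernel (?P 0) M ?i"
      using z by (auto simp: a_kernel_eq)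
  qed (use i bi fdM in \<open>auto simp: a_kernel_eq bij_betw_def\<close>)
  thus ?thesis unfolding pd_le_def by (intro exI[of _ ?P] exI[of _ ?i] exI[of _ ?d]) simp
qed

text \<open>Splicing: the resolution of the kernel \<open>K\<close> is shifted by one and continued
  by a copy of \<open>P\<close>. Injectivity of \<open>\<iota>\<close> ensures that the composite
  from \<open>PK 0\<close> through \<open>K\<close> has the same kernel as \<open>e\<close>.\<close>

lemma pd_le_step:
  fixes P :: "('r, 'p) rmod" and K :: "('r, 'q) rmod"
  assumes P: "projective_module A P" and M: "fd_module A M"
    and f: "f \<in> rmod_hom A P M" "f ` carrier P = carrier M"
    and \<iota>: "\<iota> \<in> rmod_hom A K P" "inj_on \<iota> (carrier K)"
    and ex: "\<iota> ` carrier K = {x \<in> carrier P. f x = \<zero>\<^bsub>M\<^esub>}"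
    and K: "pd_le n K"
  shows "pd_le (Suc n) M"
proof -
  obtain PK e d where res: "projective_resolution A K PK e d"
    and zero: "\<And>i. i > n \<Longrightarrow> carrier (PK i) = {\<zero>\<^bsub>PK i\<^esub>}"
    using K unfolding pd_le_def by blast
  have fdP: "fd_module A P" using P by (simp add: projective_module_def)
  hence Pr: "right_module A P" by (simp add: fd_module_def)
  have Kr: "right_module A K" using res by (simp add: projective_resolution_def fd_module_def)
  interpret K: right_module A K by fact
  obtain P' :: "('k, 'r) coord_rmod" and \<phi> where
    \<phi>: "\<phi> \<in> rmod_hom A P P'" "bij_betw \<phi> (carrier P) (carrier P')" and fdP': "fd_module A P'"
    using coordinate_copy[OF fdP] by metis
  have Pr': "right_module A P'" using fdP' by (simp add: fd_module_def)
  let ?i = "inv_into (carrier P) \<phi>"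
  have i: "?i \<in> rmod_hom A P' P" by (rule rmod_hom_inv[OF \<phi> Pr])
  have bi: "bij_betw ?i (carrier P') (carrier P)" by (rule bij_betw_inv_into[OF \<phi>(2)])
  have \<phi>i: "\<phi> (?i y) = y" "?i y \<in> carrier P" if "y \<in> carrier P'" for y
    using that \<phi>(2) by (auto simp: bij_betw_def f_inv_into_f inv_into_into)
  have i\<phi>: "?i (\<phi> x) = x" if "x \<in> carrier P" for x using that \<phi>(2) by (simp add: bij_betw_def)
  have e: "e \<in> rmod_hom A (PK 0) K" "e ` carrier (PK 0) = carrier K"
    and d: "\<And>i. d i \<in> rmod_hom A (PK (Suc i)) (PK i)"
    and exe: "d 0 ` carrier (PK 1) = a_kernel (PK 0) K e"
    and exd: "\<And>i. d (Suc i) ` carrier (PK (Suc (Suc i))) = a_kernel (PK (Suc i)) (PK i) (d i)"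
    and PK: "\<And>i. projective_module A (PK i)"
    using res unfolding projective_resolution_def by auto
  let ?P = "case_nat P' PK" and ?e = "\<lambda>x. f (?i x)" and ?d = "case_nat (\<lambda>x. \<phi> (\<iota> (e x))) d"
  have "projective_resolution A M ?P ?e ?d"
    unfolding projective_resolution_def
  proof (intro conjI allI)
    show "projective_module A (?P n)" for n
      using PK projective_module_bij[OF P Pr' \<phi>] by (cases n) auto
    show "?e \<in> rmod_hom A (?P 0) M" using rmod_hom_compose[OF i f(1)] by simp
    show "?d n \<in> rmod_hom A (?P (Suc n)) (?P n)" for n
      using d rmod_hom_compose[OF rmod_hom_compose[OF e(1) \<iota>(1)] \<phi>(1)] by (cases n) auto
    show "?e ` carrier (?P 0) = carrier M"
      using bi f(2) unfolding bij_betw_def by (metis image_image old.nat.simps(4))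
    have "?d 0 ` carrier (?P 1) = \<phi> ` \<iota> ` e ` carrier (PK 0)" by (simp add: image_image)
    also have "\<dots> = \<phi> ` {x \<in> carrier P. f x = \<zero>\<^bsub>M\<^esub>}" by (simp only: e(2) ex)
    also have "\<dots> = a_kernel P' M ?e"
      using i\<phi> \<phi>i rmod_homD(1)[OF \<phi>(1)] by (force simp: a_kernel_eq image_iff)
    finally show "?d 0 ` carrier (?P 1) = a_kernel (?P 0) M ?e" by simp
    show "?d (Suc n) ` carrier (?P (Suc (Suc n))) = a_kernel (?P (Suc n)) (?P n) (?d n)" for n
    proof (cases n)
      case 0
      have "\<phi> (\<iota> (e x)) = \<zero>\<^bsub>P'\<^esub> \<longleftrightarrow> e x = \<zero>\<^bsub>K\<^esub>" if "x \<in> carrier (PK 0)" for x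
      proof -
        have c: "e x \<in> carrier K" "\<iota> (e x) \<in> carrier P"
          using that rmod_homD(1)[OF e(1)] rmod_homD(1)[OF \<iota>(1)] by auto
        have "\<phi> \<zero>\<^bsub>P\<^esub> = \<zero>\<^bsub>P'\<^esub>" "\<iota> \<zero>\<^bsub>K\<^esub> = \<zero>\<^bsub>P\<^esub>"
          using rmod_hom_zero \<phi>(1) \<iota>(1) Pr Pr' Kr by blast+
        thus ?thesis
          using c \<phi>(2) \<iota>(2) K.M.zero_closed rmod_homD(1)[OF \<iota>(1)]
          unfolding bij_betw_def inj_on_def by metis
      qed
      thus ?thesis using exe 0 by (auto simp: a_kernel_eq)
    qed (use exd in auto)
  qed (use M in auto)
  moreover have "carrier (?P i) = {\<zero>\<^bsub>?P i\<^esub>}" if "i > Suc n" for i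
    using that zero by (cases i) auto
  ultimately show ?thesis
    unfolding pd_le_def by (intro exI[of _ ?P] exI[of _ ?e] exI[of _ ?d]) blast
qed

lemma pd_le_bij:
  assumes M: "pd_le n M" and N: "right_module A N"
    and f: "f \<in> rmod_hom A M N" "bij_betw f (carrier M) (carrier N)"
  shows "pd_le n N"
proof -
  obtain P e d where res: "projective_resolution A M P e d"
    and zero: "\<forall>i>n. carrier (P i) = {\<zero>\<^bsub>P i\<^esub>}"
    using M unfolding pd_le_def by blast
  have fdM: "fd_module A M" and e: "e \<in> rmod_hom A (P 0) M" "e ` carrier (P 0) = carrier M"
    using res unfolding projective_resolution_def by auto
  have Mr: "right_module A M" using fdM by (simp add: fd_module_def)
  interpret M: right_module A M by fact
  have "f (e x) = \<zero>\<^bsub>N\<^esub> \<longleftrightarrow> e x = \<zero>\<^bsub>M\<^esub>" if "x \<in> carrier (P 0)" for x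
    using that rmod_homD(1)[OF e(1)] f(2) M.M.zero_closed rmod_hom_zero[OF f(1) Mr N]
    unfolding bij_betw_def inj_on_def by metis
  hence "a_kernel (P 0) N (\<lambda>x. f (e x)) = a_kernel (P 0) M e"
    by (auto simp: a_kernel_eq)
  moreover have "(\<lambda>x. f (e x)) ` carrier (P 0) = carrier N"
    using e(2) f(2) unfolding bij_betw_def by (metis image_image)
  ultimately have "projective_resolution A N P (\<lambda>x. f (e x)) d"
    using res fd_module_bij[OF fdM N f kalgebra_axioms] rmod_hom_compose[OF e(1) f(1)]
    unfolding projective_resolution_def by auto
  thus ?thesis using zero unfolding pd_le_def by blast
qed

text \<open>The infimum of a nonempty set of extended naturals is attained, so dimension 0 provides
  a resolution with \<open>P 1\<close> zero, whose augmentation is then an isomorphism.\<close>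

lemma pdim_0_projective:
  assumes "pdim A M \<le> 0"
  shows "projective_module A M"
proof -
  let ?S = "{enat n | n. \<exists>P e d. projective_resolution A M P e d \<and> (\<forall>i>n. carrier (P i) = {\<zero>\<^bsub>P i\<^esub>})}"
  have "Inf ?S \<le> 0" using assms unfolding pdim_def .
  hence 0: "Inf ?S = 0" by simp
  \<comment> \<open>An empty set would have infimum infinity.\<close>
  have "?S \<noteq> {}"
  proof
    assume "?S = {}"
    hence "Inf ?S = \<infinity>" by (simp only: Inf_enat_def) simp
    thus False using 0 by simp
  qed
  hence "Inf ?S \<in> ?S" by (meson wellorder_InfI ex_in_conv)
  then obtain n where n: "enat n = 0" "pd_le n M" unfolding 0 pd_le_def by fastforce
  then obtain P e d where res: "projective_resolution A M P e d"
    and zero: "\<forall>i>0. carrier (P i) = {\<zero>\<^bsub>P i\<^esub>}"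
    unfolding pd_le_def by (auto simp: zero_enat_def)
  have P: "\<And>i. projective_module A (P i)" and Mr: "right_module A M"
    and e: "e \<in> rmod_hom A (P 0) M" "e ` carrier (P 0) = carrier M"
    and d: "d 0 \<in> rmod_hom A (P 1) (P 0)" and ex: "d 0 ` carrier (P 1) = a_kernel (P 0) M e"
    using res unfolding projective_resolution_def fd_module_def by auto
  have Pr: "right_module A (P i)" for i using P by (simp add: projective_module_def fd_module_def)
  have "a_kernel (P 0) M e = {\<zero>\<^bsub>P 0\<^esub>}"
    using ex zero rmod_hom_zero[OF d Pr Pr] by auto
  hence "inj_on e (carrier (P 0))"
    by (intro rmod_hom_inj[OF e(1) Pr Mr]) (auto simp: a_kernel_eq)
  hence "bij_betw e (carrier (P 0)) (carrier M)" using e by (simp add: bij_betw_def)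
  thus ?thesis by (rule projective_module_bij[OF P Mr e(1)])
qed

subsection \<open>Injective resolutions\<close>

lemma rsubmoduleI:
  assumes M: "right_module A M" and U: "U \<subseteq> carrier M" "\<zero>\<^bsub>M\<^esub> \<in> U"
    and "\<And>x y. \<lbrakk>x \<in> U; y \<in> U\<rbrakk> \<Longrightarrow> x \<oplus>\<^bsub>M\<^esub> y \<in> U"
    and act: "\<And>x a. \<lbrakk>x \<in> U; a \<in> carrier A\<rbrakk> \<Longrightarrow> x \<triangleleft>\<^bsub>M\<^esub> a \<in> U"
  shows "rsubmodule A U M"
proof -
  interpret M: right_module A M by fact
  \<comment> \<open>Negation is the action of \<open>- 1\<close> times the unit, so closure under
    the action covers it.\<close>
  have "\<ominus>\<^bsub>M\<^esub> x \<in> U" if "x \<in> U" for x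
    using act[OF that, of "(- 1) \<odot> \<one>"] scal_minus[OF M, of x] that U(1)
    by (auto simp: scal_def)
  hence "additive_subgroup U M"
    using assms by (intro additive_subgroupI M.M.add.subgroupI) (auto simp: a_inv_def[symmetric])
  thus ?thesis using assms by (simp add: rsubmodule_def)
qed

lemma rsubmoduleD:
  assumes "rsubmodule A U M"
  shows "U \<subseteq> carrier M" "\<zero>\<^bsub>M\<^esub> \<in> U" "\<And>x y. \<lbrakk>x \<in> U; y \<in> U\<rbrakk> \<Longrightarrow> x \<oplus>\<^bsub>M\<^esub> y \<in> U"
    "\<And>x a. \<lbrakk>x \<in> U; a \<in> carrier A\<rbrakk> \<Longrightarrow> x \<triangleleft>\<^bsub>M\<^esub> a \<in> U"
  using assms unfolding rsubmodule_def
  by (auto dest: additive_subgroup.zero_closed additive_subgroup.a_closed)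

lemma rsubmodule_image:
  assumes "right_module A M" "right_module A N" "f \<in> rmod_hom A M N"
  shows "rsubmodule A (f ` carrier M) N"
proof (rule rsubmoduleI)
  interpret M: right_module A M by fact
  show "\<zero>\<^bsub>N\<^esub> \<in> f ` carrier M"
    using rmod_hom_zero[OF assms(3,1,2)] M.M.zero_closed by (metis imageI)
  show "x \<oplus>\<^bsub>N\<^esub> y \<in> f ` carrier M" if xy: "x \<in> f ` carrier M" "y \<in> f ` carrier M" for x y
    using xy by (auto simp: rmod_homD(2)[OF assms(3), symmetric])
  show "x \<triangleleft>\<^bsub>N\<^esub> a \<in> f ` carrier M" if "x \<in> f ` carrier M" "a \<in> carrier A" for x a
    using that by (auto simp: rmod_homD(3)[OF assms(3), symmetric] M.ract_closed)
qed (use assms rmod_homD in auto)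

lemma essential_in_bij:
  assumes U: "essential_in A U M" and M: "right_module A M" and N: "right_module A N"
    and f: "f \<in> rmod_hom A M N" "bij_betw f (carrier M) (carrier N)"
  shows "essential_in A (f ` U) N"
proof -
  interpret M: right_module A M by fact
  have sub: "rsubmodule A U M" using U by (simp add: essential_in_def)
  note Us = rsubmoduleD[OF sub]
  have Uc: "x \<in> carrier M" if "x \<in> U" for x using that Us(1) by blast
  have f0: "f \<zero>\<^bsub>M\<^esub> = \<zero>\<^bsub>N\<^esub>" by (rule rmod_hom_zero[OF f(1) M N])
  have inj: "x = y" if "x \<in> carrier M" "y \<in> carrier M" "f x = f y" for x y
    using that f(2) by (auto simp: bij_betw_def inj_on_def)
  have "rsubmodule A (f ` U) N"
  proof (rule rsubmoduleI[OF N])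
    show "\<zero>\<^bsub>N\<^esub> \<in> f ` U" using f0 Us(2) by (metis imageI)
    show "x \<oplus>\<^bsub>N\<^esub> y \<in> f ` U" if xy: "x \<in> f ` U" "y \<in> f ` U" for x y
      using xy Us(3) by (auto simp: rmod_homD(2)[OF f(1) Uc Uc, symmetric])
    show "x \<triangleleft>\<^bsub>N\<^esub> a \<in> f ` U" if "x \<in> f ` U" "a \<in> carrier A" for x a
      using that Us(4) by (auto simp: rmod_homD(3)[OF f(1) Uc, symmetric])
  qed (use Uc rmod_homD(1)[OF f(1)] in auto)
  moreover have "V = {\<zero>\<^bsub>N\<^esub>}" if V: "rsubmodule A V N" "V \<inter> f ` U = {\<zero>\<^bsub>N\<^esub>}" for V
  proof -
    note Vs = rsubmoduleD[OF V(1)]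
    let ?V = "{x \<in> carrier M. f x \<in> V}"
    have "rsubmodule A ?V M"
      by (rule rsubmoduleI[OF M]) (use Vs f0 rmod_homD[OF f(1)] M.ract_closed in auto)
    moreover have "?V \<inter> U = {\<zero>\<^bsub>M\<^esub>}"
    proof (intro equalityI subsetI)
      fix x assume x: "x \<in> ?V \<inter> U"
      hence "f x = \<zero>\<^bsub>N\<^esub>" using V(2) by blast
      thus "x \<in> {\<zero>\<^bsub>M\<^esub>}" using x f0 inj[of x "\<zero>\<^bsub>M\<^esub>"] by simp
    qed (use Us Vs f0 in auto)
    ultimately have V0: "?V = {\<zero>\<^bsub>M\<^esub>}" using U by (simp add: essential_in_def)
    have "y = \<zero>\<^bsub>N\<^esub>" if "y \<in> V" for y
    proof -
      obtain x where "x \<in> carrier M" "y = f x"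
        using \<open>y \<in> V\<close> Vs(1) f(2) by (auto simp: bij_betw_def)
      moreover from this have "x \<in> {\<zero>\<^bsub>M\<^esub>}" using that unfolding V0[symmetric] by simp
      ultimately show ?thesis using f0 by simp
    qed
    thus ?thesis using Vs(2) by blast
  qed
  ultimately show ?thesis by (simp add: essential_in_def)
qed

text \<open>The resolution is built from functions on paths, whereas the definition asks for
  coordinate modules. The isomorphisms \<open>\<phi> i\<close> are returned as well, because bounds
  on projective dimensions and the vanishing of terms are carried over along them.\<close>

lemma minimal_injective_resolution_copy:
  fixes E :: "nat \<Rightarrow> ('r, 'l) rmod"
  assumes M: "fd_module A M" and E: "\<And>i. injective_module A (E i)"
    and e: "e \<in> rmod_hom A M (E 0)" "inj_on e (carrier M)"
    and d: "\<And>i. d i \<in> rmod_hom A (E i) (E (Suc i))"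
    and exe: "e ` carrier M = {x \<in> carrier (E 0). d 0 x = \<zero>\<^bsub>E 1\<^esub>}"
    and exd: "\<And>i. d i ` carrier (E i) = {x \<in> carrier (E (Suc i)). d (Suc i) x = \<zero>\<^bsub>E (Suc (Suc i))\<^esub>}"
    and mine: "essential_in A (e ` carrier M) (E 0)"
    and mind: "\<And>i. essential_in A (d i ` carrier (E i)) (E (Suc i))"
  obtains E' :: "nat \<Rightarrow> ('k, 'r) coord_rmod" and e' d' \<phi>
  where "minimal_injective_resolution A M E' e' d'"
    "\<And>i. \<phi> i \<in> rmod_hom A (E i) (E' i)" "\<And>i. bij_betw (\<phi> i) (carrier (E i)) (carrier (E' i))"
proof -
  have fdE: "fd_module A (E i)" for i using E by (simp add: injective_module_def)
  hence Er: "right_module A (E i)" for i by (simp add: fd_module_def)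
  have "\<exists>(E' :: ('k, 'r) coord_rmod) \<phi>. \<phi> \<in> rmod_hom A (E i) E' \<and> bij_betw \<phi> (carrier (E i)) (carrier E') \<and> fd_module A E'" for i
    using coordinate_copy[OF fdE[of i]] by metis
  then obtain E' :: "nat \<Rightarrow> ('k, 'r) coord_rmod" and \<phi> where
    \<phi>: "\<And>i. \<phi> i \<in> rmod_hom A (E i) (E' i)" "\<And>i. bij_betw (\<phi> i) (carrier (E i)) (carrier (E' i))"
    and fdE': "\<And>i. fd_module A (E' i)" by metis
  have Er': "right_module A (E' i)" for i using fdE' by (simp add: fd_module_def)
  let ?i = "\<lambda>n. inv_into (carrier (E n)) (\<phi> n)"
  have i: "?i n \<in> rmod_hom A (E' n) (E n)" for n by (rule rmod_hom_inv[OF \<phi> Er])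
  have bi: "?i n ` carrier (E' n) = carrier (E n)" for n
    using bij_betw_inv_into[OF \<phi>(2)] by (simp add: bij_betw_def)
  have \<phi>i: "\<phi> n (?i n y) = y" "?i n y \<in> carrier (E n)" if "y \<in> carrier (E' n)" for n y
    using that \<phi>(2)[of n] by (auto simp: bij_betw_def f_inv_into_f inv_into_into)
  have i\<phi>: "?i n (\<phi> n x) = x" if "x \<in> carrier (E n)" for n x
    using that \<phi>(2)[of n] by (simp add: bij_betw_def)
  have \<phi>c: "\<phi> n x \<in> carrier (E' n)" if "x \<in> carrier (E n)" for n x
    using that rmod_homD(1)[OF \<phi>(1)] by blast
  have \<phi>z: "\<phi> n \<zero>\<^bsub>E n\<^esub> = \<zero>\<^bsub>E' n\<^esub>" for n by (rule rmod_hom_zero[OF \<phi>(1) Er Er'])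
  have \<phi>0: "\<phi> n x = \<zero>\<^bsub>E' n\<^esub> \<longleftrightarrow> x = \<zero>\<^bsub>E n\<^esub>" if "x \<in> carrier (E n)" for n x
  proof -
    interpret right_module A "E n" by (rule Er)
    show ?thesis
      using that rmod_hom_zero[OF \<phi>(1) Er Er', of n] i\<phi> M.zero_closed by metis
  qed
  let ?e = "\<lambda>x. \<phi> 0 (e x)" and ?d = "\<lambda>n x. \<phi> (Suc n) (d n (?i n x))"
  have dc: "d n x \<in> carrier (E (Suc n))" if "x \<in> carrier (E n)" for n x
    using that rmod_homD(1)[OF d] by blast
  have ker: "\<phi> n ` {x \<in> carrier (E n). d n x = \<zero>\<^bsub>E (Suc n)\<^esub>} = a_kernel (E' n) (E' (Suc n)) (?d n)" for n
  proof (intro equalityI subsetI)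
    fix y assume "y \<in> a_kernel (E' n) (E' (Suc n)) (?d n)"
    hence y: "y \<in> carrier (E' n)" "?d n y = \<zero>\<^bsub>E' (Suc n)\<^esub>" by (auto simp: a_kernel_eq)
    hence "d n (?i n y) = \<zero>\<^bsub>E (Suc n)\<^esub>" using \<phi>0 dc \<phi>i by blast
    thus "y \<in> \<phi> n ` {x \<in> carrier (E n). d n x = \<zero>\<^bsub>E (Suc n)\<^esub>}"
      using \<phi>i[OF y(1)] by (intro image_eqI[of _ _ "?i n y"]) auto
  qed (auto simp: a_kernel_eq i\<phi> \<phi>z \<phi>c)
  have im: "?d n ` carrier (E' n) = \<phi> (Suc n) ` d n ` carrier (E n)" for n
  proof -
    have "?d n ` carrier (E' n) = \<phi> (Suc n) ` d n ` ?i n ` carrier (E' n)" by (simp only: image_image)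
    thus ?thesis by (simp only: bi)
  qed
  have ime: "?e ` carrier M = \<phi> 0 ` e ` carrier M" by (simp add: image_image)
  have "injective_resolution A M E' ?e ?d"
    unfolding injective_resolution_def
  proof (intro conjI allI)
    show "injective_module A (E' n)" for n by (rule injective_module_bij[OF E Er' \<phi>])
    show "?e \<in> rmod_hom A M (E' 0)" by (rule rmod_hom_compose[OF e(1) \<phi>(1)])
    show "?d n \<in> rmod_hom A (E' n) (E' (Suc n))" for n
      by (rule rmod_hom_compose[OF rmod_hom_compose[OF i d] \<phi>(1)])
    have "inj_on (\<phi> 0 \<circ> e) (carrier M)"
      by (rule comp_inj_on[OF e(2)], rule inj_on_subset[of _ "carrier (E 0)"])
         (use \<phi>(2)[of 0] rmod_homD(1)[OF e(1)] in \<open>auto simp: bij_betw_def\<close>)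
    thus "inj_on ?e (carrier M)" by (simp add: comp_def)
    show "?e ` carrier M = a_kernel (E' 0) (E' 1) (?d 0)"
      unfolding ime exe using ker[of 0] by simp
    show "?d n ` carrier (E' n) = a_kernel (E' (Suc n)) (E' (Suc (Suc n))) (?d (Suc n))" for n
      unfolding im exd ker ..
  qed (rule M)
  moreover have "essential_in A (?e ` carrier M) (E' 0)"
    unfolding ime by (rule essential_in_bij[OF mine Er Er' \<phi>])
  moreover have "essential_in A (?d n ` carrier (E' n)) (E' (Suc n))" for n
    unfolding im by (rule essential_in_bij[OF mind Er Er' \<phi>])
  ultimately show ?thesis
    using \<phi> by (intro that[of E' ?e ?d \<phi>]) (auto simp: minimal_injective_resolution_def)
qed

end

section \<open>Bases of gentle algebras\<close>

lemma path_algebra_simps: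
  "carrier (path_algebra Q) = {x. finite {w. x w \<noteq> 0} \<and> {w. x w \<noteq> 0} \<subseteq> quiver_paths Q}"
  "(x \<otimes>\<^bsub>path_algebra Q\<^esub> y) (u, p) =
     (\<Sum>i\<le>length p. x (u, take i p) * y (pre_digraph.awlast Q u (take i p), drop i p))"
  "\<one>\<^bsub>path_algebra Q\<^esub> (u, p) = (if u \<in> verts Q \<and> p = [] then 1 else 0)"
  "\<zero>\<^bsub>path_algebra Q\<^esub> = (\<lambda>w. 0)"
  "x \<oplus>\<^bsub>path_algebra Q\<^esub> y = (\<lambda>w. x w + y w)"
  "c \<odot>\<^bsub>path_algebra Q\<^esub> x = (\<lambda>w. c * x w)"
  by (simp_all add: path_algebra_def)

lemma not_successively_split:
  assumes "\<not> successively P xs"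
  obtains ys a b zs where "xs = ys @ [a, b] @ zs" "\<not> P a b"
proof -
  have "\<exists>ys a b zs. xs = ys @ [a, b] @ zs \<and> \<not> P a b"
    using assms
  proof (induction xs)
    case (Cons x xs)
    show ?case
    proof (cases "successively P xs")
      case True
      then obtain y zs where "xs = y # zs" "\<not> P x y" using Cons.prems by (cases xs) auto
      thus ?thesis by (intro exI[of _ "[]"] exI[of _ x] exI[of _ y] exI[of _ zs]) simp
    next
      case False
      then obtain ys a b zs where "xs = ys @ [a, b] @ zs" "\<not> P a b" using Cons.IH by blast
      thus ?thesis by (intro exI[of _ "x # ys"] exI[of _ a] exI[of _ b] exI[of _ zs]) simp
    qed
  qed simp
  thus ?thesis using that by blast
qed

text \<open>An ideal of the path algebra is closed under ring operations; putting the scalar into a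
  path factor lets multiples of paths be handled by multiplication alone.\<close>

definition scaled_path :: "'k \<Rightarrow> 'v \<times> 'a list \<Rightarrow> 'v \<times> 'a list \<Rightarrow> 'k::field" where
  "scaled_path c w = (\<lambda>w'. if w' = w then c else 0)"

text \<open>Both factors are supported on a single path, so only the cut after
  \<open>length p\<close> arrows contributes.\<close>

lemma scaled_path_mult:
  assumes "pre_digraph.awlast Q u p = v"
  shows "scaled_path c (u, p) \<otimes>\<^bsub>path_algebra Q\<^esub> scaled_path d (v, q) = scaled_path (c * d) (u, p @ q)"
proof (rule ext)
  fix w :: "'a \<times> 'b list"
  obtain u' p' where w: "w = (u', p')" by (cases w)
  have eq: "scaled_path c (u, p) (u', take i p') * scaled_path d (v, q) (pre_digraph.awlast Q u' (take i p'), drop i p')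
      = (if i = length p then scaled_path (c * d) (u, p @ q) w else 0)" if "i \<le> length p'" for i
  proof (cases "(u', take i p') = (u, p) \<and> drop i p' = q")
    case True
    hence "p' = p @ q" by (metis Pair_inject append_take_drop_id)
    moreover have "i = length p" using True that by auto
    ultimately show ?thesis using True assms by (auto simp: scaled_path_def w)
  next
    case False
    have "\<not> (i = length p \<and> w = (u, p @ q))" using False by (auto simp: w)
    thus ?thesis using False by (auto simp: scaled_path_def)
  qed
  have "(scaled_path c (u, p) \<otimes>\<^bsub>path_algebra Q\<^esub> scaled_path d (v, q)) w =
      (\<Sum>i\<le>length p'. if i = length p then scaled_path (c * d) (u, p @ q) w else 0)"
    unfolding w path_algebra_simps by (rule sum.cong) (use eq in \<open>auto simp: w\<close>)
  also have "\<dots> = scaled_path (c * d) (u, p @ q) w"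
    by (auto simp: scaled_path_def w)
  finally show "(scaled_path c (u, p) \<otimes>\<^bsub>path_algebra Q\<^esub> scaled_path d (v, q)) w = \<dots>" .
qed

text \<open>Concatenation is total; composability appears as the hypothesis
  \<open>pend w = fst q\<close> where it matters.\<close>

definition pcat :: "'v \<times> 'a list \<Rightarrow> 'v \<times> 'a list \<Rightarrow> 'v \<times> 'a list" where
  "pcat w q = (fst w, snd w @ snd q)"

lemma pcat_simps [simp]: "fst (pcat w q) = fst w" "snd (pcat w q) = snd w @ snd q"
  by (simp_all add: pcat_def)

lemma pcat_assoc: "pcat (pcat w q) r = pcat w (pcat q r)"
  by (simp add: pcat_def)

locale gentle_algebra = fin_digraph Q for Q :: "('v, 'a) pre_digraph" +
  fixes I :: "('v \<times> 'a list \<Rightarrow> 'k::field) set"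
  assumes admissible: "admissible_ideal Q I" and gentle: "gentle Q I"
begin

abbreviation R :: "('k, 'v \<times> 'a list \<Rightarrow> 'k) module" where
  "R \<equiv> path_algebra Q"

definition A :: "('k, ('v \<times> 'a list \<Rightarrow> 'k) set) module" where
  "A = bound_quiver_algebra Q I"

section \<open>Relations of length two and nonzero paths\<close>

definition rel :: "'a \<Rightarrow> 'a \<Rightarrow> bool" where
  "rel a b \<longleftrightarrow> a \<in> arcs Q \<and> b \<in> arcs Q \<and> head Q a = tail Q b \<and> path_elem (tail Q a, [a, b]) \<in> I"

definition NP :: "('v \<times> 'a list) set" where
  "NP = {w \<in> quiver_paths Q. successively (\<lambda>a b. \<not> rel a b) (snd w)}"

definition pend :: "'v \<times> 'a list \<Rightarrow> 'v" where
  "pend w = awlast (fst w) (snd w)"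

lemma pend_simps [simp]: "pend (u, []) = u" "pend (u, p @ [a]) = head Q a" "pend (u, [a]) = head Q a"
  by (simp_all add: pend_def awalk_verts_conv)

lemma pend_nonempty: "snd w \<noteq> [] \<Longrightarrow> pend w = head Q (last (snd w))"
  by (simp add: pend_def awalk_verts_conv)

lemma pend_empty: "snd w = [] \<Longrightarrow> pend w = fst w"
  by (simp add: pend_def)

lemma pend_pcat: "pend w = fst q \<Longrightarrow> pend (pcat w q) = pend q"
  by (simp add: pend_def awlast_append)

lemma quiver_paths_iff: "(u, p) \<in> quiver_paths Q \<longleftrightarrow> u \<in> verts Q \<and> set p \<subseteq> arcs Q \<and> cas u p (pend (u, p))"
proof
  assume "(u, p) \<in> quiver_paths Q"
  then obtain v where "awalk u p v" by (auto simp: quiver_paths_def)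
  thus "u \<in> verts Q \<and> set p \<subseteq> arcs Q \<and> cas u p (pend (u, p))"
    by (auto simp: pend_def awalk_def awlast_if_cas)
qed (auto simp: quiver_paths_def awalk_def)

lemma quiver_paths_append:
  "(u, p @ q) \<in> quiver_paths Q \<longleftrightarrow> (u, p) \<in> quiver_paths Q \<and> (pend (u, p), q) \<in> quiver_paths Q"
  by (auto simp: quiver_paths_def pend_def)

text \<open>Relations have length two, so whether a product of nonzero paths vanishes is decided at
  the junction.\<close>

lemma NP_append:
  "(u, p @ q) \<in> NP \<longleftrightarrow> (u, p) \<in> NP \<and> (pend (u, p), q) \<in> NP \<and>
     (p = [] \<or> q = [] \<or> \<not> rel (last p) (hd q))"
  by (auto simp: NP_def quiver_paths_append successively_append_iff)

lemma NP_pcat: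
  "pend w = fst q \<Longrightarrow> pcat w q \<in> NP \<longleftrightarrow> w \<in> NP \<and> q \<in> NP \<and>
     (snd w = [] \<or> snd q = [] \<or> \<not> rel (last (snd w)) (hd (snd q)))"
  by (cases w; cases q) (auto simp: pcat_def NP_append)

lemma NP_take_drop:
  assumes "(u, p) \<in> NP"
  shows "(u, take i p) \<in> NP" "(awlast u (take i p), drop i p) \<in> NP"
  using assms NP_append[of u "take i p" "drop i p"] by (auto simp: pend_def)

lemma NP_trivial [simp]: "(u, []) \<in> NP \<longleftrightarrow> u \<in> verts Q"
  by (simp add: NP_def quiver_paths_iff)

lemma NP_arrow [simp]: "(u, [a]) \<in> NP \<longleftrightarrow> a \<in> arcs Q \<and> u = tail Q a"
  by (auto simp: NP_def quiver_paths_iff)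

lemma NP_fst: "w \<in> NP \<Longrightarrow> fst w \<in> verts Q"
  by (cases w) (auto simp: NP_def quiver_paths_iff)

lemma NP_arcs: "w \<in> NP \<Longrightarrow> set (snd w) \<subseteq> arcs Q"
  by (cases w) (auto simp: NP_def quiver_paths_iff)

lemma NP_tail: "w \<in> NP \<Longrightarrow> snd w \<noteq> [] \<Longrightarrow> fst w = tail Q (hd (snd w))"
  by (cases w; cases "snd w") (auto simp: NP_def quiver_paths_iff)

lemma NP_pend: "w \<in> NP \<Longrightarrow> pend w \<in> verts Q"
  by (cases w) (auto simp: NP_def quiver_paths_def pend_def)

lemma ideal_I: "ideal I R"
  using admissible by (simp add: admissible_ideal_def)

sublocale I: ideal I "R :: ('k, 'v \<times> 'a list \<Rightarrow> 'k) module"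
  by (rule ideal_I)

lemma path_elem_scaled: "path_elem w = scaled_path 1 w"
  by (simp add: path_elem_def scaled_path_def)

lemma scaled_path_carrier: "w \<in> quiver_paths Q \<Longrightarrow> scaled_path c w \<in> carrier R"
  by (auto simp: path_algebra_simps scaled_path_def)

text \<open>A path outside \<open>NP\<close> contains two consecutive arrows forming a relation;
  splitting it there exhibits a factor in \<open>I\<close>.\<close>

lemma scaled_path_in_I:
  assumes w: "w \<in> quiver_paths Q" "w \<notin> NP"
  shows "scaled_path c w \<in> I"
proof -
  obtain u p where up: "w = (u, p)" by (cases w)
  have "\<not> successively (\<lambda>a b. \<not> rel a b) p" using w up by (auto simp: NP_def)
  then obtain ys a b zs where p: "p = ys @ [a, b] @ zs" and ab: "rel a b"
    by (elim not_successively_split) auto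
  have ys: "(u, ys) \<in> quiver_paths Q" and "(pend (u, ys), [a, b] @ zs) \<in> quiver_paths Q"
    using w(1) unfolding up p quiver_paths_append by auto
  hence e: "awlast u ys = tail Q a" and zs: "(head Q b, zs) \<in> quiver_paths Q"
    by (auto simp: pend_def quiver_paths_iff)
  have "scaled_path c w = scaled_path c (u, ys) \<otimes>\<^bsub>R\<^esub> path_elem (tail Q a, [a, b]) \<otimes>\<^bsub>R\<^esub> path_elem (head Q b, zs)"
    unfolding path_elem_scaled scaled_path_mult[of Q, OF e]
    by (subst scaled_path_mult) (auto simp: awlast_append up p)
  thus ?thesis
    using ab I.I_l_closed I.I_r_closed scaled_path_carrier[OF ys] scaled_path_carrier[OF zs, of 1]
    by (simp add: rel_def path_elem_scaled)
qed

text \<open>\<open>I\<close> is a monomial ideal. The functions vanishing on \<open>NP\<close> form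
  an ideal containing the generators, which gives one inclusion; conversely each path in the support
  of such a function already lies in \<open>I\<close>.\<close>

lemma I_eq: "I = {x \<in> carrier R. \<forall>w\<in>NP. x w = 0}" (is "_ = ?J")
proof
  obtain S where S: "S \<subseteq> {(u, p) \<in> quiver_paths Q. length p = 2}" and IS: "I = Idl\<^bsub>R\<^esub> (path_elem ` S)"
    using gentle unfolding gentle_def by blast
  have pS: "path_elem w \<in> I" if "w \<in> S" for w
    unfolding IS genideal_def using that by auto
  have "ideal ?J R"
  proof (rule idealI)
    show "ring R" by (rule I.ring_axioms)
    show "subgroup ?J (add_monoid R)"
    proof (rule I.add.subgroupI)
      fix x assume x: "x \<in> ?J"
      have "(\<lambda>w. - x w) \<in> carrier R" using x by (auto simp: path_algebra_simps)
      moreover have "(\<lambda>w. - x w) \<oplus>\<^bsub>R\<^esub> x = \<zero>\<^bsub>R\<^esub>" by (simp add: path_algebra_simps)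
      ultimately have "\<ominus>\<^bsub>R\<^esub> x = (\<lambda>w. - x w)" using x I.minus_equality by blast
      thus "\<ominus>\<^bsub>R\<^esub> x \<in> ?J"
        using x \<open>(\<lambda>w. - x w) \<in> carrier R\<close> by auto
    next
      fix x y assume "x \<in> ?J" "y \<in> ?J"
      thus "x \<oplus>\<^bsub>R\<^esub> y \<in> ?J"
        using I.a_closed[of x y] by (auto simp: path_algebra_simps(5))
    next
      have "\<zero>\<^bsub>R\<^esub> \<in> ?J" using I.zero_closed[unfolded path_algebra_simps(4)] I.ring_axioms
        by (auto simp: path_algebra_simps)
      thus "?J \<noteq> {}" by blast
    qed auto
  next
    fix x y assume xy: "x \<in> ?J" "y \<in> carrier R"
    \<comment> \<open>Both pieces of a cut nonzero path are nonzero, so every summand contains a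
      value of \<open>x\<close> at a path in \<open>NP\<close>.\<close>
    have "(y \<otimes>\<^bsub>R\<^esub> x) (u, p) = 0" "(x \<otimes>\<^bsub>R\<^esub> y) (u, p) = 0" if "(u, p) \<in> NP" for u p
      using xy(1) NP_take_drop[OF that]
      unfolding path_algebra_simps by (auto intro!: sum.neutral)
    moreover have "y \<otimes>\<^bsub>R\<^esub> x \<in> carrier R" "x \<otimes>\<^bsub>R\<^esub> y \<in> carrier R"
      using xy by auto
    ultimately show "y \<otimes>\<^bsub>R\<^esub> x \<in> ?J" "x \<otimes>\<^bsub>R\<^esub> y \<in> ?J" by auto
  qed
  moreover have "path_elem ` S \<subseteq> ?J"
  proof
    fix x :: "'v \<times> 'a list \<Rightarrow> 'k" assume "x \<in> path_elem ` S"
    then obtain w where w: "w \<in> S" "x = path_elem w" by blast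
    obtain u p where up: "w = (u, p)" by (cases w)
    have pq: "(u, p) \<in> quiver_paths Q" "length p = 2" using S w(1) up by auto
    then obtain a b where p: "p = [a, b]" by (auto simp: numeral_2_eq_2 length_Suc_conv)
    have "rel a b" using pS[OF w(1)] pq unfolding rel_def up p by (auto simp: quiver_paths_iff pend_def)
    hence "w \<notin> NP" unfolding up p NP_def by simp
    moreover have "x \<in> carrier R" using scaled_path_carrier[OF pq(1), of 1] by (simp add: path_elem_scaled w up)
    ultimately show "x \<in> ?J" by (auto simp: path_elem_def w)
  qed
  ultimately show "I \<subseteq> ?J" unfolding IS genideal_def by blast
next
  have "\<forall>x\<in>carrier R. {w. x w \<noteq> 0} = S \<longrightarrow> S \<inter> NP = {} \<longrightarrow> x \<in> I" if "finite S" for S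
    using that
  proof (induction S)
    case empty
    have "x = \<zero>\<^bsub>R\<^esub>" if "{w. x w \<noteq> 0} = {}" for x :: "'v \<times> 'a list \<Rightarrow> 'k"
      using that by (auto simp: path_algebra_simps)
    thus ?case using I.additive_subgroup_axioms additive_subgroup.zero_closed by blast
  next
    case (insert w S)
    show ?case
    proof (intro ballI impI)
      fix x assume x: "x \<in> carrier R" "{w. x w \<noteq> 0} = insert w S" "insert w S \<inter> NP = {}"
      \<comment> \<open>The support is peeled off one path at a time; the removed term lies in
        \<open>I\<close> by \<open>scaled_path_in_I\<close>.\<close>
      let ?y = "x(w := 0)"
      have sy: "{w. ?y w \<noteq> 0} = S" using x(2) insert.hyps by auto
      moreover have "?y \<in> carrier R"
        using x insert.hyps unfolding path_algebra_simps(1) mem_Collect_eq sy by simp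
      ultimately have "?y \<in> I" using insert.IH x(3) by auto
      moreover have "scaled_path (x w) w \<in> I"
        using x by (intro scaled_path_in_I) (auto simp: path_algebra_simps)
      ultimately have "scaled_path (x w) w \<oplus>\<^bsub>R\<^esub> ?y \<in> I" 
        by (rule additive_subgroup.a_closed[OF I.additive_subgroup_axioms, rotated])
      moreover have "scaled_path (x w) w \<oplus>\<^bsub>R\<^esub> ?y = x"
        by (auto simp: path_algebra_simps scaled_path_def)
      ultimately show "x \<in> I" by simp
    qed
  qed
  thus "?J \<subseteq> I" by (auto simp: path_algebra_simps)
qed

lemma mem_I: "x \<in> I \<longleftrightarrow> x \<in> carrier R \<and> (\<forall>w\<in>NP. x w = 0)"
  by (rule trans[OF arg_cong[where f = "\<lambda>S. x \<in> S", OF I_eq]]) simp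

text \<open>Admissibility speaks about powers of the arrow ideal; this links them to lengths of
  paths.\<close>

lemma path_elem_arrow_ideal_pow:
  "(u, p) \<in> quiver_paths Q \<Longrightarrow>
     path_elem (u, p) \<in> (arrow_ideal Q :: ('v \<times> 'a list \<Rightarrow> 'k) set) [^]\<^bsub>ideals_set R\<^esub> length p"
proof (induction p rule: rev_induct)
  case Nil
  thus ?case using scaled_path_carrier[of "(u, [])" 1]
    by (simp add: nat_pow_def ideals_set_def path_elem_scaled)
next
  case (snoc a p)
  have p: "(u, p) \<in> quiver_paths Q" and a: "a \<in> arcs Q" "awlast u p = tail Q a"
    using snoc.prems unfolding quiver_paths_append by (auto simp: quiver_paths_iff pend_def)
  have "path_elem (u, p @ [a]) = path_elem (u, p) \<otimes>\<^bsub>R\<^esub> path_elem (tail Q a, [a])"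
    unfolding path_elem_scaled by (subst scaled_path_mult) (use a in auto)
  moreover have "path_elem (tail Q a, [a]) \<in> (arrow_ideal Q :: ('v \<times> 'a list \<Rightarrow> 'k) set)"
    unfolding arrow_ideal_def genideal_def using a by auto
  ultimately show ?case
    using snoc.IH[OF p] by (auto simp: nat_pow_def ideals_set_def intro: ideal_prod.prod)
qed

text \<open>Admissibility puts some power \<open>m\<close> of the arrow ideal into \<open>I\<close>.
  A nonzero path with at least \<open>m\<close> arrows would have a prefix of length
  \<open>m\<close> in \<open>I\<close>, although elements of \<open>I\<close> vanish on nonzero
  paths.\<close>

lemma finite_NP: "finite NP"
proof -
  obtain m :: nat where m: "arrow_ideal Q [^]\<^bsub>ideals_set R\<^esub> m \<subseteq> I"
    using admissible unfolding admissible_ideal_def by blast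
  have "length p < m" if up: "(u, p) \<in> NP" for u p
  proof (rule ccontr)
    assume "\<not> length p < m"
    hence l: "length (take m p) = m" by simp
    have t: "(u, take m p) \<in> NP" by (rule NP_take_drop(1)[OF up])
    hence "(u, take m p) \<in> quiver_paths Q" by (simp add: NP_def)
    from path_elem_arrow_ideal_pow[OF this, unfolded l] m have "path_elem (u, take m p) \<in> I" by blast
    hence "path_elem (u, take m p) (u, take m p) = (0 :: 'k)" using t unfolding mem_I by blast
    thus False by (simp add: path_elem_def)
  qed
  hence "NP \<subseteq> verts Q \<times> {p. set p \<subseteq> arcs Q \<and> length p \<le> m}"
    using NP_fst NP_arcs less_imp_le by (force simp del: NP_trivial)
  thus ?thesis by (rule finite_subset) (simp add: finite_lists_length_le)
qed

subsection \<open>Coordinates\<close>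

text \<open>All representatives of a coset agree on the nonzero paths, so the choice does not matter.\<close>

definition cf :: "('v \<times> 'a list \<Rightarrow> 'k) set \<Rightarrow> 'v \<times> 'a list \<Rightarrow> 'k" where
  "cf X w = (if w \<in> NP then (SOME x. x \<in> X) w else 0)"

text \<open>Truncation to \<open>NP\<close> makes this total: any function on paths gives an element
  of \<open>A\<close>, and \<open>cf\<close> returns the function if it is supported in
  \<open>NP\<close>.\<close>

definition emb :: "('v \<times> 'a list \<Rightarrow> 'k) \<Rightarrow> ('v \<times> 'a list \<Rightarrow> 'k) set" where
  "emb y = I +>\<^bsub>R\<^esub> (\<lambda>w. if w \<in> NP then y w else 0)"

lemma carrier_A: "X \<in> carrier A \<longleftrightarrow> (\<exists>x\<in>carrier R. X = I +>\<^bsub>R\<^esub> x)"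
proof -
  have "carrier A = a_rcosets\<^bsub>R\<^esub> I"
    by (simp add: A_def bound_quiver_algebra_def Let_def FactRing_def)
  thus ?thesis unfolding A_RCOSETS_def' by blast
qed

lemma mem_coset:
  assumes "x \<in> carrier R"
  shows "x' \<in> I +>\<^bsub>R\<^esub> x \<longleftrightarrow> x' \<in> carrier R \<and> (\<forall>w\<in>NP. x' w = x w)"
proof
  assume "x' \<in> I +>\<^bsub>R\<^esub> x"
  then obtain h where h: "h \<in> I" "x' = h \<oplus>\<^bsub>R\<^esub> x" by (auto simp: a_r_coset_def')
  moreover from this have "h \<in> carrier R" using I.a_subset by blast
  ultimately show "x' \<in> carrier R \<and> (\<forall>w\<in>NP. x' w = x w)"
    using I.a_closed[of h x] assms by (auto simp: mem_I path_algebra_simps(5))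
next
  assume x': "x' \<in> carrier R \<and> (\<forall>w\<in>NP. x' w = x w)"
  let ?h = "\<lambda>w. x' w - x w"
  have "{w. ?h w \<noteq> 0} \<subseteq> {w. x' w \<noteq> 0} \<union> {w. x w \<noteq> 0}" by auto
  moreover have "finite ({w. x' w \<noteq> 0} \<union> {w. x w \<noteq> 0})" using x' assms by (auto simp: path_algebra_simps)
  ultimately have "?h \<in> carrier R"
    using x' assms by (auto simp: path_algebra_simps dest: finite_subset)
  hence "?h \<in> I" using x' by (simp add: mem_I)
  moreover have "x' = ?h \<oplus>\<^bsub>R\<^esub> x" by (simp add: path_algebra_simps)
  ultimately show "x' \<in> I +>\<^bsub>R\<^esub> x" unfolding a_r_coset_def' by blast
qed

lemma coset_eq_iff:
  assumes "x \<in> carrier R" "y \<in> carrier R"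
  shows "I +>\<^bsub>R\<^esub> x = I +>\<^bsub>R\<^esub> y \<longleftrightarrow> (\<forall>w\<in>NP. x w = y w)"
  using mem_coset[OF assms(1)] mem_coset[OF assms(2)] assms by (auto simp: set_eq_iff)

lemma cf_coset:
  assumes "x \<in> carrier R"
  shows "cf (I +>\<^bsub>R\<^esub> x) w = (if w \<in> NP then x w else 0)"
proof -
  have "x \<in> I +>\<^bsub>R\<^esub> x" using mem_coset[OF assms] assms by blast
  hence "(SOME x'. x' \<in> I +>\<^bsub>R\<^esub> x) \<in> I +>\<^bsub>R\<^esub> x" by (rule someI[of "\<lambda>x'. x' \<in> I +>\<^bsub>R\<^esub> x"])
  thus ?thesis using mem_coset[OF assms] by (simp add: cf_def)
qed

lemma cf_outside: "w \<notin> NP \<Longrightarrow> cf X w = 0"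
  by (simp add: cf_def)

lemma cf_eqI: "\<lbrakk>X \<in> carrier A; Y \<in> carrier A; \<And>w. w \<in> NP \<Longrightarrow> cf X w = cf Y w\<rbrakk> \<Longrightarrow> X = Y"
  unfolding carrier_A by (elim bexE) (simp add: cf_coset coset_eq_iff)

lemma restricted_carrier: "(\<lambda>w. if w \<in> NP then y w else 0) \<in> carrier R"
  using finite_NP by (auto simp: path_algebra_simps NP_def intro: finite_subset[of _ NP])

lemma emb_closed [simp, intro]: "emb y \<in> carrier A"
  using restricted_carrier by (auto simp: emb_def carrier_A)

lemma cf_emb: "cf (emb y) w = (if w \<in> NP then y w else 0)"
  by (simp add: emb_def cf_coset[OF restricted_carrier])

lemma emb_cf: "X \<in> carrier A \<Longrightarrow> emb (cf X) = X"
  by (rule cf_eqI) (auto simp: cf_emb)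

lemma A_ops:
  assumes "x \<in> carrier R" "y \<in> carrier R"
  shows "(I +>\<^bsub>R\<^esub> x) \<oplus>\<^bsub>A\<^esub> (I +>\<^bsub>R\<^esub> y) = I +>\<^bsub>R\<^esub> (x \<oplus>\<^bsub>R\<^esub> y)"
    and "(I +>\<^bsub>R\<^esub> x) \<otimes>\<^bsub>A\<^esub> (I +>\<^bsub>R\<^esub> y) = I +>\<^bsub>R\<^esub> (x \<otimes>\<^bsub>R\<^esub> y)"
    and "c \<odot>\<^bsub>A\<^esub> (I +>\<^bsub>R\<^esub> x) = I +>\<^bsub>R\<^esub> (c \<odot>\<^bsub>R\<^esub> x)"
proof -
  show "(I +>\<^bsub>R\<^esub> x) \<oplus>\<^bsub>A\<^esub> (I +>\<^bsub>R\<^esub> y) = I +>\<^bsub>R\<^esub> (x \<oplus>\<^bsub>R\<^esub> y)"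
    using assms by (simp add: A_def bound_quiver_algebra_def Let_def FactRing_def I.a_rcos_sum)
  show "(I +>\<^bsub>R\<^esub> x) \<otimes>\<^bsub>A\<^esub> (I +>\<^bsub>R\<^esub> y) = I +>\<^bsub>R\<^esub> (x \<otimes>\<^bsub>R\<^esub> y)"
    using assms by (simp add: A_def bound_quiver_algebra_def Let_def FactRing_def I.rcoset_mult_add)
  have sc: "c \<odot>\<^bsub>R\<^esub> z \<in> carrier R" if "z \<in> carrier R" for z
    using that unfolding path_algebra_simps by (auto intro: finite_subset)
  have "(\<Union>z\<in>I +>\<^bsub>R\<^esub> x. I +>\<^bsub>R\<^esub> (c \<odot>\<^bsub>R\<^esub> z)) = (\<Union>z\<in>I +>\<^bsub>R\<^esub> x. I +>\<^bsub>R\<^esub> (c \<odot>\<^bsub>R\<^esub> x))"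
    using assms(1) mem_coset[OF assms(1)] coset_eq_iff[OF sc sc]
    by (intro SUP_cong) (auto simp: path_algebra_simps(6))
  also have "\<dots> = I +>\<^bsub>R\<^esub> (c \<odot>\<^bsub>R\<^esub> x)" using mem_coset[OF assms(1), of x] assms(1) by auto
  finally show "c \<odot>\<^bsub>A\<^esub> (I +>\<^bsub>R\<^esub> x) = I +>\<^bsub>R\<^esub> (c \<odot>\<^bsub>R\<^esub> x)"
    by (simp add: A_def bound_quiver_algebra_def Let_def)
qed

lemma ring_A: "ring A"
proof -
  interpret F: ring "R Quot I" by (rule I.quotient_is_ring)
  have fields: "carrier A = carrier (R Quot I)" "mult A = mult (R Quot I)" "one A = one (R Quot I)"
    "zero A = zero (R Quot I)" "add A = add (R Quot I)"
    by (simp_all add: A_def bound_quiver_algebra_def Let_def)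
  show ?thesis
  proof (rule ringI)
    show "abelian_group A"
      by (rule abelian_groupI) (auto simp: fields F.a_ac intro: F.l_neg bexI[of _ "\<ominus>\<^bsub>R Quot I\<^esub> _"])
    show "monoid A" by (rule monoidI) (auto simp: fields F.m_assoc)
  qed (auto simp: fields F.l_distr F.r_distr)
qed

sublocale A: ring A
  by (rule ring_A)

lemma cf_add: "\<lbrakk>X \<in> carrier A; Y \<in> carrier A\<rbrakk> \<Longrightarrow> cf (X \<oplus>\<^bsub>A\<^esub> Y) w = cf X w + cf Y w"
  by (auto simp: carrier_A A_ops cf_coset) (simp add: path_algebra_simps)

lemma smult_R_closed: "x \<in> carrier R \<Longrightarrow> c \<odot>\<^bsub>R\<^esub> x \<in> carrier R"
  unfolding path_algebra_simps by (auto intro: finite_subset)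

lemma cf_smult: "X \<in> carrier A \<Longrightarrow> cf (c \<odot>\<^bsub>A\<^esub> X) w = c * cf X w"
  by (auto simp: carrier_A A_ops cf_coset smult_R_closed) (simp add: path_algebra_simps)

lemma smult_A_closed: "X \<in> carrier A \<Longrightarrow> c \<odot>\<^bsub>A\<^esub> X \<in> carrier A"
  by (auto simp: carrier_A A_ops) (use smult_R_closed in blast)

lemma cf_zero: "cf \<zero>\<^bsub>A\<^esub> w = 0"
  using cf_add[of "\<zero>\<^bsub>A\<^esub>" "\<zero>\<^bsub>A\<^esub>" w] by (metis A.l_zero A.zero_closed add_cancel_left_left)

lemma cf_mult:
  assumes "X \<in> carrier A" "Y \<in> carrier A" "(u, p) \<in> NP"
  shows "cf (X \<otimes>\<^bsub>A\<^esub> Y) (u, p) = (\<Sum>i\<le>length p. cf X (u, take i p) * cf Y (awlast u (take i p), drop i p))"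
proof -
  obtain x y where xy: "x \<in> carrier R" "y \<in> carrier R" "X = I +>\<^bsub>R\<^esub> x" "Y = I +>\<^bsub>R\<^esub> y"
    using assms by (auto simp: carrier_A)
  show ?thesis
    unfolding xy A_ops(2)[OF xy(1,2)] using xy(1,2) assms(3) NP_take_drop[OF assms(3)]
    by (simp add: cf_coset path_algebra_simps(2))
qed

sublocale A: kalgebra A
proof
  fix a b :: "('v \<times> 'a list \<Rightarrow> 'k) set" and c d :: 'k
  assume a: "a \<in> carrier A"
  note [simp] = smult_A_closed a cf_add cf_smult
  show "c \<odot>\<^bsub>A\<^esub> a \<in> carrier A" by simp
  show "(c + d) \<odot>\<^bsub>A\<^esub> a = c \<odot>\<^bsub>A\<^esub> a \<oplus>\<^bsub>A\<^esub> d \<odot>\<^bsub>A\<^esub> a"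
    by (rule cf_eqI) (auto simp: distrib_right)
  show "c \<odot>\<^bsub>A\<^esub> (d \<odot>\<^bsub>A\<^esub> a) = (c * d) \<odot>\<^bsub>A\<^esub> a"
    by (rule cf_eqI) auto
  show "1 \<odot>\<^bsub>A\<^esub> a = a"
    by (rule cf_eqI) auto
  assume b: "b \<in> carrier A"
  note [simp] = b
  show "c \<odot>\<^bsub>A\<^esub> (a \<oplus>\<^bsub>A\<^esub> b) = c \<odot>\<^bsub>A\<^esub> a \<oplus>\<^bsub>A\<^esub> c \<odot>\<^bsub>A\<^esub> b"
    by (rule cf_eqI) (auto simp: distrib_left)
  show "(c \<odot>\<^bsub>A\<^esub> a) \<otimes>\<^bsub>A\<^esub> b = c \<odot>\<^bsub>A\<^esub> (a \<otimes>\<^bsub>A\<^esub> b)"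
    by (rule cf_eqI) (auto simp: cf_mult sum_distrib_left mult.assoc)
  show "a \<otimes>\<^bsub>A\<^esub> (c \<odot>\<^bsub>A\<^esub> b) = c \<odot>\<^bsub>A\<^esub> (a \<otimes>\<^bsub>A\<^esub> b)"
    by (rule cf_eqI) (auto simp: cf_mult sum_distrib_left mult_ac)
qed

lemma emb_add: "emb (\<lambda>w. y w + z w) = emb y \<oplus>\<^bsub>A\<^esub> emb z"
  by (rule cf_eqI) (auto simp: cf_add cf_emb)

lemma emb_smult: "emb (\<lambda>w. c * y w) = c \<odot>\<^bsub>A\<^esub> emb y"
  by (rule cf_eqI) (auto simp: cf_smult cf_emb)

lemma emb_0: "emb (\<lambda>w. 0) = \<zero>\<^bsub>A\<^esub>"
  by (rule cf_eqI) (auto simp: cf_zero cf_emb)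

text \<open>Outside \<open>NP\<close> this is zero, so products of basis elements obey the single
  rule \<open>be_mult\<close> without a case for vanishing paths.\<close>

definition be :: "'v \<times> 'a list \<Rightarrow> ('v \<times> 'a list \<Rightarrow> 'k) set" where
  "be q = emb (path_elem q)"

lemma be_closed [simp, intro]: "be q \<in> carrier A"
  by (simp add: be_def)

lemma cf_be: "cf (be q) w = (if w = q \<and> q \<in> NP then 1 else 0)"
  by (auto simp: be_def cf_emb path_elem_def)

lemma cf_mult_be_right:
  assumes X: "X \<in> carrier A" and q: "pend w = fst q" and w: "pcat w q \<in> NP"
  shows "cf (X \<otimes>\<^bsub>A\<^esub> be q) (pcat w q) = cf X w"
proof -
  obtain u p where up: "w = (u, p)" by (cases w)
  obtain v r where vr: "q = (v, r)" by (cases q)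
  have NP: "(u, p @ r) \<in> NP" "pcat w q = (u, p @ r)" using w by (auto simp: pcat_def up vr)
  have qNP: "q \<in> NP" using w NP_pcat[OF q] by blast
  have v: "awlast u p = v" using q by (simp add: up vr pend_def)
  have "cf (X \<otimes>\<^bsub>A\<^esub> be q) (pcat w q) =
      (\<Sum>i\<le>length (p @ r). if i = length p then cf X w else 0)"
    unfolding NP(2) cf_mult[OF X be_closed NP(1)]
  proof (rule sum.cong[OF refl])
    fix i assume i: "i \<in> {..length (p @ r)}"
    show "cf X (u, take i (p @ r)) * cf (be q) (awlast u (take i (p @ r)), drop i (p @ r)) =
        (if i = length p then cf X w else 0)"
    proof (cases "i = length p")
      case False
      have "length (drop i (p @ r)) \<noteq> length r" using False i by auto
      hence "drop i (p @ r) \<noteq> r" by metis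
      thus ?thesis using False by (simp add: cf_be vr)
    qed (use qNP v in \<open>simp add: cf_be vr up\<close>)
  qed
  thus ?thesis by simp
qed

lemma cf_mult_be_right_nonzero:
  assumes X: "X \<in> carrier A" and nz: "cf (X \<otimes>\<^bsub>A\<^esub> be q) w' \<noteq> 0"
  obtains w where "w' = pcat w q" "pend w = fst q" "w \<in> NP"
proof -
  obtain u p where up: "w' = (u, p)" by (cases w')
  have NP: "(u, p) \<in> NP" using nz cf_outside up by metis
  have "(\<Sum>i\<le>length p. cf X (u, take i p) * cf (be q) (awlast u (take i p), drop i p)) \<noteq> 0"
    using nz unfolding up cf_mult[OF X be_closed NP] .
  then obtain i where "cf (be q) (awlast u (take i p), drop i p) \<noteq> 0"
    by (metis (no_types, lifting) mult_zero_right sum.neutral)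
  hence "q = (awlast u (take i p), drop i p)" by (metis cf_be)
  thus ?thesis using NP_take_drop(1)[OF NP, of i] by (intro that[of "(u, take i p)"]) (auto simp: up pcat_def pend_def)
qed

lemma cf_mult_be_left:
  assumes X: "X \<in> carrier A" and q: "pend q = fst w" and w: "pcat q w \<in> NP"
  shows "cf (be q \<otimes>\<^bsub>A\<^esub> X) (pcat q w) = cf X w"
proof -
  obtain u p where up: "q = (u, p)" by (cases q)
  obtain v r where vr: "w = (v, r)" by (cases w)
  have NP: "(u, p @ r) \<in> NP" "pcat q w = (u, p @ r)" using w by (auto simp: pcat_def up vr)
  have qNP: "q \<in> NP" using w NP_pcat[OF q] by blast
  have v: "awlast u p = v" using q by (simp add: up vr pend_def)
  have "cf (be q \<otimes>\<^bsub>A\<^esub> X) (pcat q w) =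
      (\<Sum>i\<le>length (p @ r). if i = length p then cf X w else 0)"
    unfolding NP(2) cf_mult[OF be_closed X NP(1)]
  proof (rule sum.cong[OF refl])
    fix i assume i: "i \<in> {..length (p @ r)}"
    show "cf (be q) (u, take i (p @ r)) * cf X (awlast u (take i (p @ r)), drop i (p @ r)) =
        (if i = length p then cf X w else 0)"
    proof (cases "i = length p")
      case False
      have "length (take i (p @ r)) \<noteq> length p" using False i by auto
      hence "take i (p @ r) \<noteq> p" by metis
      thus ?thesis using False by (simp add: cf_be up)
    qed (use qNP v in \<open>simp add: cf_be vr up\<close>)
  qed
  thus ?thesis by simp
qed

lemma cf_mult_be_left_nonzero:
  assumes X: "X \<in> carrier A" and nz: "cf (be q \<otimes>\<^bsub>A\<^esub> X) w' \<noteq> 0"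
  obtains w where "w' = pcat q w" "pend q = fst w" "w \<in> NP"
proof -
  obtain u p where up: "w' = (u, p)" by (cases w')
  have NP: "(u, p) \<in> NP" using nz cf_outside up by metis
  have "(\<Sum>i\<le>length p. cf (be q) (u, take i p) * cf X (awlast u (take i p), drop i p)) \<noteq> 0"
    using nz unfolding up cf_mult[OF be_closed X NP] .
  then obtain i where "cf (be q) (u, take i p) \<noteq> 0"
    by (metis (no_types, lifting) mult_zero_left sum.neutral)
  hence "q = (u, take i p)" by (metis cf_be)
  thus ?thesis using NP_take_drop(2)[OF NP, of i]
    by (intro that[of "(awlast u (take i p), drop i p)"]) (auto simp: up pcat_def pend_def)
qed

lemma be_mult:
  "be q \<otimes>\<^bsub>A\<^esub> be r = (if pend q = fst r then be (pcat q r) else \<zero>\<^bsub>A\<^esub>)"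
proof (rule cf_eqI)
  fix w assume w: "w \<in> NP"
  show "cf (be q \<otimes>\<^bsub>A\<^esub> be r) w = cf (if pend q = fst r then be (pcat q r) else \<zero>\<^bsub>A\<^esub>) w"
  proof (cases "cf (be q \<otimes>\<^bsub>A\<^esub> be r) w = 0")
    case False
    then obtain w' where w': "w = pcat w' r" "pend w' = fst r" "w' \<in> NP"
      using cf_mult_be_right_nonzero[OF be_closed] by blast
    have "cf (be q \<otimes>\<^bsub>A\<^esub> be r) w = cf (be q) w'"
      using cf_mult_be_right[OF be_closed w'(2)] w w'(1) by simp
    thus ?thesis using False w' w by (auto simp: cf_be split: if_splits)
  next
    case True
    show ?thesis
    proof (cases "pend q = fst r \<and> w = pcat q r")
      case qr: True
      have "q \<in> NP" using w NP_pcat[of q r] qr by simp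
      hence "cf (be q \<otimes>\<^bsub>A\<^esub> be r) w = 1"
        using cf_mult_be_right[OF be_closed, of q r q] qr w by (simp add: cf_be)
      thus ?thesis using True by simp
    qed (use True in \<open>auto simp: cf_be cf_zero\<close>)
  qed
qed auto

text \<open>The elements \<open>be q\<close> with \<open>q \<in> NP\<close> span the algebra. The
  auxiliary claim truncates to subsets of \<open>NP\<close> so that induction over finite sets
  applies.\<close>

lemma linear_expand:
  assumes add: "\<And>a b. \<lbrakk>a \<in> carrier A; b \<in> carrier A\<rbrakk> \<Longrightarrow> l (a \<oplus>\<^bsub>A\<^esub> b) = l a + l b"
    and sm: "\<And>a c. a \<in> carrier A \<Longrightarrow> l (c \<odot>\<^bsub>A\<^esub> a) = c * l a" and a: "a \<in> carrier A"
  shows "l a = (\<Sum>q\<in>NP. cf a q * (l (be q) :: 'k))"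
proof -
  have *: "l (emb (\<lambda>w. if w \<in> S then y w else 0)) = (\<Sum>q\<in>S. y q * l (be q))"
    if "finite S" "S \<subseteq> NP" for S y
    using that
  proof (induction S)
    case empty
    thus ?case using sm[of "\<zero>\<^bsub>A\<^esub>" 0] by (simp add: emb_0 A.smult_zero_left)
  next
    case (insert q S)
    have "emb (\<lambda>w. if w \<in> insert q S then y w else 0) =
        y q \<odot>\<^bsub>A\<^esub> be q \<oplus>\<^bsub>A\<^esub> emb (\<lambda>w. if w \<in> S then y w else 0)"
      unfolding be_def emb_smult[symmetric] emb_add[symmetric]
      by (rule arg_cong[where f = emb]) (use insert.hyps in \<open>auto simp: path_elem_def\<close>)
    thus ?case using insert by (simp add: add sm)
  qed
  have eq: "(\<lambda>w. if w \<in> NP then cf a w else 0) = cf a" by (auto simp: cf_outside)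
  show ?thesis using *[OF finite_NP subset_refl, of "cf a"] by (simp only: eq emb_cf[OF a])
qed

subsection \<open>Relations\<close>

lemma relD: "rel a b \<Longrightarrow> a \<in> arcs Q" "rel a b \<Longrightarrow> b \<in> arcs Q" "rel a b \<Longrightarrow> head Q a = tail Q b"
  by (auto simp: rel_def)

lemma path_elem_inj: "path_elem w = (path_elem w' :: 'v \<times> 'a list \<Rightarrow> 'k) \<Longrightarrow> w = w'"
  by (metis path_elem_def zero_neq_one)

text \<open>The two path elements are distinct, so meeting \<open>I\<close> in exactly one element
  is an exclusive or.\<close>

lemma gentle_right:
  assumes "a \<in> arcs Q" "b \<in> arcs Q" "b' \<in> arcs Q" "b \<noteq> b'" "head Q a = tail Q b" "head Q a = tail Q b'"
  shows "rel a b \<longleftrightarrow> \<not> rel a b'"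
proof -
  let ?x = "path_elem (tail Q a, [a, b]) :: 'v \<times> 'a list \<Rightarrow> 'k"
  let ?y = "path_elem (tail Q a, [a, b']) :: 'v \<times> 'a list \<Rightarrow> 'k"
  have c: "card ({?x, ?y} \<inter> I) = 1" using gentle assms unfolding gentle_def by blast
  have "?x \<noteq> ?y" using path_elem_inj assms(4) by fastforce
  hence "?x \<in> I \<longleftrightarrow> ?y \<notin> I" using c by (cases "?x \<in> I"; cases "?y \<in> I") auto
  thus ?thesis using assms by (simp add: rel_def)
qed

lemma gentle_left:
  assumes "b \<in> arcs Q" "a \<in> arcs Q" "a' \<in> arcs Q" "a \<noteq> a'" "head Q a = tail Q b" "head Q a' = tail Q b"
  shows "rel a b \<longleftrightarrow> \<not> rel a' b"
proof -
  let ?x = "path_elem (tail Q a, [a, b]) :: 'v \<times> 'a list \<Rightarrow> 'k"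
  let ?y = "path_elem (tail Q a', [a', b]) :: 'v \<times> 'a list \<Rightarrow> 'k"
  have c: "card ({?x, ?y} \<inter> I) = 1" using gentle assms unfolding gentle_def by blast
  have "?x \<noteq> ?y" using path_elem_inj assms(4) by fastforce
  hence "?x \<in> I \<longleftrightarrow> ?y \<notin> I" using c by (cases "?x \<in> I"; cases "?y \<in> I") auto
  thus ?thesis using assms by (simp add: rel_def)
qed

text \<open>Together with \<open>rel_left_unique\<close> this makes \<open>rel\<close> a partial
  injection on arrows: chains of relations neither branch nor merge.\<close>

lemma rel_right_unique: "rel a b \<Longrightarrow> rel a b' \<Longrightarrow> b = b'"
  using gentle_right[of a b b'] relD by metis

lemma rel_left_unique: "rel a b \<Longrightarrow> rel a' b \<Longrightarrow> a = a'"
  using gentle_left[of b a a'] relD by metis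

lemma in_degree_le: "v \<in> verts Q \<Longrightarrow> in_degree Q v \<le> 2"
  and out_degree_le: "v \<in> verts Q \<Longrightarrow> out_degree Q v \<le> 2"
  using gentle by (auto simp: gentle_def)

lemma in_degree_2:
  assumes "in_degree Q v = 2"
  obtains a b where "in_arcs Q v = {a, b}" "a \<noteq> b"
  using assms by (auto simp: in_degree_def card_2_iff)

lemma out_degree_2:
  assumes "out_degree Q v = 2"
  obtains a b where "out_arcs Q v = {a, b}" "a \<noteq> b"
  using assms by (auto simp: out_degree_def card_2_iff)

lemma in_degree_2I:
  assumes "a \<in> arcs Q" "b \<in> arcs Q" "a \<noteq> b" "head Q a = v" "head Q b = v"
  shows "in_degree Q v = 2"
proof -
  have "card {a, b} \<le> in_degree Q v"
    unfolding in_degree_def by (rule card_mono) (use assms in auto)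
  moreover have "v \<in> verts Q" using assms by auto
  ultimately show ?thesis using in_degree_le[of v] assms(3) by simp
qed

lemma out_degree_2I:
  assumes "a \<in> arcs Q" "b \<in> arcs Q" "a \<noteq> b" "tail Q a = v" "tail Q b = v"
  shows "out_degree Q v = 2"
proof -
  have "card {a, b} \<le> out_degree Q v"
    unfolding out_degree_def by (rule card_mono) (use assms in auto)
  moreover have "v \<in> verts Q" using assms by auto
  ultimately show ?thesis using out_degree_le[of v] assms(3) by simp
qed

end

section \<open>Free and cofree modules over a gentle algebra\<close>

declare split_paired_All [simp del] split_paired_Ex [simp del]

context gentle_algebra
begin

text \<open>
  Direct sums of modules are families of coefficient functions on paths, indexed by labels \<open>l \<in> L\<close>.
  Below, \<open>F L W\<close> is the submodule of \<open>A\<^sup>L\<close> spanned by the paths in the \<open>W l\<close>, and \<open>C L \<tau>\<close> is the sum of the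
  injectives \<open>I(\<tau> l)\<close>, where \<open>\<phi> l q\<close> is the value of a functional on the path \<open>q\<close>.
\<close>

definition fmod :: "'l set \<Rightarrow> ('l \<Rightarrow> ('v \<times> 'a list) set) \<Rightarrow>
    (('l \<Rightarrow> 'v \<times> 'a list \<Rightarrow> 'k) \<Rightarrow> ('v \<times> 'a list \<Rightarrow> 'k) set \<Rightarrow> 'l \<Rightarrow> 'v \<times> 'a list \<Rightarrow> 'k) \<Rightarrow>
    (('v \<times> 'a list \<Rightarrow> 'k) set, 'l \<Rightarrow> 'v \<times> 'a list \<Rightarrow> 'k) rmod" where
  "fmod L W act = \<lparr>carrier = {\<phi>. \<forall>l q. \<phi> l q \<noteq> 0 \<longrightarrow> l \<in> L \<and> q \<in> W l}, mult = undefined, one = undefined,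
     zero = (\<lambda>_ _. 0), add = (\<lambda>\<phi> \<psi> l q. \<phi> l q + \<psi> l q), ract = act\<rparr>"

lemma fmod_simps:
  "carrier (fmod L W act) = {\<phi>. \<forall>l q. \<phi> l q \<noteq> 0 \<longrightarrow> l \<in> L \<and> q \<in> W l}"
  "\<zero>\<^bsub>fmod L W act\<^esub> = (\<lambda>_ _. 0)"
  "\<phi> \<oplus>\<^bsub>fmod L W act\<^esub> \<psi> = (\<lambda>l q. \<phi> l q + \<psi> l q)"
  "\<phi> \<triangleleft>\<^bsub>fmod L W act\<^esub> a = act \<phi> a"
  by (simp_all add: fmod_def)

lemma abelian_group_fmod: "abelian_group (fmod L W act)"
proof (rule abelian_groupI)
  fix x assume x: "x \<in> carrier (fmod L W act)"
  show "\<exists>y\<in>carrier (fmod L W act). y \<oplus>\<^bsub>fmod L W act\<^esub> x = \<zero>\<^bsub>fmod L W act\<^esub>"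
    by (rule bexI[of _ "\<lambda>l q. - x l q"]) (use x in \<open>auto simp: fmod_simps\<close>)
next
  fix x y assume xy: "x \<in> carrier (fmod L W act)" "y \<in> carrier (fmod L W act)"
  have "l \<in> L \<and> q \<in> W l" if "x l q + y l q \<noteq> 0" for l q
    using that xy by (cases "x l q = 0") (auto simp: fmod_simps)
  thus "x \<oplus>\<^bsub>fmod L W act\<^esub> y \<in> carrier (fmod L W act)"
    by (simp add: fmod_simps)
qed (auto simp: fmod_simps ac_simps)

lemma fmod_finsum:
  assumes "g \<in> S \<rightarrow> carrier (fmod L W act)" "finite S"
  shows "(\<Oplus>\<^bsub>fmod L W act\<^esub>i\<in>S. g i) l q = (\<Sum>i\<in>S. g i l q)"
  using assms(2,1)
proof (induction S)
  interpret abelian_group "fmod L W act" by (rule abelian_group_fmod)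
  case (insert i S)
  have "g i \<in> carrier (fmod L W act)" "g \<in> S \<rightarrow> carrier (fmod L W act)" using insert.prems by auto
  thus ?case using insert by (simp add: fmod_simps(3))
next
  interpret abelian_group "fmod L W act" by (rule abelian_group_fmod)
  case empty
  thus ?case by (simp add: fmod_simps(2))
qed

definition unit_fun :: "'l \<Rightarrow> 'v \<times> 'a list \<Rightarrow> 'l \<Rightarrow> 'v \<times> 'a list \<Rightarrow> 'k" where
  "unit_fun l q = (\<lambda>l' q'. if l' = l \<and> q' = q then 1 else 0)"

lemma fd_module_fmod:
  assumes M: "right_module A (fmod L W act)" and L: "finite L" and W: "\<And>l. l \<in> L \<Longrightarrow> W l \<subseteq> NP"
    and sc: "\<And>\<phi> c. \<phi> \<in> carrier (fmod L W act) \<Longrightarrow> A.scal (fmod L W act) \<phi> c = (\<lambda>l q. c * \<phi> l q)"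
  shows "fd_module A (fmod L W act)"
proof -
  let ?M = "fmod L W act"
  let ?T = "SIGMA l:L. W l"
  let ?u = "\<lambda>(l, q). unit_fun l q"
  interpret M: right_module A ?M by fact
  have T: "finite ?T" using L W finite_NP by (auto intro: finite_subset)
  have inj: "inj_on ?u ?T"
    by (rule inj_onI) (auto simp: unit_fun_def fun_eq_iff split: if_splits, (metis zero_neq_one)+)
  have uc: "?u t \<in> carrier ?M" if "t \<in> ?T" for t
    using that by (auto simp: fmod_simps unit_fun_def split: if_splits)
  have "\<exists>c. \<phi> = (\<Oplus>\<^bsub>?M\<^esub>b\<in>?u ` ?T. b \<triangleleft>\<^bsub>?M\<^esub> (c b \<odot>\<^bsub>A\<^esub> \<one>\<^bsub>A\<^esub>))" if \<phi>: "\<phi> \<in> carrier ?M" for \<phi>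
  proof -
    \<comment> \<open>In \<open>fd_module\<close> a coefficient depends on the spanning element, so
      the index pair is recovered from the unit function.\<close>
    let ?c = "\<lambda>b. case inv_into ?T ?u b of (l, q) \<Rightarrow> \<phi> l q"
    have c: "?c (?u (l, q)) = \<phi> l q" if "(l, q) \<in> ?T" for l q
      by (subst inv_into_f_f[OF inj that]) simp
    have eq: "\<phi> l q = (\<Oplus>\<^bsub>?M\<^esub>b\<in>?u ` ?T. b \<triangleleft>\<^bsub>?M\<^esub> (?c b \<odot>\<^bsub>A\<^esub> \<one>\<^bsub>A\<^esub>)) l q" for l q
    proof -
      have "(\<Oplus>\<^bsub>?M\<^esub>b\<in>?u ` ?T. b \<triangleleft>\<^bsub>?M\<^esub> (?c b \<odot>\<^bsub>A\<^esub> \<one>\<^bsub>A\<^esub>)) l q =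
          (\<Sum>b\<in>?u ` ?T. (b \<triangleleft>\<^bsub>?M\<^esub> (?c b \<odot>\<^bsub>A\<^esub> \<one>\<^bsub>A\<^esub>)) l q)"
        by (rule fmod_finsum) (use T uc in \<open>auto intro!: M.ract_closed\<close>)
      also have "\<dots> = (\<Sum>b\<in>?u ` ?T. ?c b * b l q)"
        by (rule sum.cong[OF refl]) (use sc uc in \<open>auto simp: A.scal_def\<close>)
      also have "\<dots> = (\<Sum>t\<in>?T. ?c (?u t) * ?u t l q)" by (rule sum.reindex[OF inj, unfolded comp_def])
      also have "\<dots> = (\<Sum>t\<in>?T. if t = (l, q) then \<phi> l q else 0)"
      proof (rule sum.cong[OF refl])
        fix t assume t: "t \<in> ?T"
        obtain l' q' where "t = (l', q')" by (cases t)
        thus "?c (?u t) * ?u t l q = (if t = (l, q) then \<phi> l q else 0)"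
          using c[of l' q'] t by (auto simp: unit_fun_def)
      qed
      also have "\<dots> = \<phi> l q" using T \<phi> by (auto simp: fmod_simps)
      finally show ?thesis ..
    qed
    show ?thesis by (intro exI[of _ ?c] ext) (rule eq)
  qed
  thus ?thesis unfolding fd_module_def using M T uc
    by (intro conjI exI[of _ "?u ` ?T"]) auto
qed

definition F :: "'l set \<Rightarrow> ('l \<Rightarrow> ('v \<times> 'a list) set) \<Rightarrow>
    (('v \<times> 'a list \<Rightarrow> 'k) set, 'l \<Rightarrow> 'v \<times> 'a list \<Rightarrow> 'k) rmod" where
  "F L W = fmod L W (\<lambda>\<phi> a l. cf (emb (\<phi> l) \<otimes>\<^bsub>A\<^esub> a))"

text \<open>These are the sets of nonzero paths whose span is a right ideal.\<close>

definition right_closed :: "('v \<times> 'a list) set \<Rightarrow> bool" where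
  "right_closed W \<longleftrightarrow> W \<subseteq> NP \<and> (\<forall>w\<in>W. \<forall>r. pend w = fst r \<and> pcat w r \<in> NP \<longrightarrow> pcat w r \<in> W)"

lemma F_simps:
  "carrier (F L W) = {\<phi>. \<forall>l q. \<phi> l q \<noteq> 0 \<longrightarrow> l \<in> L \<and> q \<in> W l}"
  "\<zero>\<^bsub>F L W\<^esub> = (\<lambda>_ _. 0)"
  "\<phi> \<oplus>\<^bsub>F L W\<^esub> \<psi> = (\<lambda>l q. \<phi> l q + \<psi> l q)"
  "\<phi> \<triangleleft>\<^bsub>F L W\<^esub> a = (\<lambda>l. cf (emb (\<phi> l) \<otimes>\<^bsub>A\<^esub> a))"
  by (simp_all add: F_def fmod_simps)

lemma cf_mult_nonzero:
  assumes "X \<in> carrier A" "a \<in> carrier A" "cf (X \<otimes>\<^bsub>A\<^esub> a) w \<noteq> 0"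
  obtains w' r where "w = pcat w' r" "pend w' = fst r" "cf X w' \<noteq> 0" "cf a r \<noteq> 0" "w \<in> NP"
proof -
  obtain u p where up: "w = (u, p)" by (cases w)
  have NP: "(u, p) \<in> NP" using assms(3) cf_outside up by metis
  have "(\<Sum>i\<le>length p. cf X (u, take i p) * cf a (awlast u (take i p), drop i p)) \<noteq> 0"
    using assms(3) unfolding up cf_mult[OF assms(1,2) NP] .
  then obtain i where "cf X (u, take i p) * cf a (awlast u (take i p), drop i p) \<noteq> 0"
    by (metis (no_types, lifting) sum.neutral)
  thus ?thesis
    using NP by (intro that[of "(u, take i p)" "(awlast u (take i p), drop i p)"]) (auto simp: up pcat_def pend_def)
qed

lemma right_closed_mult:
  assumes "right_closed W" "\<And>w. y w \<noteq> 0 \<Longrightarrow> w \<in> W" "a \<in> carrier A" "cf (emb y \<otimes>\<^bsub>A\<^esub> a) w \<noteq> 0"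
  shows "w \<in> W"
  using cf_mult_nonzero[OF emb_closed assms(3,4)] assms(1,2)
  unfolding right_closed_def by (metis cf_emb)

lemma F_supp:
  assumes "\<phi> \<in> carrier (F L W)" "\<And>l. l \<in> L \<Longrightarrow> W l \<subseteq> NP"
  shows "cf (emb (\<phi> l)) = \<phi> l"
  using assms by (fastforce simp: F_simps cf_emb)

lemma right_module_F:
  assumes W: "\<And>l. l \<in> L \<Longrightarrow> right_closed (W l)"
  shows "right_module A (F L W)"
proof -
  have WN: "\<And>l. l \<in> L \<Longrightarrow> W l \<subseteq> NP" using W by (auto simp: right_closed_def)
  have "abelian_group (F L W)" by (simp add: F_def abelian_group_fmod)
  moreover have "right_module_axioms A (F L W)"
  proof
    fix m assume m: "m \<in> carrier (F L W)"
    show "m \<triangleleft>\<^bsub>F L W\<^esub> \<one>\<^bsub>A\<^esub> = m" using F_supp[OF m WN] by (simp add: F_simps)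
  next
    fix m a b assume m: "m \<in> carrier (F L W)" and a: "a \<in> carrier A"
    show "m \<triangleleft>\<^bsub>F L W\<^esub> a \<in> carrier (F L W)"
    proof -
      have "l \<in> L \<and> q \<in> W l" if nz: "cf (emb (m l) \<otimes>\<^bsub>A\<^esub> a) q \<noteq> 0" for l q
      proof
        obtain w' where "cf (emb (m l)) w' \<noteq> 0" using cf_mult_nonzero[OF emb_closed a nz] by blast
        hence "m l w' \<noteq> 0" by (metis cf_emb)
        thus l: "l \<in> L" using m by (auto simp: F_simps)
        show "q \<in> W l" by (rule right_closed_mult[OF W[OF l] _ a nz]) (use m in \<open>auto simp: F_simps\<close>)
      qed
      thus ?thesis by (simp add: F_simps)
    qed
    assume b: "b \<in> carrier A"
    show "m \<triangleleft>\<^bsub>F L W\<^esub> (a \<oplus>\<^bsub>A\<^esub> b) = m \<triangleleft>\<^bsub>F L W\<^esub> a \<oplus>\<^bsub>F L W\<^esub> m \<triangleleft>\<^bsub>F L W\<^esub> b"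
      using a b by (simp add: F_simps A.r_distr cf_add fun_eq_iff)
    show "m \<triangleleft>\<^bsub>F L W\<^esub> (a \<otimes>\<^bsub>A\<^esub> b) = m \<triangleleft>\<^bsub>F L W\<^esub> a \<triangleleft>\<^bsub>F L W\<^esub> b"
      using a b by (simp add: F_simps emb_cf A.m_assoc)
  next
    fix m n a assume "a \<in> carrier A"
    thus "(m \<oplus>\<^bsub>F L W\<^esub> n) \<triangleleft>\<^bsub>F L W\<^esub> a = m \<triangleleft>\<^bsub>F L W\<^esub> a \<oplus>\<^bsub>F L W\<^esub> n \<triangleleft>\<^bsub>F L W\<^esub> a"
      by (simp add: F_simps emb_add A.l_distr cf_add fun_eq_iff)
  qed
  ultimately show ?thesis by (rule right_module.intro[OF ring_A])
qed

lemma scal_F: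
  assumes "\<phi> \<in> carrier (F L W)" "\<And>l. l \<in> L \<Longrightarrow> W l \<subseteq> NP"
  shows "A.scal (F L W) \<phi> c = (\<lambda>l q. c * \<phi> l q)"
  using F_supp[OF assms] by (simp add: A.scal_def F_simps A.smult_rmult cf_smult fun_eq_iff)

lemma fd_module_F:
  assumes "finite L" "\<And>l. l \<in> L \<Longrightarrow> right_closed (W l)"
  shows "fd_module A (F L W)"
proof -
  have WN: "\<And>l. l \<in> L \<Longrightarrow> W l \<subseteq> NP" using assms(2) by (auto simp: right_closed_def)
  show ?thesis
    unfolding F_def
    by (rule fd_module_fmod)
       (use assms right_module_F[of L W] scal_F[of _ L W] WN in \<open>auto simp: F_def\<close>)
qed

text \<open>For \<open>W l = NP\<close> this is the universal property of the free module. The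
  formula only involves coefficients, so restriction gives maps out of every
  \<open>F L W\<close>.\<close>

lemma hom_from_F:
  assumes X: "right_module A X" and L: "finite L" and x: "\<And>l. l \<in> L \<Longrightarrow> x l \<in> carrier X"
  shows "(\<lambda>\<phi>. \<Oplus>\<^bsub>X\<^esub>l\<in>L. x l \<triangleleft>\<^bsub>X\<^esub> emb (\<phi> l)) \<in> rmod_hom A (F L W) X"
proof -
  interpret X: right_module A X by fact
  have c: "(\<lambda>l. x l \<triangleleft>\<^bsub>X\<^esub> a l) \<in> L \<rightarrow> carrier X" if "\<And>l. a l \<in> carrier A" for a
    using that x by (auto intro!: X.ract_closed)
  show ?thesis
  proof (rule rmod_homI)
    fix \<phi> show "(\<Oplus>\<^bsub>X\<^esub>l\<in>L. x l \<triangleleft>\<^bsub>X\<^esub> emb (\<phi> l)) \<in> carrier X" by (simp add: c)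
  next
    fix \<phi> \<psi> assume "\<phi> \<in> carrier (F L W)"
    have "(\<Oplus>\<^bsub>X\<^esub>l\<in>L. x l \<triangleleft>\<^bsub>X\<^esub> emb ((\<phi> \<oplus>\<^bsub>F L W\<^esub> \<psi>) l)) =
        (\<Oplus>\<^bsub>X\<^esub>l\<in>L. x l \<triangleleft>\<^bsub>X\<^esub> emb (\<phi> l) \<oplus>\<^bsub>X\<^esub> x l \<triangleleft>\<^bsub>X\<^esub> emb (\<psi> l))"
      by (rule X.M.finsum_cong') (use x in \<open>auto simp: F_simps emb_add X.ract_add_right intro!: X.ract_closed\<close>)
    thus "(\<Oplus>\<^bsub>X\<^esub>l\<in>L. x l \<triangleleft>\<^bsub>X\<^esub> emb ((\<phi> \<oplus>\<^bsub>F L W\<^esub> \<psi>) l)) =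
        (\<Oplus>\<^bsub>X\<^esub>l\<in>L. x l \<triangleleft>\<^bsub>X\<^esub> emb (\<phi> l)) \<oplus>\<^bsub>X\<^esub> (\<Oplus>\<^bsub>X\<^esub>l\<in>L. x l \<triangleleft>\<^bsub>X\<^esub> emb (\<psi> l))"
      by (simp add: X.M.finsum_addf c)
  next
    fix \<phi> a assume a: "a \<in> carrier A"
    have "(\<Oplus>\<^bsub>X\<^esub>l\<in>L. x l \<triangleleft>\<^bsub>X\<^esub> emb (\<phi> l)) \<triangleleft>\<^bsub>X\<^esub> a = (\<Oplus>\<^bsub>X\<^esub>l\<in>L. x l \<triangleleft>\<^bsub>X\<^esub> emb (\<phi> l) \<triangleleft>\<^bsub>X\<^esub> a)"
      by (rule additive_finsum[of X X "\<lambda>y. y \<triangleleft>\<^bsub>X\<^esub> a"])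
         (use a c in \<open>auto simp: X.M.abelian_group_axioms X.ract_closed X.ract_add_left\<close>)
    also have "\<dots> = (\<Oplus>\<^bsub>X\<^esub>l\<in>L. x l \<triangleleft>\<^bsub>X\<^esub> emb ((\<phi> \<triangleleft>\<^bsub>F L W\<^esub> a) l))"
      by (rule X.M.finsum_cong') (use x a in \<open>auto simp: F_simps emb_cf X.ract_mult intro!: X.ract_closed\<close>)
    finally show "(\<Oplus>\<^bsub>X\<^esub>l\<in>L. x l \<triangleleft>\<^bsub>X\<^esub> emb ((\<phi> \<triangleleft>\<^bsub>F L W\<^esub> a) l)) =
        (\<Oplus>\<^bsub>X\<^esub>l\<in>L. x l \<triangleleft>\<^bsub>X\<^esub> emb (\<phi> l)) \<triangleleft>\<^bsub>X\<^esub> a" ..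
  qed
qed

definition start :: "'v \<Rightarrow> ('v \<times> 'a list) set" where
  "start v = {q \<in> NP. fst q = v}"

lemma right_closed_start: "right_closed (start v)"
  by (auto simp: right_closed_def start_def)

text \<open>Each summand is generated by the trivial path at \<open>\<tau> l\<close>, and a map is
  lifted by lifting the images of these generators.\<close>

lemma projective_F:
  assumes L: "finite L" and \<tau>: "\<And>l. l \<in> L \<Longrightarrow> \<tau> l \<in> verts Q"
  shows "projective_module A (F L (\<lambda>l. start (\<tau> l)))" (is "projective_module A ?F")
  unfolding projective_module_def
proof (intro conjI allI ballI impI)
  show "fd_module A ?F" using L by (intro fd_module_F) (auto simp: right_closed_start)
next
  fix X Y :: "('k, ('v \<times> 'a list \<Rightarrow> 'k) set) coord_rmod" and f g
  assume f: "f \<in> rmod_hom A X Y" and g: "g \<in> rmod_hom A ?F Y"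
    and *: "fd_module A X \<and> fd_module A Y \<and> f ` carrier X = carrier Y"
  have Xr: "right_module A X" and Yr: "right_module A Y" and Fr: "right_module A ?F"
    using * by (auto simp: fd_module_def intro!: right_module_F right_closed_start)
  interpret X: right_module A X by (rule Xr)
  interpret F: right_module A ?F by (rule Fr)
  interpret Y: right_module A Y by (rule Yr)
  define u where "u l = unit_fun l (\<tau> l, [])" for l
  have u: "u l \<in> carrier ?F" if "l \<in> L" for l
    using that \<tau> by (auto simp: F_simps u_def unit_fun_def start_def split: if_splits)
  have im: "f ` carrier X = carrier Y" using * by blast
  \<comment> \<open>The lift \<open>x l\<close> may fail to be fixed by the idempotent at
    \<open>\<tau> l\<close>; this is harmless, as it gets multiplied by elements supported on paths
    starting there.\<close>
  have "\<exists>x. x \<in> carrier X \<and> f x = g (u l)" if "l \<in> L" for l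
    using rmod_homD(1)[OF g u[OF that]] unfolding im[symmetric] by auto
  then obtain x where x: "\<And>l. l \<in> L \<Longrightarrow> x l \<in> carrier X" "\<And>l. l \<in> L \<Longrightarrow> f (x l) = g (u l)"
    by metis
  let ?h = "\<lambda>\<phi>. \<Oplus>\<^bsub>X\<^esub>l\<in>L. x l \<triangleleft>\<^bsub>X\<^esub> emb (\<phi> l)"
  have eq: "f (?h \<phi>) = g \<phi>" if \<phi>: "\<phi> \<in> carrier ?F" for \<phi>
  proof -
    have "f (?h \<phi>) = (\<Oplus>\<^bsub>Y\<^esub>l\<in>L. f (x l \<triangleleft>\<^bsub>X\<^esub> emb (\<phi> l)))"
      by (rule rmod_hom_finsum[OF f Xr Yr]) (use x in \<open>auto intro!: X.ract_closed\<close>)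
    also have "\<dots> = (\<Oplus>\<^bsub>Y\<^esub>l\<in>L. g (u l \<triangleleft>\<^bsub>?F\<^esub> emb (\<phi> l)))"
    proof (rule Y.M.finsum_cong'[OF refl])
      show "(\<lambda>l. g (u l \<triangleleft>\<^bsub>?F\<^esub> emb (\<phi> l))) \<in> L \<rightarrow> carrier Y"
        using u by (auto intro!: F.ract_closed rmod_homD(1)[OF g])
      show "f (x l \<triangleleft>\<^bsub>X\<^esub> emb (\<phi> l)) = g (u l \<triangleleft>\<^bsub>?F\<^esub> emb (\<phi> l))" if "l \<in> L" for l
        using rmod_homD(3)[OF f x(1)[OF that] emb_closed] rmod_homD(3)[OF g u[OF that] emb_closed] x(2)[OF that]
        by simp
    qed
    also have "\<dots> = g (\<Oplus>\<^bsub>?F\<^esub>l\<in>L. u l \<triangleleft>\<^bsub>?F\<^esub> emb (\<phi> l))"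
      by (rule rmod_hom_finsum[OF g Fr Yr, symmetric]) (use u in \<open>auto intro!: F.ract_closed\<close>)
    also have "(\<Oplus>\<^bsub>?F\<^esub>l\<in>L. u l \<triangleleft>\<^bsub>?F\<^esub> emb (\<phi> l)) = \<phi>"
    proof (intro ext)
      fix l q
      have "(\<Oplus>\<^bsub>?F\<^esub>l\<in>L. u l \<triangleleft>\<^bsub>?F\<^esub> emb (\<phi> l)) l q = (\<Sum>l'\<in>L. (u l' \<triangleleft>\<^bsub>?F\<^esub> emb (\<phi> l')) l q)"
        unfolding F_def by (rule fmod_finsum) (use u L F.ract_closed in \<open>auto simp: F_def\<close>)
      also have "\<dots> = (\<Sum>l'\<in>L. if l' = l then \<phi> l q else 0)"
      proof (rule sum.cong[OF refl])
        fix l' assume l': "l' \<in> L"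
        show "(u l' \<triangleleft>\<^bsub>?F\<^esub> emb (\<phi> l')) l q = (if l' = l then \<phi> l q else 0)"
        proof (cases "l' = l")
          case True
          have e: "emb (u l l) = be (\<tau> l, [])"
            unfolding be_def by (rule arg_cong[where f = emb]) (auto simp: u_def unit_fun_def path_elem_def)
          have "cf (be (\<tau> l, []) \<otimes>\<^bsub>A\<^esub> emb (\<phi> l)) q = \<phi> l q"
          proof (cases "q \<in> NP \<and> fst q = \<tau> l")
            case True
            have "pcat (\<tau> l, []) q = q" using True by (simp add: pcat_def prod_eq_iff)
            thus ?thesis using cf_mult_be_left[of "emb (\<phi> l)" "(\<tau> l, [])" q] True by (simp add: cf_emb)
          next
            case False
            hence "\<phi> l q = 0" using \<phi> by (auto simp: F_simps start_def)
            moreover have "cf (be (\<tau> l, []) \<otimes>\<^bsub>A\<^esub> emb (\<phi> l)) q = 0"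
            proof (rule ccontr)
              assume nz: "cf (be (\<tau> l, []) \<otimes>\<^bsub>A\<^esub> emb (\<phi> l)) q \<noteq> 0"
              then obtain w where "q = pcat (\<tau> l, []) w"
                using cf_mult_be_left_nonzero[OF emb_closed] by blast
              moreover have "q \<in> NP" using nz cf_outside by blast
              ultimately show False using False by simp
            qed
            ultimately show ?thesis by simp
          qed
          thus ?thesis using True by (simp add: F_simps e)
        next
          case False
          have "emb (u l' l) = \<zero>\<^bsub>A\<^esub>"
            unfolding emb_0[symmetric] by (rule arg_cong[where f = emb]) (use False in \<open>auto simp: u_def unit_fun_def\<close>)
          thus ?thesis using False by (simp add: F_simps cf_zero)
        qed
      qed
      also have "\<dots> = \<phi> l q" using L \<phi> by (auto simp: F_simps)
      finally show "(\<Oplus>\<^bsub>?F\<^esub>l\<in>L. u l \<triangleleft>\<^bsub>?F\<^esub> emb (\<phi> l)) l q = \<phi> l q" .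
    qed
    finally show ?thesis .
  qed
  show "\<exists>h\<in>rmod_hom A ?F X. \<forall>p\<in>carrier ?F. f (h p) = g p"
    by (rule bexI[of _ ?h], rule ballI, erule eq, rule hom_from_F[OF Xr L x(1)])
qed

text \<open>Left multiplication commutes with the right action. The reindexing
  \<open>\<sigma>\<close> lets several target summands read the same source summand, as happens in
  \<open>kmap\<close>.\<close>

lemma hom_F_F:
  assumes z: "\<And>l. l \<in> L' \<Longrightarrow> z l \<in> carrier A"
    and supp: "\<And>\<phi> l w. \<lbrakk>\<phi> \<in> carrier (F L W); l \<in> L'; cf (z l \<otimes>\<^bsub>A\<^esub> emb (\<phi> (\<sigma> l))) w \<noteq> 0\<rbrakk> \<Longrightarrow> w \<in> W' l"
  shows "(\<lambda>\<phi> l w. if l \<in> L' then cf (z l \<otimes>\<^bsub>A\<^esub> emb (\<phi> (\<sigma> l))) w else 0) \<in> rmod_hom A (F L W) (F L' W')"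
proof (rule rmod_homI)
  fix \<phi> assume "\<phi> \<in> carrier (F L W)"
  thus "(\<lambda>l w. if l \<in> L' then cf (z l \<otimes>\<^bsub>A\<^esub> emb (\<phi> (\<sigma> l))) w else 0) \<in> carrier (F L' W')"
    using supp by (auto simp: F_simps)
next
  fix \<phi> \<psi> assume "\<phi> \<in> carrier (F L W)"
  show "(\<lambda>l w. if l \<in> L' then cf (z l \<otimes>\<^bsub>A\<^esub> emb ((\<phi> \<oplus>\<^bsub>F L W\<^esub> \<psi>) (\<sigma> l))) w else 0) =
    (\<lambda>l w. if l \<in> L' then cf (z l \<otimes>\<^bsub>A\<^esub> emb (\<phi> (\<sigma> l))) w else 0) \<oplus>\<^bsub>F L' W'\<^esub>
    (\<lambda>l w. if l \<in> L' then cf (z l \<otimes>\<^bsub>A\<^esub> emb (\<psi> (\<sigma> l))) w else 0)"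
    using z by (auto simp: F_simps emb_add A.r_distr cf_add fun_eq_iff)
next
  fix \<phi> a assume a: "a \<in> carrier A"
  have "emb (\<lambda>w. cf (z l \<otimes>\<^bsub>A\<^esub> emb (\<phi> (\<sigma> l))) w) = z l \<otimes>\<^bsub>A\<^esub> emb (\<phi> (\<sigma> l))" if "l \<in> L'" for l
    using z[OF that] emb_cf by simp
  thus "(\<lambda>l w. if l \<in> L' then cf (z l \<otimes>\<^bsub>A\<^esub> emb ((\<phi> \<triangleleft>\<^bsub>F L W\<^esub> a) (\<sigma> l))) w else 0) =
    (\<lambda>l w. if l \<in> L' then cf (z l \<otimes>\<^bsub>A\<^esub> emb (\<phi> (\<sigma> l))) w else 0) \<triangleleft>\<^bsub>F L' W'\<^esub> a"
    using z a by (auto simp: F_simps emb_cf A.m_assoc fun_eq_iff emb_0 cf_zero)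
qed

subsection \<open>Cofree modules\<close>

definition pairing :: "('v \<times> 'a list \<Rightarrow> 'k) \<Rightarrow> ('v \<times> 'a list \<Rightarrow> 'k) set \<Rightarrow> 'k" where
  "pairing y a = (\<Sum>r\<in>NP. cf a r * y r)"

text \<open>Each summand is the dual of the left module spanned by the paths ending at
  \<open>\<tau> l\<close>, with right action \<open>(\<phi> a)(q) = \<phi>(a q)\<close>.\<close>

definition C :: "'l set \<Rightarrow> ('l \<Rightarrow> 'v) \<Rightarrow>
    (('v \<times> 'a list \<Rightarrow> 'k) set, 'l \<Rightarrow> 'v \<times> 'a list \<Rightarrow> 'k) rmod" where
  "C L \<tau> = fmod L (\<lambda>l. {q \<in> NP. pend q = \<tau> l})
     (\<lambda>\<phi> a l q. if q \<in> NP then pairing (\<phi> l) (a \<otimes>\<^bsub>A\<^esub> be q) else 0)"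

lemma C_simps:
  "carrier (C L \<tau>) = {\<phi>. \<forall>l q. \<phi> l q \<noteq> 0 \<longrightarrow> l \<in> L \<and> q \<in> NP \<and> pend q = \<tau> l}"
  "\<zero>\<^bsub>C L \<tau>\<^esub> = (\<lambda>_ _. 0)"
  "\<phi> \<oplus>\<^bsub>C L \<tau>\<^esub> \<psi> = (\<lambda>l q. \<phi> l q + \<psi> l q)"
  "\<phi> \<triangleleft>\<^bsub>C L \<tau>\<^esub> a = (\<lambda>l q. if q \<in> NP then pairing (\<phi> l) (a \<otimes>\<^bsub>A\<^esub> be q) else 0)"
  by (simp_all add: C_def fmod_simps)

lemma pairing_add: "\<lbrakk>a \<in> carrier A; b \<in> carrier A\<rbrakk> \<Longrightarrow> pairing y (a \<oplus>\<^bsub>A\<^esub> b) = pairing y a + pairing y b"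
  by (simp add: pairing_def cf_add distrib_right sum.distrib)

lemma pairing_smult: "a \<in> carrier A \<Longrightarrow> pairing y (c \<odot>\<^bsub>A\<^esub> a) = c * pairing y a"
  by (simp add: pairing_def cf_smult sum_distrib_left mult.assoc)

lemma pairing_add_left: "pairing (\<lambda>q. y q + z q) a = pairing y a + pairing z a"
  by (simp add: pairing_def distrib_left sum.distrib)

lemma pairing_zero: "pairing y \<zero>\<^bsub>A\<^esub> = 0"
  by (simp add: pairing_def cf_zero)

lemma pairing_be: "pairing y (be q) = (if q \<in> NP then y q else 0)"
proof -
  have "pairing y (be q) = (\<Sum>r\<in>NP. if r = q then (if q \<in> NP then y q else 0) else 0)"
    unfolding pairing_def by (rule sum.cong) (auto simp: cf_be)
  thus ?thesis using finite_NP by simp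
qed

text \<open>Expanding \<open>b\<close> in the path basis gives the associativity of the dual
  action.\<close>

lemma pairing_ract:
  assumes a: "a \<in> carrier A" and b: "b \<in> carrier A"
  shows "pairing (\<lambda>q. if q \<in> NP then pairing y (a \<otimes>\<^bsub>A\<^esub> be q) else 0) b = pairing y (a \<otimes>\<^bsub>A\<^esub> b)"
proof -
  have "pairing y (a \<otimes>\<^bsub>A\<^esub> b) = (\<Sum>q\<in>NP. cf b q * pairing y (a \<otimes>\<^bsub>A\<^esub> be q))"
    by (rule linear_expand[of "\<lambda>b. pairing y (a \<otimes>\<^bsub>A\<^esub> b)"])
       (use a b in \<open>auto simp: A.r_distr pairing_add A.smult_rmult pairing_smult\<close>)
  thus ?thesis unfolding pairing_def[of "\<lambda>q. if q \<in> NP then _ q else 0"] by simp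
qed

lemma right_module_C: "right_module A (C L \<tau>)"
proof -
  have "abelian_group (C L \<tau>)" by (simp add: C_def abelian_group_fmod)
  moreover have "right_module_axioms A (C L \<tau>)"
  proof
    fix m assume m: "m \<in> carrier (C L \<tau>)"
    show "m \<triangleleft>\<^bsub>C L \<tau>\<^esub> \<one>\<^bsub>A\<^esub> = m"
      using m by (auto simp: C_simps pairing_be fun_eq_iff)
  next
    fix m a b assume m: "m \<in> carrier (C L \<tau>)" and a: "a \<in> carrier A"
    have "l \<in> L \<and> pend q = \<tau> l" if "pairing (m l) (a \<otimes>\<^bsub>A\<^esub> be q) \<noteq> 0" for l q
    proof -
      obtain r where "cf (a \<otimes>\<^bsub>A\<^esub> be q) r * m l r \<noteq> 0"
        using \<open>pairing (m l) (a \<otimes>\<^bsub>A\<^esub> be q) \<noteq> 0\<close> unfolding pairing_def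
        by (rule sum.not_neutral_contains_not_neutral)
      hence r: "cf (a \<otimes>\<^bsub>A\<^esub> be q) r \<noteq> 0" "m l r \<noteq> 0" by auto
      obtain w where "r = pcat w q" "pend w = fst q" using cf_mult_be_right_nonzero[OF a r(1)] by blast
      hence "pend r = pend q" by (simp add: pend_pcat)
      thus ?thesis using r(2) m by (auto simp: C_simps)
    qed
    thus "m \<triangleleft>\<^bsub>C L \<tau>\<^esub> a \<in> carrier (C L \<tau>)" by (auto simp: C_simps)
    assume b: "b \<in> carrier A"
    show "m \<triangleleft>\<^bsub>C L \<tau>\<^esub> (a \<oplus>\<^bsub>A\<^esub> b) = m \<triangleleft>\<^bsub>C L \<tau>\<^esub> a \<oplus>\<^bsub>C L \<tau>\<^esub> m \<triangleleft>\<^bsub>C L \<tau>\<^esub> b"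
      using a b by (auto simp: C_simps A.l_distr pairing_add fun_eq_iff)
    show "m \<triangleleft>\<^bsub>C L \<tau>\<^esub> (a \<otimes>\<^bsub>A\<^esub> b) = m \<triangleleft>\<^bsub>C L \<tau>\<^esub> a \<triangleleft>\<^bsub>C L \<tau>\<^esub> b"
      using a b by (auto simp: C_simps A.m_assoc pairing_ract fun_eq_iff)
  next
    fix m n a assume "a \<in> carrier A"
    thus "(m \<oplus>\<^bsub>C L \<tau>\<^esub> n) \<triangleleft>\<^bsub>C L \<tau>\<^esub> a = m \<triangleleft>\<^bsub>C L \<tau>\<^esub> a \<oplus>\<^bsub>C L \<tau>\<^esub> n \<triangleleft>\<^bsub>C L \<tau>\<^esub> a"
      by (auto simp: C_simps pairing_add_left fun_eq_iff)
  qed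
  ultimately show ?thesis by (rule right_module.intro[OF ring_A])
qed

lemma scal_C: "\<phi> \<in> carrier (C L \<tau>) \<Longrightarrow> A.scal (C L \<tau>) \<phi> c = (\<lambda>l q. c * \<phi> l q)"
  by (auto simp: A.scal_def C_simps A.smult_lmult pairing_smult pairing_be fun_eq_iff)

lemma fd_module_C: "finite L \<Longrightarrow> fd_module A (C L \<tau>)"
  unfolding C_def
  by (rule fd_module_fmod) (use right_module_C[of L \<tau>] scal_C[of _ L \<tau>] in \<open>auto simp: C_def\<close>)

lemma C_ract_be:
  assumes "\<phi> \<in> carrier (C L \<tau>)"
  shows "(\<phi> \<triangleleft>\<^bsub>C L \<tau>\<^esub> be q) l w = (if w \<in> NP \<and> pend q = fst w then \<phi> l (pcat q w) else 0)"
  using assms by (auto simp: C_simps be_mult pairing_be pairing_zero)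

text \<open>Every homomorphism to a cofree module arises in this way.\<close>

lemma hom_to_C:
  assumes M: "right_module A M" and lam: "\<And>l. l \<in> L \<Longrightarrow> A.linear_on M (carrier M) (lam l)"
  shows "(\<lambda>m l q. if l \<in> L \<and> q \<in> NP \<and> pend q = \<tau> l then lam l (m \<triangleleft>\<^bsub>M\<^esub> be q) else 0) \<in> rmod_hom A M (C L \<tau>)"
    (is "?f \<in> _")
proof (rule rmod_homI)
  interpret M: right_module A M by fact
  fix m assume m: "m \<in> carrier M"
  show "?f m \<in> carrier (C L \<tau>)" by (auto simp: C_simps)
next
  interpret M: right_module A M by fact
  fix m n assume mn: "m \<in> carrier M" "n \<in> carrier M"
  have "lam l ((m \<oplus>\<^bsub>M\<^esub> n) \<triangleleft>\<^bsub>M\<^esub> be q) = lam l (m \<triangleleft>\<^bsub>M\<^esub> be q) + lam l (n \<triangleleft>\<^bsub>M\<^esub> be q)" if "l \<in> L" for l q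
    using mn A.linear_onD(1)[OF lam[OF that]] by (simp add: M.ract_add_left M.ract_closed)
  thus "?f (m \<oplus>\<^bsub>M\<^esub> n) = ?f m \<oplus>\<^bsub>C L \<tau>\<^esub> ?f n"
    unfolding C_simps(3) by (intro ext) simp
next
  interpret M: right_module A M by fact
  fix m a assume m: "m \<in> carrier M" and a: "a \<in> carrier A"
  have eq: "lam l ((m \<triangleleft>\<^bsub>M\<^esub> a) \<triangleleft>\<^bsub>M\<^esub> be q) = pairing (?f m l) (a \<otimes>\<^bsub>A\<^esub> be q)"
    if l: "l \<in> L" and q: "q \<in> NP" "pend q = \<tau> l" for l q
  proof -
    have "lam l (m \<triangleleft>\<^bsub>M\<^esub> (a \<otimes>\<^bsub>A\<^esub> be q)) = (\<Sum>r\<in>NP. cf (a \<otimes>\<^bsub>A\<^esub> be q) r * lam l (m \<triangleleft>\<^bsub>M\<^esub> be r))"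
      by (rule linear_expand[of "\<lambda>b. lam l (m \<triangleleft>\<^bsub>M\<^esub> b)"])
         (simp_all add: a m M.ract_add_right M.ract_closed A.linear_onD[OF lam[OF l]]
           A.ract_scal[OF M m, symmetric])
    also have "\<dots> = pairing (?f m l) (a \<otimes>\<^bsub>A\<^esub> be q)"
      unfolding pairing_def
    proof (rule sum.cong[OF refl])
      fix r assume r: "r \<in> NP"
      show "cf (a \<otimes>\<^bsub>A\<^esub> be q) r * lam l (m \<triangleleft>\<^bsub>M\<^esub> be r) = cf (a \<otimes>\<^bsub>A\<^esub> be q) r * ?f m l r"
      proof (cases "cf (a \<otimes>\<^bsub>A\<^esub> be q) r = 0")
        case False
        \<comment> \<open>Paths occurring in \<open>a \<otimes> be q\<close> end where
          \<open>q\<close> ends, so the guard in the map holds for them.\<close>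
        obtain w where "r = pcat w q" "pend w = fst q" using cf_mult_be_right_nonzero[OF a False] by blast
        hence "pend r = \<tau> l" using q by (simp add: pend_pcat)
        thus ?thesis using l r by simp
      qed simp
    qed
    finally show ?thesis using m a by (simp add: M.ract_mult)
  qed
  have eq0: "pairing (?f m l) (a \<otimes>\<^bsub>A\<^esub> be q) = 0" if ne: "\<not> (l \<in> L \<and> pend q = \<tau> l)" for l q
    unfolding pairing_def
  proof (rule sum.neutral, rule ballI)
    fix r assume r: "r \<in> NP"
    show "cf (a \<otimes>\<^bsub>A\<^esub> be q) r * ?f m l r = 0"
    proof (cases "cf (a \<otimes>\<^bsub>A\<^esub> be q) r = 0")
      case False
      obtain w where "r = pcat w q" "pend w = fst q" using cf_mult_be_right_nonzero[OF a False] by blast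
      thus ?thesis using ne by (auto simp: pend_pcat)
    qed simp
  qed
  show "?f (m \<triangleleft>\<^bsub>M\<^esub> a) = ?f m \<triangleleft>\<^bsub>C L \<tau>\<^esub> a"
    unfolding C_simps(4)
  proof (intro ext)
    fix l q
    show "?f (m \<triangleleft>\<^bsub>M\<^esub> a) l q = (if q \<in> NP then pairing (?f m l) (a \<otimes>\<^bsub>A\<^esub> be q) else 0)"
      by (cases "q \<in> NP"; cases "l \<in> L \<and> pend q = \<tau> l") (simp_all only: eq eq0 simp_thms if_True if_False)
  qed
qed

text \<open>Every value of \<open>\<phi>\<close> can be moved to a trivial path, so a homomorphism
  into a cofree module is determined by the functionals reading its values there. Injectivity and
  essentiality both rest on this.\<close>

lemma C_ract_trivial:
  assumes "\<phi> \<in> carrier (C L \<tau>)" "q \<in> NP"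
  shows "(\<phi> \<triangleleft>\<^bsub>C L \<tau>\<^esub> be q) l (pend q, []) = \<phi> l q"
  using assms by (simp add: C_ract_be NP_pend) (simp add: pcat_def)

text \<open>Homomorphisms into \<open>C L \<tau>\<close> amount to families of linear functionals,
  and these extend along injections by \<open>extend_functional_hom\<close>.\<close>

lemma injective_C:
  assumes L: "finite L" and \<tau>: "\<And>l. l \<in> L \<Longrightarrow> \<tau> l \<in> verts Q"
  shows "injective_module A (C L \<tau>)"
  unfolding injective_module_def
proof (intro conjI allI ballI impI)
  show "fd_module A (C L \<tau>)" by (rule fd_module_C[OF L])
next
  fix X Y :: "('k, ('v \<times> 'a list \<Rightarrow> 'k) set) coord_rmod" and f g
  assume f: "f \<in> rmod_hom A X Y" and g: "g \<in> rmod_hom A X (C L \<tau>)"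
    and *: "fd_module A X \<and> fd_module A Y \<and> inj_on f (carrier X)"
  have Xr: "right_module A X" and Yr: "right_module A Y" using * by (auto simp: fd_module_def)
  interpret X: right_module A X by (rule Xr)
  have lin: "A.linear_on X (carrier X) (\<lambda>x. g x l (\<tau> l, []))" for l
    by (rule A.linear_onI)
       (auto simp: rmod_homD(2)[OF g] A.rmod_hom_scal[OF g] scal_C rmod_homD(1)[OF g] C_simps(3))
  have "\<exists>k. A.linear_on Y (carrier Y) k \<and> (\<forall>x\<in>carrier X. k (f x) = g x l (\<tau> l, []))" for l
    using A.extend_functional_hom[OF Xr _ f _ lin] * by metis
  then obtain lam where lam: "\<And>l. A.linear_on Y (carrier Y) (lam l)"
    "\<And>l x. x \<in> carrier X \<Longrightarrow> lam l (f x) = g x l (\<tau> l, [])" by metis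
  let ?h = "\<lambda>m l q. if l \<in> L \<and> q \<in> NP \<and> pend q = \<tau> l then lam l (m \<triangleleft>\<^bsub>Y\<^esub> be q) else 0"
  have eq: "?h (f x) = g x" if x: "x \<in> carrier X" for x
  proof (intro ext)
    fix l q
    have gx: "g x \<in> carrier (C L \<tau>)" using rmod_homD(1)[OF g x] .
    show "?h (f x) l q = g x l q"
    proof (cases "l \<in> L \<and> q \<in> NP \<and> pend q = \<tau> l")
      case True
      have "lam l (f x \<triangleleft>\<^bsub>Y\<^esub> be q) = g (x \<triangleleft>\<^bsub>X\<^esub> be q) l (\<tau> l, [])"
        using x by (simp add: rmod_homD(3)[OF f, symmetric] lam X.ract_closed)
      also have "\<dots> = (g x \<triangleleft>\<^bsub>C L \<tau>\<^esub> be q) l (pend q, [])"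
        using x True by (simp add: rmod_homD(3)[OF g])
      also have "\<dots> = g x l q" using C_ract_trivial[OF gx] True by blast
      finally show ?thesis using True by simp
    next
      case False
      thus ?thesis using gx by (auto simp: C_simps)
    qed
  qed
  show "\<exists>h\<in>rmod_hom A Y (C L \<tau>). \<forall>x\<in>carrier X. h (f x) = g x"
    by (rule bexI[of _ ?h], rule ballI, erule eq, rule hom_to_C[OF Yr lam(1)])
qed

text \<open>Acting on a nonzero element with a longest path of its support leaves values at trivial
  paths only, one of them nonzero. So every nonzero submodule meets the socle, which is contained in
  \<open>U\<close>.\<close>

lemma essential_in_C:
  assumes U: "rsubmodule A U (C L \<tau>)"
    and soc: "\<And>\<phi>. \<lbrakk>\<phi> \<in> carrier (C L \<tau>); \<And>l q. \<phi> l q \<noteq> 0 \<Longrightarrow> snd q = []\<rbrakk> \<Longrightarrow> \<phi> \<in> U"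
  shows "essential_in A U (C L \<tau>)"
proof -
  interpret C: right_module A "C L \<tau>" by (rule right_module_C)
  have "\<phi> = \<zero>\<^bsub>C L \<tau>\<^esub>" if V: "rsubmodule A V (C L \<tau>)" "V \<inter> U = {\<zero>\<^bsub>C L \<tau>\<^esub>}" and \<phi>: "\<phi> \<in> V" for V \<phi>
  proof (rule ccontr)
    assume "\<phi> \<noteq> \<zero>\<^bsub>C L \<tau>\<^esub>"
    then obtain l0 q0 where nz: "\<phi> l0 q0 \<noteq> 0" by (auto simp: C_simps fun_eq_iff)
    have \<phi>c: "\<phi> \<in> carrier (C L \<tau>)" using A.rsubmoduleD(1)[OF V(1)] \<phi> by blast
    have b: "length (snd q) \<le> Max ((length \<circ> snd) ` NP)" if "\<phi> l q \<noteq> 0" for l q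
      using that \<phi>c finite_NP by (intro Max_ge) (auto simp: C_simps image_iff)
    have "\<exists>x. \<phi> (fst x) (snd x) \<noteq> 0 \<and>
        (\<forall>y. \<phi> (fst y) (snd y) \<noteq> 0 \<longrightarrow> length (snd (snd y)) \<le> length (snd (snd x)))"
      by (rule ex_has_greatest_nat[where k = "(l0, q0)" and b = "Suc (Max ((length \<circ> snd) ` NP))"])
         (use nz b in \<open>auto simp: less_Suc_eq_le\<close>)
    then obtain x where x: "\<phi> (fst x) (snd x) \<noteq> 0"
      "\<And>y. \<phi> (fst y) (snd y) \<noteq> 0 \<Longrightarrow> length (snd (snd y)) \<le> length (snd (snd x))"
      by blast
    define l q where "l = fst x" and "q = snd x"
    have lq: "\<phi> l q \<noteq> 0" using x(1) by (simp add: l_def q_def)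
    have max: "length (snd q') \<le> length (snd q)" if "\<phi> l' q' \<noteq> 0" for l' q'
      using x(2)[of "(l', q')"] that by (simp add: q_def)
    have q: "q \<in> NP" using \<phi>c lq by (auto simp: C_simps)
    let ?\<psi> = "\<phi> \<triangleleft>\<^bsub>C L \<tau>\<^esub> be q"
    have "?\<psi> \<in> U"
    proof (rule soc)
      show "?\<psi> \<in> carrier (C L \<tau>)" using \<phi>c by (simp add: C.ract_closed)
      fix l' w assume "?\<psi> l' w \<noteq> 0"
      hence "\<phi> l' (pcat q w) \<noteq> 0" using C_ract_be[OF \<phi>c] by metis
      thus "snd w = []" using max by fastforce
    qed
    moreover have "?\<psi> \<in> V" using A.rsubmoduleD(4)[OF V(1) \<phi>] by simp
    ultimately have "?\<psi> = (\<lambda>_ _. 0)" using V(2) by (auto simp: C_simps(2))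
    moreover have "?\<psi> l (pend q, []) = \<phi> l q" by (rule C_ract_trivial[OF \<phi>c q])
    ultimately show False using lq by simp
  qed
  thus ?thesis unfolding essential_in_def using U A.rsubmoduleD(2) by blast
qed

subsection \<open>The regular module\<close>

lemma regular_simps:
  "carrier (regular_module A) = carrier A" "\<zero>\<^bsub>regular_module A\<^esub> = \<zero>\<^bsub>A\<^esub>"
  "x \<oplus>\<^bsub>regular_module A\<^esub> y = x \<oplus>\<^bsub>A\<^esub> y" "x \<triangleleft>\<^bsub>regular_module A\<^esub> a = x \<otimes>\<^bsub>A\<^esub> a"
  by (simp_all add: regular_module_def)

lemma right_module_regular: "right_module A (regular_module A)"
proof -
  have "abelian_group (regular_module A)"
    by (rule abelian_groupI) (auto simp: regular_simps A.a_ac intro: A.l_neg bexI[of _ "\<ominus>\<^bsub>A\<^esub> _"])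
  moreover have "right_module_axioms A (regular_module A)"
    by unfold_locales (auto simp: regular_simps A.l_distr A.r_distr A.m_assoc)
  ultimately show ?thesis by (rule right_module.intro[OF ring_A])
qed

lemma scal_regular: "x \<in> carrier A \<Longrightarrow> A.scal (regular_module A) x c = c \<odot>\<^bsub>A\<^esub> x"
  by (simp add: A.scal_def regular_simps A.smult_rmult)

lemma right_closed_NP: "right_closed NP"
  by (simp add: right_closed_def)

lemma fd_module_regular: "fd_module A (regular_module A)"
proof -
  let ?F = "F {()} (\<lambda>_. NP)"
  let ?f = "\<lambda>\<phi>. emb (\<phi> ())"
  have fdF: "fd_module A ?F" by (rule fd_module_F) (auto simp: right_closed_NP)
  have "?f \<in> rmod_hom A ?F (regular_module A)"
    by (rule rmod_homI) (auto simp: F_simps regular_simps emb_add emb_cf)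
  moreover have "bij_betw ?f (carrier ?F) (carrier (regular_module A))"
  proof (rule bij_betwI[of _ _ _ "\<lambda>x _. cf x"])
    show "(\<lambda>x _. cf x) \<in> carrier (regular_module A) \<rightarrow> carrier ?F"
      using cf_outside by (auto simp: F_simps)
    show "(\<lambda>_. cf (emb (\<phi> ()))) = \<phi>" if "\<phi> \<in> carrier ?F" for \<phi>
      using F_supp[OF that] by (auto simp: fun_eq_iff)
  qed (auto simp: regular_simps emb_cf)
  ultimately show ?thesis by (rule fd_module_bij[OF fdF right_module_regular _ _ A.kalgebra_axioms])
qed

end

section \<open>Combinatorics of nonzero paths\<close>

context gentle_algebra
begin

definition arr :: "'a \<Rightarrow> 'v \<times> 'a list" where
  "arr a = (tail Q a, [a])"

lemma arr_simps [simp]: "fst (arr a) = tail Q a" "snd (arr a) = [a]" "pend (arr a) = head Q a"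
  by (simp_all add: arr_def)

lemma arr_NP [simp]: "arr a \<in> NP \<longleftrightarrow> a \<in> arcs Q"
  by (simp add: arr_def)

lemma arr_inj [simp]: "arr a = arr b \<longleftrightarrow> a = b"
  by (auto simp: arr_def)

lemma pcat_trivial_left [simp]: "pcat (fst q, []) q = q"
  by (simp add: pcat_def)

lemma pcat_trivial_right [simp]: "pcat w (v, []) = w"
  by (simp add: pcat_def)

lemma pcat_left_cancel [simp]: "pcat w q = pcat w' q \<longleftrightarrow> w = w'"
  by (auto simp: pcat_def prod_eq_iff)

text \<open>Gentleness leaves at most one nonzero continuation after each arrow, so the two paths
  agree until the shorter one stops.\<close>

lemma prefix_comparable:
  assumes "(u, p) \<in> NP" "(u, q) \<in> NP" "p \<noteq> []" "q \<noteq> []" "hd p = hd q"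
  shows "\<exists>r. q = p @ r \<or> p = q @ r"
  using assms
proof (induction p arbitrary: u q)
  case (Cons a p)
  obtain q' where q: "q = a # q'" using Cons.prems(4,5) by (cases q) auto
  have ap: "(head Q a, p) \<in> NP" "p = [] \<or> \<not> rel a (hd p)" "(u, [a]) \<in> NP"
    using Cons.prems(1) NP_append[of u "[a]" p] by auto
  have aq: "(head Q a, q') \<in> NP" "q' = [] \<or> \<not> rel a (hd q')"
    using Cons.prems(2) NP_append[of u "[a]" q'] by (auto simp: q)
  show ?case
  proof (cases "p = [] \<or> q' = []")
    case False
    have h: "hd p \<in> arcs Q" "hd q' \<in> arcs Q" "tail Q (hd p) = head Q a" "tail Q (hd q') = head Q a"
      using ap aq False NP_arcs[OF ap(1)] NP_arcs[OF aq(1)] NP_tail[OF ap(1)] NP_tail[OF aq(1)] by auto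
    have "a \<in> arcs Q" "\<not> rel a (hd p)" "\<not> rel a (hd q')" using ap aq False by auto
    hence "hd p = hd q'" using gentle_right[of a, OF _ h(1,2)] h(3,4) by metis
    thus ?thesis using Cons.IH[OF ap(1) aq(1)] False by (auto simp: q)
  qed (auto simp: q)
qed simp

text \<open>Mirror image; the starting vertices may differ because the comparison runs backwards
  from the common last arrow.\<close>

lemma suffix_comparable:
  assumes "(u, p) \<in> NP" "(v, q) \<in> NP" "p \<noteq> []" "q \<noteq> []" "last p = last q"
  shows "\<exists>r. q = r @ p \<or> p = r @ q"
  using assms
proof (induction p arbitrary: q rule: rev_induct)
  case (snoc a p)
  obtain q' where q: "q = q' @ [a]" using snoc.prems(4,5) by (cases q rule: rev_cases) auto
  have ap: "(u, p) \<in> NP" "p = [] \<or> \<not> rel (last p) a" "a \<in> arcs Q" "pend (u, p) = tail Q a"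
    using snoc.prems(1) NP_append[of u p "[a]"] by auto
  have aq: "(v, q') \<in> NP" "q' = [] \<or> \<not> rel (last q') a" "pend (v, q') = tail Q a"
    using snoc.prems(2) NP_append[of v q' "[a]"] by (auto simp: q)
  show ?case
  proof (cases "p = [] \<or> q' = []")
    case False
    have "last p \<in> arcs Q" "last q' \<in> arcs Q" "head Q (last p) = tail Q a" "head Q (last q') = tail Q a"
      using ap aq False NP_arcs[OF ap(1)] NP_arcs[OF aq(1)] by (auto simp: pend_nonempty)
    hence "last p = last q'" using gentle_left[of a "last p" "last q'"] ap aq False by auto
    thus ?thesis using snoc.IH[OF ap(1) aq(1)] False by (auto simp: q)
  qed (auto simp: q)
qed simp

lemma suffix_pcat:
  assumes "w \<in> NP" "q \<in> NP" "pend q = pend w" "snd w = r @ snd q"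
  shows "w = pcat (fst w, r) q" "pend (fst w, r) = fst q" "(fst w, r) \<in> NP"
proof -
  have w: "(fst w, r @ snd q) \<in> NP" using assms by (metis prod.collapse)
  show "w = pcat (fst w, r) q" using assms(4) by (simp add: pcat_def prod_eq_iff)
  show "(fst w, r) \<in> NP" using w NP_append by blast
  have *: "(pend (fst w, r), snd q) \<in> NP" using w NP_append by blast
  show "pend (fst w, r) = fst q"
  proof (cases "snd q = []")
    case True
    thus ?thesis using assms by (metis append_Nil2 pend_empty prod.collapse)
  next
    case False
    thus ?thesis using NP_tail[OF *] NP_tail[OF assms(2)] by simp
  qed
qed

lemma prefix_pcat:
  assumes "w \<in> NP" "snd w = snd p @ r" "fst w = fst p"
  shows "w = pcat p (pend p, r)" "(pend p, r) \<in> NP" "p \<in> NP"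
proof -
  have w: "(fst p, snd p @ r) \<in> NP" using assms by (metis prod.collapse)
  show "w = pcat p (pend p, r)" using assms by (simp add: pcat_def prod_eq_iff)
  show "(pend p, r) \<in> NP" "p \<in> NP" using w NP_append[of "fst p" "snd p" r] by auto
qed

section \<open>Maximal nonzero paths\<close>

definition RM :: "('v \<times> 'a list) set" where
  "RM = {w \<in> NP. \<forall>c. (fst w, snd w @ [c]) \<notin> NP}"

text \<open>For trivial \<open>w\<close> the candidate \<open>(tail Q c, [c])\<close> forgets the
  vertex \<open>fst w\<close>, hence the guard on the head of \<open>c\<close>; in \<open>RM\<close>
  the starting vertex is part of the prolonged path.\<close>

definition LM :: "('v \<times> 'a list) set" where
  "LM = {w \<in> NP. \<forall>c. head Q c = fst w \<longrightarrow> (tail Q c, c # snd w) \<notin> NP}"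

lemma RM_NP: "w \<in> RM \<Longrightarrow> w \<in> NP"
  by (simp add: RM_def)

lemma LM_NP: "w \<in> LM \<Longrightarrow> w \<in> NP"
  by (simp add: LM_def)

lemma NP_longest:
  assumes "P w" "\<And>x. P x \<Longrightarrow> x \<in> NP"
  obtains x where "P x" "\<And>y. P y \<Longrightarrow> length (snd y) \<le> length (snd x)"
proof -
  have "\<exists>x. P x \<and> (\<forall>y. P y \<longrightarrow> length (snd y) \<le> length (snd x))"
    by (rule ex_has_greatest_nat[where k = w and b = "Suc (Max ((length \<circ> snd) ` NP))"])
       (use assms finite_NP in \<open>auto simp: less_Suc_eq_le\<close>)
  thus ?thesis using that by blast
qed

lemma RM_extend:
  assumes "w \<in> NP"
  obtains q where "pcat w q \<in> RM" "pend w = fst q" "q \<in> NP"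
proof -
  let ?P = "\<lambda>x. x \<in> NP \<and> (\<exists>q. x = pcat w q \<and> pend w = fst q)"
  have "?P w" using assms by (auto intro!: exI[of _ "(pend w, [])"])
  then obtain x where x: "?P x" and max: "\<And>y. ?P y \<Longrightarrow> length (snd y) \<le> length (snd x)"
    using NP_longest[of ?P] by metis
  obtain q where q: "x = pcat w q" "pend w = fst q" using x by blast
  have "(fst x, snd x @ [c]) \<notin> NP" for c
  proof
    assume c: "(fst x, snd x @ [c]) \<in> NP"
    have "?P (fst x, snd x @ [c])"
      using c q by (auto intro!: exI[of _ "(fst q, snd q @ [c])"] simp: pcat_def)
    from max[OF this] show False by simp
  qed
  hence "pcat w q \<in> RM" using x q by (simp add: RM_def)
  thus ?thesis using that q NP_pcat[OF q(2)] RM_NP by blast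
qed

lemma LM_extend:
  assumes "w \<in> NP"
  obtains q where "pcat q w \<in> LM" "pend q = fst w" "q \<in> NP"
proof -
  let ?P = "\<lambda>x. x \<in> NP \<and> (\<exists>q. x = pcat q w \<and> pend q = fst w)"
  have "?P w" using assms by (auto intro!: exI[of _ "(fst w, [])"])
  then obtain x where x: "?P x" and max: "\<And>y. ?P y \<Longrightarrow> length (snd y) \<le> length (snd x)"
    using NP_longest[of ?P] by metis
  obtain q where q: "x = pcat q w" "pend q = fst w" using x by blast
  have "(tail Q c, c # snd x) \<notin> NP" if h: "head Q c = fst x" for c
  proof
    assume c: "(tail Q c, c # snd x) \<in> NP"
    have "pend (tail Q c, c # snd q) = pend q"
      using h q(1) by (simp add: pend_def)
    hence "?P (tail Q c, c # snd x)"
      using c q by (auto intro!: exI[of _ "(tail Q c, c # snd q)"] simp: pcat_def)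
    from max[OF this] show False by simp
  qed
  hence "pcat q w \<in> LM" using x q by (simp add: LM_def)
  thus ?thesis using that q NP_pcat[OF q(2)] LM_NP by blast
qed

text \<open>A right-maximal path can only be stopped by a relation. In particular a trivial one sits
  at a vertex without outgoing arrows.\<close>

lemma RM_rel:
  assumes "w \<in> RM" "c \<in> arcs Q" "tail Q c = pend w"
  shows "snd w \<noteq> [] \<and> rel (last (snd w)) c"
proof (rule ccontr)
  assume *: "\<not> ?thesis"
  have "pcat w (arr c) \<in> NP"
    using assms * by (subst NP_pcat) (auto simp: RM_NP)
  thus False using assms(1) by (simp add: RM_def pcat_def)
qed

lemma LM_rel:
  assumes "w \<in> LM" "c \<in> arcs Q" "head Q c = fst w"
  shows "snd w \<noteq> [] \<and> rel c (hd (snd w))"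
proof (rule ccontr)
  assume *: "\<not> ?thesis"
  have "pcat (arr c) w \<in> NP"
    using assms * by (subst NP_pcat) (auto simp: LM_NP)
  thus False using assms by (simp add: LM_def pcat_def)
qed

lemma RM_out_unique:
  "\<lbrakk>w \<in> RM; c \<in> arcs Q; c' \<in> arcs Q; tail Q c = pend w; tail Q c' = pend w\<rbrakk> \<Longrightarrow> c = c'"
  using RM_rel rel_right_unique by blast

lemma LM_in_unique:
  "\<lbrakk>w \<in> LM; c \<in> arcs Q; c' \<in> arcs Q; head Q c = fst w; head Q c' = fst w\<rbrakk> \<Longrightarrow> c = c'"
  using LM_rel rel_left_unique by blast

text \<open>The two paths are comparable, and if they differed, the shorter one could be
  prolonged.\<close>

lemma RM_unique:
  assumes "p \<in> RM" "p' \<in> RM" "fst p = fst p'" "snd p \<noteq> []" "snd p' \<noteq> []" "hd (snd p) = hd (snd p')"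
  shows "p = p'"
proof -
  have maxi: "r = []" if "x \<in> RM" "(fst x, snd x @ r) \<in> NP" for x r
  proof (rule ccontr)
    assume "r \<noteq> []"
    then obtain c r' where r: "r = c # r'" by (cases r) auto
    have "(fst x, snd x @ [c]) \<in> NP" using that(2) NP_append[of "fst x" "snd x @ [c]" r'] by (simp add: r)
    thus False using that(1) by (simp add: RM_def)
  qed
  have NP: "(fst p, snd p) \<in> NP" "(fst p, snd p') \<in> NP" using assms RM_NP by (auto, metis prod.collapse)
  obtain r where r: "snd p' = snd p @ r \<or> snd p = snd p' @ r"
    using prefix_comparable[OF NP] assms by blast
  have "snd p = snd p'"
    using r
  proof
    assume r: "snd p' = snd p @ r"
    have "r = []" by (rule maxi[OF assms(1)]) (use NP(2) in \<open>simp only: r\<close>)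
    thus ?thesis using r by simp
  next
    assume r: "snd p = snd p' @ r"
    have "r = []" by (rule maxi[OF assms(2)]) (use NP(1) in \<open>simp only: r assms(3)\<close>)
    thus ?thesis using r by simp
  qed
  thus ?thesis using assms(3) by (simp add: prod_eq_iff)
qed

lemma LM_unique:
  assumes "p \<in> LM" "p' \<in> LM" "snd p \<noteq> []" "snd p' \<noteq> []" "last (snd p) = last (snd p')"
  shows "p = p'"
proof -
  have maxi: "r = []" if "x \<in> LM" "snd x \<noteq> []" "(v, r @ snd x) \<in> NP" for x r v
  proof (rule ccontr)
    assume "r \<noteq> []"
    then obtain c r' where r: "r = r' @ [c]" by (cases r rule: rev_cases) auto
    have "(pend (v, r'), [c] @ snd x) \<in> NP" using that(3) NP_append[of v r' "[c] @ snd x"] by (simp add: r)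
    moreover from this have "pend (v, r') = tail Q c" "(head Q c, snd x) \<in> NP"
      using NP_append[of "pend (v, r')" "[c]" "snd x"] by auto
    moreover have "head Q c = fst x"
      using NP_tail[OF calculation(3)] NP_tail[OF LM_NP[OF that(1)]] that(2) by simp
    ultimately show False using that(1) by (simp add: LM_def)
  qed
  have NP: "(fst p, snd p) \<in> NP" "(fst p', snd p') \<in> NP" using assms LM_NP by auto
  obtain r where r: "snd p' = r @ snd p \<or> snd p = r @ snd p'"
    using suffix_comparable[OF NP] assms by blast
  have "snd p = snd p'"
    using r
  proof
    assume r: "snd p' = r @ snd p"
    have "r = []" by (rule maxi[OF assms(1,3)]) (use NP(2) in \<open>simp only: r\<close>)
    thus ?thesis using r by simp
  next
    assume r: "snd p = r @ snd p'"
    have "r = []" by (rule maxi[OF assms(2,4)]) (use NP(1) in \<open>simp only: r\<close>)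
    thus ?thesis using r by simp
  qed
  thus ?thesis using NP_tail[OF NP(1)] NP_tail[OF NP(2)] assms(3) by (simp add: prod_eq_iff)
qed

lemma RM_unique':
  assumes "p \<in> RM" "p' \<in> RM" "fst p = fst p'" "out_degree Q (fst p) \<noteq> 2"
  shows "p = p'"
proof (cases "snd p = [] \<or> snd p' = []")
  case True
  have "x = y" if "x \<in> RM" "y \<in> RM" "fst x = fst y" "snd x = []" for x y
  proof (cases "snd y = []")
    case False
    have "hd (snd y) \<in> arcs Q" "tail Q (hd (snd y)) = fst y"
      using NP_arcs[OF RM_NP[OF that(2)]] NP_tail[OF RM_NP[OF that(2)]] False by auto
    thus ?thesis using RM_rel[OF that(1), of "hd (snd y)"] that by (simp add: pend_empty)
  qed (use that in \<open>simp add: prod_eq_iff\<close>)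
  thus ?thesis using assms True by metis
next
  case False
  have "hd (snd p) \<in> arcs Q" "tail Q (hd (snd p)) = fst p" "hd (snd p') \<in> arcs Q" "tail Q (hd (snd p')) = fst p"
    using NP_arcs[OF RM_NP[OF assms(1)]] NP_tail[OF RM_NP[OF assms(1)]]
      NP_arcs[OF RM_NP[OF assms(2)]] NP_tail[OF RM_NP[OF assms(2)]] assms(3) False by auto
  hence "hd (snd p) = hd (snd p')" using out_degree_2I assms(4) by metis
  thus ?thesis using RM_unique assms False by blast
qed

text \<open>At a vertex with two outgoing arrows there are two candidates; the choice decides which
  of them carries the positive sign in \<open>sg\<close>.\<close>

definition first :: "'v \<Rightarrow> 'v \<times> 'a list" where
  "first u = (SOME p. p \<in> RM \<and> fst p = u)"

lemma first: "u \<in> verts Q \<Longrightarrow> first u \<in> RM \<and> fst (first u) = u"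
  unfolding first_def
  by (rule someI_ex) (metis NP_trivial RM_extend fst_conv pcat_simps(1))

lemma RM_out_2:
  assumes "out_degree Q u = 2" "u \<in> verts Q"
  obtains p where "{p \<in> RM. fst p = u} = {first u, p}" "p \<noteq> first u"
    "snd p \<noteq> []" "snd (first u) \<noteq> []" "hd (snd p) \<noteq> hd (snd (first u))"
    "hd (snd p) \<in> arcs Q" "hd (snd (first u)) \<in> arcs Q" "tail Q (hd (snd p)) = u" "tail Q (hd (snd (first u))) = u"
proof -
  obtain a b where ab: "out_arcs Q u = {a, b}" "a \<noteq> b" using out_degree_2[OF assms(1)] .
  have arcs: "a \<in> arcs Q" "b \<in> arcs Q" "tail Q a = u" "tail Q b = u" using ab(1) by (auto simp: set_eq_iff)
  have nt: "snd p \<noteq> [] \<and> hd (snd p) \<in> {a, b}" if p: "p \<in> RM" "fst p = u" for p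
  proof
    show ne: "snd p \<noteq> []" using RM_rel[OF p(1) arcs(1)] p arcs by (cases "snd p = []") (auto simp: pend_empty)
    show "hd (snd p) \<in> {a, b}"
      using NP_arcs[OF RM_NP[OF p(1)]] NP_tail[OF RM_NP[OF p(1)] ne] ne p unfolding ab(1)[symmetric] by auto
  qed
  have ex: "\<exists>p\<in>RM. fst p = u \<and> hd (snd p) = c" if "c \<in> {a, b}" for c
  proof -
    have "arr c \<in> NP" using that arcs by auto
    then obtain q where "pcat (arr c) q \<in> RM" using RM_extend by blast
    thus ?thesis using that arcs by (intro bexI[of _ "pcat (arr c) q"]) auto
  qed
  have f: "first u \<in> RM" "fst (first u) = u" using first[OF assms(2)] by auto
  obtain c where c: "c \<in> {a, b}" "c \<noteq> hd (snd (first u))" using ab(2) by blast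
  obtain p where p: "p \<in> RM" "fst p = u" "hd (snd p) = c" using ex[OF c(1)] by blast
  have "x = first u \<or> x = p" if x: "x \<in> RM" "fst x = u" for x
  proof -
    have "hd (snd x) = hd (snd (first u)) \<or> hd (snd x) = hd (snd p)"
      using nt[OF x] nt[OF f] nt[OF p(1,2)] p(3) c by auto
    thus ?thesis using RM_unique[OF x(1) f(1)] RM_unique[OF x(1) p(1)] nt[OF x] nt[OF f] nt[OF p(1,2)] x f p by metis
  qed
  hence "{p \<in> RM. fst p = u} = {first u, p}" using f p by auto
  moreover have "p \<noteq> first u" using c p by auto
  ultimately show ?thesis using that[of p] c p nt[OF f] nt[OF p(1,2)] arcs by auto
qed

text \<open>\<open>D k\<close> collects the arrows from which the chain of relations runs for
  exactly \<open>k\<close> more steps. Arrows on a cycle of relations belong to no layer.\<close>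

primrec D :: "nat \<Rightarrow> 'a set" where
  "D 0 = {f \<in> arcs Q. \<forall>c. \<not> rel f c}"
| "D (Suc k) = {g \<in> arcs Q. \<exists>f\<in>D k. rel g f}"

lemma D_arcs: "f \<in> D k \<Longrightarrow> f \<in> arcs Q"
  by (cases k) auto

lemma D_Suc: "rel g f \<Longrightarrow> g \<in> D (Suc k) \<longleftrightarrow> f \<in> D k"
  using rel_right_unique relD(1) by auto

lemma D_disjoint: "f \<in> D j \<Longrightarrow> f \<in> D k \<Longrightarrow> j = k"
proof (induction j arbitrary: f k)
  case 0
  thus ?case by (cases k) auto
next
  case (Suc j)
  then obtain c where "rel f c" "c \<in> D j" by auto
  thus ?case using Suc.IH[of c "k - 1"] Suc.prems(2) D_Suc[of f c "k - 1"] by (cases k) auto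
qed

text \<open>The relation chains are deterministic in both directions, hence the layers are disjoint and,
  there being finitely many arrows, eventually empty.\<close>

lemma D_eventually_empty: "\<exists>N. \<forall>k\<ge>N. D k = {}"
proof -
  let ?K = "{k. D k \<noteq> {}}"
  have "inj_on (\<lambda>k. SOME f. f \<in> D k) ?K"
  proof (rule inj_onI)
    fix j k assume *: "j \<in> ?K" "k \<in> ?K" "(SOME f. f \<in> D j) = (SOME f. f \<in> D k)"
    have "(SOME f. f \<in> D j) \<in> D j" "(SOME f. f \<in> D k) \<in> D k"
      using *(1,2) by (simp_all add: some_in_eq)
    thus "j = k" using D_disjoint *(3) by metis
  qed
  moreover have "(\<lambda>k. SOME f. f \<in> D k) ` ?K \<subseteq> arcs Q"
  proof
    fix f assume "f \<in> (\<lambda>k. SOME f. f \<in> D k) ` ?K"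
    then obtain k where k: "D k \<noteq> {}" "f = (SOME f. f \<in> D k)" by auto
    hence "f \<in> D k" by (simp add: some_in_eq)
    thus "f \<in> arcs Q" by (rule D_arcs)
  qed
  ultimately have "finite ?K" using finite_arcs by (meson finite_imageD finite_subset)
  then obtain N where "\<forall>k\<in>?K. k < N" by (meson finite_nat_set_iff_bounded)
  thus ?thesis by (intro exI[of _ N]) fastforce
qed

definition succ :: "'a \<Rightarrow> 'a" where
  "succ a = (SOME c. rel a c)"

lemma succ_eq: "rel a c \<Longrightarrow> succ a = c"
  unfolding succ_def by (rule some_equality) (auto dest: rel_right_unique)

lemma D_succ: "g \<in> D (Suc k) \<Longrightarrow> rel g (succ g) \<and> succ g \<in> D k"
  using succ_eq by auto

text \<open>Of two arrows leaving the head of \<open>d\<close>, gentleness would make one form a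
  relation with \<open>d\<close>.\<close>

lemma D_0_out: "d \<in> D 0 \<Longrightarrow> out_degree Q (head Q d) \<noteq> 2"
proof
  assume d: "d \<in> D 0" and "out_degree Q (head Q d) = 2"
  then obtain a b where ab: "out_arcs Q (head Q d) = {a, b}" "a \<noteq> b" using out_degree_2 by metis
  have "a \<in> arcs Q" "b \<in> arcs Q" "tail Q a = head Q d" "tail Q b = head Q d"
    using ab(1) by (auto simp: set_eq_iff)
  moreover have "d \<in> arcs Q" "\<not> rel d a" "\<not> rel d b" using d by auto
  ultimately show False using gentle_right[of d a b] ab(2) by metis
qed

lemma D_0_first:
  assumes "d \<in> D 0"
  shows "first (head Q d) \<in> RM" "fst (first (head Q d)) = head Q d" "pcat (arr d) (first (head Q d)) \<in> NP"
proof -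
  have d: "d \<in> arcs Q" using assms by simp
  show f: "first (head Q d) \<in> RM" "fst (first (head Q d)) = head Q d"
    using first[of "head Q d"] d by auto
  show "pcat (arr d) (first (head Q d)) \<in> NP"
    using assms f RM_NP by (subst NP_pcat) auto
qed

text \<open>With these signs the sum over the right-maximal paths from a vertex with two outgoing
  arrows is a difference of two values. Its vanishing says that they agree, as they do on the image
  of the algebra.\<close>

definition sg :: "'v \<times> 'a list \<Rightarrow> 'k" where
  "sg p = (if p = first (fst p) then 1 else - 1)"

text \<open>The last clause is gentleness at \<open>u\<close>: a nontrivial path into
  \<open>u\<close> continues along exactly one of the two maximal paths.\<close>

lemma RM_out_2_sum:
  assumes "out_degree Q u = 2" "u \<in> verts Q"
  obtains p where "p \<in> RM" "fst p = u" "p \<noteq> first u" "sg p = -1" "sg (first u) = 1" "snd p \<noteq> []" "snd (first u) \<noteq> []"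
    "\<And>f. (\<Sum>p\<in>{p \<in> RM. fst p = u}. sg p * f p) = f (first u) - (f p :: 'k)"
    "\<And>x. x \<in> RM \<Longrightarrow> fst x = u \<Longrightarrow> x = first u \<or> x = p"
    "\<And>q. q \<in> NP \<Longrightarrow> pend q = u \<Longrightarrow> snd q \<noteq> [] \<Longrightarrow> pcat q p \<in> NP \<longleftrightarrow> pcat q (first u) \<notin> NP"
proof -
  obtain p where p: "{p \<in> RM. fst p = u} = {first u, p}" "p \<noteq> first u"
    "snd p \<noteq> []" "snd (first u) \<noteq> []" "hd (snd p) \<noteq> hd (snd (first u))"
    "hd (snd p) \<in> arcs Q" "hd (snd (first u)) \<in> arcs Q" "tail Q (hd (snd p)) = u" "tail Q (hd (snd (first u))) = u"
    by (rule RM_out_2[OF assms])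
  have pR: "p \<in> RM" "fst p = u" using p(1) by auto
  have f: "first u \<in> RM" "fst (first u) = u" using first[OF assms(2)] by auto
  have s: "sg p = -1" "sg (first u) = 1" using p(2) pR f by (auto simp: sg_def)
  have sum: "(\<Sum>p\<in>{p \<in> RM. fst p = u}. sg p * f p) = f (first u) - f p" for f :: "'v \<times> 'a list \<Rightarrow> 'k"
    unfolding p(1) using p(2) s by simp
  have cat: "pcat q p \<in> NP \<longleftrightarrow> pcat q (first u) \<notin> NP" if q: "q \<in> NP" "pend q = u" "snd q \<noteq> []" for q
  proof -
    have l: "last (snd q) \<in> arcs Q" "head Q (last (snd q)) = u"
      using NP_arcs[OF q(1)] q by (auto simp: pend_nonempty)
    show ?thesis
      using q pR f p gentle_right[OF l(1) p(6,7,5)] l RM_NP by (simp add: NP_pcat)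
  qed
  have el: "x = first u \<or> x = p" if "x \<in> RM" "fst x = u" for x
    using that p(1) by blast
  show ?thesis by (rule that[of p, OF pR p(2) s p(3,4) sum el cat])
qed

end

section \<open>The minimal injective resolution\<close>

locale balanced_gentle_algebra = gentle_algebra Q I
  for Q :: "('v, 'a) pre_digraph" and I :: "('v \<times> 'a list \<Rightarrow> 'k::field) set" +
  assumes balanced: "\<And>v. v \<in> verts Q \<Longrightarrow> in_degree Q v = 2 \<longleftrightarrow> out_degree Q v = 2"
begin

text \<open>If two arrows entered the end, two would leave it by the degree condition, but at most
  one arrow can leave the end of a right-maximal path. This is why \<open>I(pend w)\<close> is
  uniserial.\<close>

lemma RM_in_unique:
  assumes "w \<in> RM" "a \<in> arcs Q" "b \<in> arcs Q" "head Q a = pend w" "head Q b = pend w"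
  shows "a = b"
proof (rule ccontr)
  assume "a \<noteq> b"
  hence "out_degree Q (pend w) = 2"
    using in_degree_2I assms balanced NP_pend[OF RM_NP[OF assms(1)]] by metis
  then obtain c c' where cc: "out_arcs Q (pend w) = {c, c'}" "c \<noteq> c'" using out_degree_2 by metis
  have "c \<in> arcs Q" "c' \<in> arcs Q" "tail Q c = pend w" "tail Q c' = pend w" using cc(1) by (auto simp: set_eq_iff)
  thus False using RM_out_unique[OF assms(1)] cc(2) by blast
qed

lemma LM_out_unique:
  assumes "w \<in> LM" "a \<in> arcs Q" "b \<in> arcs Q" "tail Q a = fst w" "tail Q b = fst w"
  shows "a = b"
proof (rule ccontr)
  assume "a \<noteq> b"
  hence "in_degree Q (fst w) = 2"
    using out_degree_2I assms balanced NP_fst[OF LM_NP[OF assms(1)]] by metis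
  then obtain c c' where cc: "in_arcs Q (fst w) = {c, c'}" "c \<noteq> c'" using in_degree_2 by metis
  have "c \<in> arcs Q" "c' \<in> arcs Q" "head Q c = fst w" "head Q c' = fst w" using cc(1) by (auto simp: set_eq_iff)
  thus False using LM_in_unique[OF assms(1)] cc(2) by blast
qed

text \<open>All nontrivial nonzero paths into the end of \<open>p\<close> share their last arrow, so
  they are linearly ordered by the suffix relation.\<close>

lemma RM_suffix:
  assumes p: "p \<in> RM" and q: "q \<in> NP" "pend q = pend p"
  obtains w where "p = pcat w q" "pend w = fst q" "w \<in> NP"
  | w where "q = pcat w p" "pend w = fst p" "w \<in> NP" "snd w \<noteq> []"
proof -
  have "\<exists>r. snd p = r @ snd q \<or> snd q = r @ snd p"
  proof (cases "snd p = [] \<or> snd q = []")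
    case False
    have "last (snd p) \<in> arcs Q" "last (snd q) \<in> arcs Q"
      using False NP_arcs[OF RM_NP[OF p]] NP_arcs[OF q(1)] by auto
    moreover have "head Q (last (snd p)) = pend p" "head Q (last (snd q)) = pend p"
      using False q(2) by (simp_all add: pend_nonempty)
    ultimately have "last (snd p) = last (snd q)" using RM_in_unique[OF p] by blast
    thus ?thesis using suffix_comparable[of "fst p" "snd p" "fst q" "snd q"] RM_NP[OF p] q False by auto
  qed auto
  then obtain r where "snd p = r @ snd q \<or> (snd q = r @ snd p \<and> r \<noteq> [])" by (metis append_Nil)
  thus ?thesis
    using suffix_pcat[OF RM_NP[OF p] q(1,2), of r] suffix_pcat[OF q(1) RM_NP[OF p] q(2)[symmetric], of r] that
    by (metis snd_conv)
qed

text \<open>The trivial path at \<open>u\<close> labels the summand \<open>I(u)\<close> that is the cokernel of \<open>P(u)\<close>; an arrow \<open>f\<close>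
  labels the summand \<open>I(w)\<close> for the source \<open>w\<close> of \<open>f\<close>.\<close>

definition Lab :: "nat \<Rightarrow> ('v \<times> 'a list) set" where
  "Lab n = (case n of 0 \<Rightarrow> RM
     | Suc k \<Rightarrow> (if k = 0 then {(u, []) | u. u \<in> verts Q \<and> out_degree Q u = 2} else {}) \<union> arr ` D k)"

text \<open>In degree 0 the injective sits at the end of the labelling path, in higher degrees at
  the source of the label.\<close>

definition tgt :: "nat \<Rightarrow> 'v \<times> 'a list \<Rightarrow> 'v" where
  "tgt n = (if n = 0 then pend else fst)"

definition E :: "nat \<Rightarrow> (('v \<times> 'a list \<Rightarrow> 'k) set, 'v \<times> 'a list \<Rightarrow> 'v \<times> 'a list \<Rightarrow> 'k) rmod" where
  "E n = C (Lab n) (tgt n)"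

lemma Lab_simps: "Lab 0 = RM"
  "Lab (Suc 0) = {(u, []) | u. u \<in> verts Q \<and> out_degree Q u = 2} \<union> arr ` D 0"
  "Lab (Suc (Suc k)) = arr ` D (Suc k)"
  by (simp_all add: Lab_def)

lemma tgt_simps [simp]: "tgt 0 = pend" "tgt (Suc n) = fst"
  by (simp_all add: tgt_def)

lemma arr_Lab: "f \<in> D k \<Longrightarrow> arr f \<in> Lab (Suc k)"
  by (auto simp: Lab_def)

lemma Lab_cases:
  assumes "l \<in> Lab (Suc k)"
  obtains u where "k = 0" "l = (u, [])" "u \<in> verts Q" "out_degree Q u = 2"
  | f where "f \<in> D k" "l = arr f"
  using assms by (auto simp: Lab_def split: if_splits)

lemma finite_Lab: "finite (Lab n)"
proof (cases n)
  case 0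
  thus ?thesis using finite_NP by (auto simp: Lab_def RM_def)
next
  case (Suc k)
  have "finite (D k)" using D_arcs finite_arcs by (meson finite_subset subsetI)
  moreover have "finite {(u, []) | u. u \<in> verts Q \<and> out_degree Q u = 2}" by simp
  ultimately show ?thesis using Suc by (simp add: Lab_def)
qed

lemma tgt_verts: "l \<in> Lab n \<Longrightarrow> tgt n l \<in> verts Q"
  by (cases n) (auto simp: Lab_simps(1) RM_NP NP_pend D_arcs elim!: Lab_cases)

lemma right_module_E: "right_module A (E n)"
  by (simp add: E_def right_module_C)

lemma injective_E: "injective_module A (E n)"
  unfolding E_def by (rule injective_C[OF finite_Lab tgt_verts])

lemma E_carrier: "\<phi> \<in> carrier (E n) \<longleftrightarrow> (\<forall>l q. \<phi> l q \<noteq> 0 \<longrightarrow> l \<in> Lab n \<and> q \<in> NP \<and> pend q = tgt n l)"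
  by (simp add: E_def C_simps)

lemma E_zero: "\<zero>\<^bsub>E n\<^esub> = (\<lambda>_ _. 0)"
  by (simp add: E_def C_simps)

lemma E_outside: "\<phi> \<in> carrier (E n) \<Longrightarrow> l \<notin> Lab n \<or> q \<notin> NP \<or> pend q \<noteq> tgt n l \<Longrightarrow> \<phi> l q = 0"
  unfolding E_carrier by blast

text \<open>The homomorphism that \<open>hom_to_C\<close> assigns to the functionals reading the
  coefficient at each right-maximal path.\<close>

definition e :: "('v \<times> 'a list \<Rightarrow> 'k) set \<Rightarrow> 'v \<times> 'a list \<Rightarrow> 'v \<times> 'a list \<Rightarrow> 'k" where
  "e m = (\<lambda>p q. if p \<in> RM \<and> q \<in> NP \<and> pend q = pend p then cf (m \<otimes>\<^bsub>A\<^esub> be q) p else 0)"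

text \<open>The functionals from which \<open>hom_to_C\<close> produces \<open>d n\<close>. The
  image of \<open>e\<close> consists of the \<open>\<phi>\<close> that vanish at
  \<open>(p, q)\<close> for \<open>q\<close> a proper prolongation of \<open>p\<close> to the left,
  and whose values \<open>\<phi> p p\<close> agree for all right-maximal \<open>p\<close> with the
  same start. For \<open>n = 0\<close> a vertex label compares these values, and an arrow label
  \<open>f\<close> reads the value at \<open>f p\<close>. In higher degrees an arrow label reads the
  summand of the next arrow in its chain.\<close>

definition lam :: "nat \<Rightarrow> 'v \<times> 'a list \<Rightarrow> ('v \<times> 'a list \<Rightarrow> 'v \<times> 'a list \<Rightarrow> 'k) \<Rightarrow> 'k" where
  "lam n l \<phi> = (if n = 0 then
       if snd l = [] then \<Sum>p\<in>{p \<in> RM. fst p = fst l}. sg p * \<phi> p p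
       else \<phi> (first (pend l)) (pcat l (first (pend l)))
     else \<phi> (arr (succ (hd (snd l)))) l)"

definition d :: "nat \<Rightarrow> ('v \<times> 'a list \<Rightarrow> 'v \<times> 'a list \<Rightarrow> 'k) \<Rightarrow> 'v \<times> 'a list \<Rightarrow> 'v \<times> 'a list \<Rightarrow> 'k" where
  "d n \<phi> = (\<lambda>l q. if l \<in> Lab (Suc n) \<and> q \<in> NP \<and> pend q = fst l then lam n l (\<phi> \<triangleleft>\<^bsub>E n\<^esub> be q) else 0)"

lemma e_hom: "e \<in> rmod_hom A (regular_module A) (E 0)"
proof -
  have "A.linear_on (regular_module A) (carrier (regular_module A)) (\<lambda>m. cf m l)" for l
    by (rule A.linear_onI) (auto simp: regular_simps scal_regular cf_add cf_smult)
  from hom_to_C[OF right_module_regular, where L = RM and lam = "\<lambda>l m. cf m l" and \<tau> = pend, OF this,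
      unfolded regular_simps]
  show ?thesis
    by (simp add: E_def Lab_simps(1) e_def[abs_def])
qed

lemma d_hom: "d n \<in> rmod_hom A (E n) (E (Suc n))"
proof -
  have "A.linear_on (E n) (carrier (E n)) (lam n l)" for l
  proof (rule A.linear_onI)
    fix x y assume "x \<in> carrier (E n)" "y \<in> carrier (E n)"
    show "lam n l (x \<oplus>\<^bsub>E n\<^esub> y) = lam n l x + lam n l y"
      by (simp add: E_def C_simps lam_def distrib_left sum.distrib)
  next
    fix x c assume "x \<in> carrier (E n)"
    thus "lam n l (A.scal (E n) x c) = c * lam n l x"
      by (simp add: E_def scal_C lam_def sum_distrib_left mult_ac)
  qed
  from hom_to_C[OF right_module_E, where L = "Lab (Suc n)" and lam = "lam n" and \<tau> = fst, OF this]
  show ?thesis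
    by (simp add: E_def[of "Suc n"] d_def[abs_def])
qed

text \<open>Prolonging \<open>w\<close> to a right-maximal path makes its coefficient visible as a
  value of \<open>e m\<close>; \<open>e_inj\<close> and \<open>kernel_d_0\<close> recover
  \<open>m\<close> from such values.\<close>

lemma e_eval:
  assumes "m \<in> carrier A" "pcat w q \<in> RM" "pend w = fst q"
  shows "e m (pcat w q) q = cf m w"
proof -
  have NP: "pcat w q \<in> NP" using assms(2) by (rule RM_NP)
  hence "q \<in> NP" using NP_pcat[OF assms(3)] by blast
  thus ?thesis using assms NP by (simp add: e_def cf_mult_be_right pend_pcat)
qed

lemma e_eval_0:
  assumes "m \<in> carrier A" "length (snd p) < length (snd q)"
  shows "e m p q = 0"
proof (rule ccontr)
  assume "e m p q \<noteq> 0"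
  hence "cf (m \<otimes>\<^bsub>A\<^esub> be q) p \<noteq> 0" by (auto simp: e_def split: if_splits)
  then obtain w where "p = pcat w q" using cf_mult_be_right_nonzero[OF assms(1)] by blast
  thus False using assms(2) by simp
qed

lemma d_0_arr:
  assumes \<phi>: "\<phi> \<in> carrier (E 0)" and d: "f \<in> D 0" and q: "q \<in> NP" "pend q = tail Q f"
  shows "d 0 \<phi> (arr f) q = \<phi> (first (head Q f)) (pcat (pcat q (arr f)) (first (head Q f)))"
  using assms arr_Lab[OF d] D_0_first[OF d]
  by (simp add: d_def lam_def E_def C_ract_be pcat_assoc)

lemma d_0_vertex:
  assumes \<phi>: "\<phi> \<in> carrier (E 0)" and u: "u \<in> verts Q" "out_degree Q u = 2" and q: "q \<in> NP" "pend q = u"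
  shows "d 0 \<phi> (u, []) q = (\<Sum>p\<in>{p \<in> RM. fst p = u}. sg p * \<phi> p (pcat q p))"
proof -
  have "(u, []) \<in> Lab (Suc 0)" using u by (auto simp: Lab_simps)
  moreover have "(\<phi> \<triangleleft>\<^bsub>E 0\<^esub> be q) p p = \<phi> p (pcat q p)" if "p \<in> RM" "fst p = u" for p
    using \<phi> that q RM_NP by (simp add: E_def C_ract_be)
  ultimately show ?thesis using q by (simp add: d_def lam_def)
qed

lemma d_Suc:
  assumes \<phi>: "\<phi> \<in> carrier (E (Suc n))" and g: "g \<in> D (Suc n)" and q: "q \<in> NP" "pend q = tail Q g"
  shows "d (Suc n) \<phi> (arr g) q = \<phi> (arr (succ g)) (pcat q (arr g))"
  using assms arr_Lab[OF g] D_arcs[OF g] by (simp add: d_def lam_def E_def C_ract_be)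

lemma d_outside: "l \<notin> Lab (Suc n) \<or> q \<notin> NP \<or> pend q \<noteq> fst l \<Longrightarrow> d n \<phi> l q = 0"
  by (auto simp: d_def)

section \<open>Exactness of the resolution\<close>

lemma e_inj: "inj_on e (carrier A)"
proof -
  have "inj_on e (carrier (regular_module A))"
  proof (rule rmod_hom_inj[OF e_hom right_module_regular right_module_E])
    fix m assume "m \<in> carrier (regular_module A)" "e m = \<zero>\<^bsub>E 0\<^esub>"
    hence m: "m \<in> carrier A" and z: "\<And>p q. e m p q = 0" by (auto simp: regular_simps E_zero)
    have "cf m w = 0" if w: "w \<in> NP" for w
    proof -
      obtain q where "pcat w q \<in> RM" "pend w = fst q" using RM_extend[OF w] by blast
      thus ?thesis using e_eval[OF m] z by metis
    qed
    thus "m = \<zero>\<^bsub>regular_module A\<^esub>"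
      unfolding regular_simps by (intro cf_eqI) (auto simp: m cf_zero)
  qed
  thus ?thesis by (simp add: regular_simps)
qed

text \<open>The values read lie at paths longer than their label, where \<open>e m\<close> vanishes,
  except at the trivial path of a vertex label; there both values are the coefficient of that
  trivial path and cancel.\<close>

lemma d_0_e: "m \<in> carrier A \<Longrightarrow> d 0 (e m) = (\<lambda>_ _. 0)"
proof (intro ext)
  fix l q assume m: "m \<in> carrier A"
  have em: "e m \<in> carrier (E 0)" using rmod_homD(1)[OF e_hom] m by (simp add: regular_simps)
  show "d 0 (e m) l q = 0"
  proof (cases "l \<in> Lab (Suc 0) \<and> q \<in> NP \<and> pend q = fst l")
    case False
    thus ?thesis using d_outside by blast
  next
    case True
    hence q: "q \<in> NP" "pend q = fst l" and "l \<in> Lab (Suc 0)" by auto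
    from this(3) show ?thesis
    proof (cases rule: Lab_cases)
      case (1 u)
      have u: "pend q = u" using q 1 by simp
      show ?thesis
      proof (cases "snd q = []")
        case True
        hence "q = (u, [])" using u by (simp add: prod_eq_iff pend_empty)
        hence "e m p (pcat q p) = cf m (u, [])" if "p \<in> RM" "fst p = u" for p
          using that e_eval[OF m, of "(u, [])" p] pcat_trivial_left[of p] by simp
        hence "d 0 (e m) l q = (\<Sum>p\<in>{p \<in> RM. fst p = u}. sg p * cf m (u, []))"
          unfolding 1(2) d_0_vertex[OF em 1(3,4) q(1) u] by (intro sum.cong) auto
        also have "\<dots> = 0"
        proof (rule RM_out_2_sum[OF 1(4,3)])
          fix p assume "\<And>f. (\<Sum>p\<in>{p \<in> RM. fst p = u}. sg p * f p) = f (first u) - (f p :: 'k)"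
          thus ?thesis by simp
        qed
        finally show ?thesis .
      next
        case False
        have "e m p (pcat q p) = 0" for p by (rule e_eval_0[OF m]) (use False in simp)
        thus ?thesis unfolding 1(2) d_0_vertex[OF em 1(3,4) q(1) u] by simp
      qed
    next
      case (2 f)
      have "pend q = tail Q f" using q 2 by simp
      thus ?thesis unfolding 2(2) by (subst d_0_arr[OF em 2(1) q(1)]) (auto intro!: e_eval_0[OF m])
    qed
  qed
qed

text \<open>The preimage takes the coefficient of \<open>w\<close> from one chosen right-maximal
  prolongation. The kernel condition shows that the choice is immaterial and that the values at
  longer paths vanish.\<close>

lemma kernel_d_0:
  assumes \<phi>: "\<phi> \<in> carrier (E 0)" and z: "d 0 \<phi> = (\<lambda>_ _. 0)"
  shows "\<phi> \<in> e ` carrier A"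
proof -
  have "\<exists>q. pcat w q \<in> RM \<and> pend w = fst q" if "w \<in> NP" for w
    using RM_extend[OF that] by blast
  then obtain r where r: "\<And>w. w \<in> NP \<Longrightarrow> pcat w (r w) \<in> RM" "\<And>w. w \<in> NP \<Longrightarrow> pend w = fst (r w)"
    by metis
  let ?m = "emb (\<lambda>w. \<phi> (pcat w (r w)) (r w))"
  have "e ?m p q = \<phi> p q" for p q
  proof (cases "p \<in> RM \<and> q \<in> NP \<and> pend q = pend p")
    case False
    hence "\<phi> p q = 0" using E_outside[OF \<phi>] by (simp add: Lab_simps(1))
    thus ?thesis using False by (auto simp: e_def)
  next
    case True
    hence p: "p \<in> RM" and q: "q \<in> NP" "pend q = pend p" by auto
    from p q show ?thesis
    proof (cases rule: RM_suffix)
      case (1 w)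
      have pw: "pcat w (r w) \<in> RM" "pend w = fst (r w)" using r[OF 1(3)] by auto
      have "e ?m p q = \<phi> (pcat w (r w)) (r w)"
        using e_eval[OF emb_closed, of w q] 1 p by (simp add: cf_emb)
      also have "\<dots> = \<phi> p q"
      proof (cases "pcat w (r w) = p")
        case True
        hence "r w = q" using 1 pw by (auto simp: pcat_def prod_eq_iff)
        thus ?thesis using True by simp
      next
        case ne: False
        \<comment> \<open>A nontrivial path has a single right-maximal prolongation, so a different
          choice forces \<open>w\<close> to be trivial.\<close>
        have w: "snd w = []"
        proof (rule ccontr)
          assume "snd w \<noteq> []"
          thus False using RM_unique[OF pw(1) p] ne 1(1) by simp
        qed
        let ?u = "fst w"
        have wu: "w = (?u, [])" "?u \<in> verts Q" using w 1(3) NP_fst by (auto simp: prod_eq_iff)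
        have pr: "pcat w (r w) = r w" "pcat w q = q"
          using pw(2) 1(2) w by (auto simp: pcat_def prod_eq_iff pend_empty)
        have o: "out_degree Q ?u = 2" using RM_unique'[OF pw(1) p] ne 1(1) by auto
        obtain p' where *: "\<And>f. (\<Sum>p\<in>{p \<in> RM. fst p = ?u}. sg p * f p) = f (first ?u) - (f p' :: 'k)"
          "\<And>x. x \<in> RM \<Longrightarrow> fst x = ?u \<Longrightarrow> x = first ?u \<or> x = p'"
          by (rule RM_out_2_sum[OF o wu(2)]) (rule that; assumption)
        \<comment> \<open>At the trivial path the kernel condition equates the values of the two
          right-maximal paths.\<close>
        have "d 0 \<phi> (?u, []) (?u, []) = (\<Sum>p\<in>{p \<in> RM. fst p = ?u}. sg p * \<phi> p p)"
          by (subst d_0_vertex[OF \<phi> wu(2) o])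
             (use wu(2) in \<open>auto intro!: sum.cong simp: pcat_def prod_eq_iff\<close>)
        hence "\<phi> (first ?u) (first ?u) = \<phi> p' p'" using z *(1)[of "\<lambda>p. \<phi> p p"] by simp
        moreover have "r w \<in> RM" "fst (r w) = ?u" "p = q" "fst p = ?u"
          using pw pr 1 w by (auto simp: pend_empty)
        ultimately show ?thesis using *(2)[of "r w"] *(2)[OF p] pr(1) by auto
      qed
      finally show ?thesis .
    next
      case (2 w)
      have "e ?m p q = 0" by (rule e_eval_0) (use 2 in auto)
      moreover have "\<phi> p q = 0"
      proof (cases "out_degree Q (fst p) = 2")
        case True
        have u: "fst p \<in> verts Q" using NP_fst[OF RM_NP[OF p]] .
        obtain p' where *: "\<And>f. (\<Sum>p\<in>{x \<in> RM. fst x = fst p}. sg p * f p) = f (first (fst p)) - (f p' :: 'k)"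
          "\<And>x. x \<in> RM \<Longrightarrow> fst x = fst p \<Longrightarrow> x = first (fst p) \<or> x = p'"
          "\<And>q. q \<in> NP \<Longrightarrow> pend q = fst p \<Longrightarrow> snd q \<noteq> [] \<Longrightarrow> pcat q p' \<in> NP \<longleftrightarrow> pcat q (first (fst p)) \<notin> NP"
          by (rule RM_out_2_sum[OF True u]) (rule that; assumption)
        have eq: "\<phi> (first (fst p)) (pcat w (first (fst p))) = \<phi> p' (pcat w p')"
          using d_0_vertex[OF \<phi> u True 2(3,2)] z *(1)[of "\<lambda>p. \<phi> p (pcat w p)"] by simp
        \<comment> \<open>The path \<open>w\<close> continues along only one of the two maximal
          paths, so one of the two equal values sits at a vanishing path.\<close>
        have "\<phi> (first (fst p)) (pcat w (first (fst p))) = 0 \<or> \<phi> p' (pcat w p') = 0"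
          using *(3)[OF 2(3,2,4)] E_outside[OF \<phi>] by blast
        thus ?thesis using eq *(2)[OF p refl] 2(1) by auto
      next
        case False
        let ?d = "last (snd w)" and ?w = "(fst w, butlast (snd w))"
        have wNP: "(fst w, butlast (snd w) @ [?d]) \<in> NP" using 2(3,4) by simp
        have d: "?d \<in> arcs Q" "head Q ?d = fst p" "?w \<in> NP" "pend ?w = tail Q ?d"
          using wNP NP_append[of "fst w" "butlast (snd w)" "[?d]"] 2(2,4) by (auto simp: pend_nonempty)
        \<comment> \<open>A relation beginning with \<open>?d\<close> would involve the only arrow
          leaving this vertex. That is the first arrow of \<open>p\<close>, but \<open>w p\<close>
          is nonzero.\<close>
        have "\<not> rel ?d c" for c
        proof
          assume rel: "rel ?d c"
          have c: "c \<in> arcs Q" "tail Q c = fst p" using relD[OF rel] d by auto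
          show False
          proof (cases "snd p = []")
            case True
            thus ?thesis using RM_rel[OF p c(1)] c by (simp add: pend_empty)
          next
            case ne: False
            have "hd (snd p) \<in> arcs Q" "tail Q (hd (snd p)) = fst p"
              using NP_arcs[OF RM_NP[OF p]] NP_tail[OF RM_NP[OF p] ne] ne by auto
            hence "hd (snd p) = c" using out_degree_2I[of "hd (snd p)" c "fst p"] c False by blast
            thus ?thesis using rel q(1) NP_pcat[OF 2(2)] 2(1,4) ne by simp
          qed
        qed
        hence d0: "?d \<in> D 0" using d(1) by simp
        have "first (head Q ?d) = p"
          using RM_unique'[OF D_0_first(1)[OF d0] p] D_0_first(2)[OF d0] d(2) False by simp
        moreover have "pcat ?w (arr ?d) = w" using 2(4) by (simp add: pcat_def prod_eq_iff)
        ultimately have "d 0 \<phi> (arr ?d) ?w = \<phi> p q"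
          using d_0_arr[OF \<phi> d0 d(3,4)] 2(1) by simp
        thus ?thesis using z by simp
      qed
      ultimately show ?thesis by simp
    qed
  qed
  hence "\<phi> = e ?m" by (intro ext) simp
  thus ?thesis by (rule image_eqI) simp
qed

text \<open>If \<open>q f\<close> vanishes, the last arrow of \<open>q\<close> precedes
  \<open>f\<close> in its chain, and the next differential reads exactly this value.\<close>

lemma kernel_d_Suc:
  assumes \<psi>: "\<psi> \<in> carrier (E (Suc n))" and z: "d (Suc n) \<psi> = (\<lambda>_ _. 0)"
    and f: "f \<in> D n" and q: "q \<in> NP" "pend q = tail Q f" "pcat q (arr f) \<notin> NP"
  shows "\<psi> (arr f) q = 0"
proof -
  have ne: "snd q \<noteq> []" and rel: "rel (last (snd q)) f"
    using q D_arcs[OF f] by (auto simp: NP_pcat)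
  let ?g = "last (snd q)" and ?q = "(fst q, butlast (snd q))"
  have g: "?g \<in> D (Suc n)" "succ ?g = f" using rel f D_Suc succ_eq by auto
  have "(fst q, butlast (snd q) @ [?g]) \<in> NP" using q(1) ne by simp
  hence "?q \<in> NP" "pend ?q = tail Q ?g" using NP_append[of "fst q" "butlast (snd q)" "[?g]"] by auto
  moreover have "pcat ?q (arr ?g) = q" using ne by (simp add: pcat_def prod_eq_iff)
  ultimately show ?thesis using d_Suc[OF \<psi> g(1), of ?q] z g(2) by simp
qed

text \<open>The composite would evaluate \<open>\<phi>\<close> at a path containing the relation
  formed by \<open>g\<close> and \<open>succ g\<close>.\<close>

lemma d_d:
  assumes \<phi>: "\<phi> \<in> carrier (E n)"
  shows "d (Suc n) (d n \<phi>) = (\<lambda>_ _. 0)"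
proof (intro ext)
  fix l q
  have d\<phi>: "d n \<phi> \<in> carrier (E (Suc n))" using rmod_homD(1)[OF d_hom \<phi>] .
  show "d (Suc n) (d n \<phi>) l q = 0"
  proof (cases "l \<in> Lab (Suc (Suc n)) \<and> q \<in> NP \<and> pend q = fst l")
    case False
    thus ?thesis using d_outside by blast
  next
    case True
    then obtain g where g: "g \<in> D (Suc n)" "l = arr g" by (auto simp: Lab_simps)
    have q: "q \<in> NP" "pend q = tail Q g" using True g by auto
    have f: "rel g (succ g)" "succ g \<in> D n" using D_succ[OF g(1)] by auto
    have eq: "d (Suc n) (d n \<phi>) l q = d n \<phi> (arr (succ g)) (pcat q (arr g))"
      unfolding g(2) by (rule d_Suc[OF d\<phi> g(1) q])
    have pe: "pend (pcat q (arr g)) = head Q g" "head Q g = tail Q (succ g)"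
      using q relD(3)[OF f(1)] by (simp_all add: pend_pcat)
    have no: "pcat (pcat q (arr g)) (arr (succ g)) \<notin> NP"
      using f(1) pe by (subst NP_pcat) auto
    show ?thesis
    proof (cases "pcat q (arr g) \<in> NP")
      case NP: True
      show ?thesis
      proof (cases n)
        case 0
        have f0: "succ g \<in> D 0" and \<phi>0: "\<phi> \<in> carrier (E 0)" using f \<phi> 0 by auto
        have "d 0 \<phi> (arr (succ g)) (pcat q (arr g)) =
            \<phi> (first (head Q (succ g))) (pcat (pcat (pcat q (arr g)) (arr (succ g))) (first (head Q (succ g))))"
          by (rule d_0_arr[OF \<phi>0 f0 NP]) (use pe in simp)
        moreover have "pcat (pcat (pcat q (arr g)) (arr (succ g))) (first (head Q (succ g))) \<notin> NP"
          using no D_0_first(2)[OF f0] pe by (subst NP_pcat) (auto simp: pend_pcat)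
        ultimately show ?thesis using eq 0 E_outside[OF \<phi>0] by simp
      next
        case (Suc k)
        have fk: "succ g \<in> D (Suc k)" and \<phi>k: "\<phi> \<in> carrier (E (Suc k))" using f \<phi> Suc by auto
        have "d (Suc k) \<phi> (arr (succ g)) (pcat q (arr g)) = \<phi> (arr (succ (succ g))) (pcat (pcat q (arr g)) (arr (succ g)))"
          by (rule d_Suc[OF \<phi>k fk NP]) (use pe in simp)
        thus ?thesis using eq Suc no E_outside[OF \<phi>k] by simp
      qed
    qed (use eq d_outside in auto)
  qed
qed

text \<open>The map \<open>d 0\<close> reads an element only at paths \<open>w p\<close> labelled by
  a right-maximal \<open>p\<close>, so a preimage has to be prescribed only there.\<close>

lemma kernel_d_1:
  assumes \<psi>: "\<psi> \<in> carrier (E (Suc 0))" and z: "d (Suc 0) \<psi> = (\<lambda>_ _. 0)"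
  shows "\<psi> \<in> d 0 ` carrier (E 0)"
proof -
  \<comment> \<open>At a vertex with two outgoing arrows and for nontrivial \<open>w\<close>,
    exactly one of the two products is nonzero, and the sign turns its contribution into
    \<open>\<psi>\<close>. For trivial \<open>w\<close> both products count, so the value is given
    to \<open>first\<close> alone. At the other vertices the last arrow of \<open>w\<close> is the
    label that reads this value.\<close>
  define h where "h p w = (if out_degree Q (fst p) = 2
      then if snd w = [] \<and> p \<noteq> first (fst p) then 0 else sg p * \<psi> (fst p, []) w
      else if snd w \<noteq> [] then \<psi> (arr (last (snd w))) (fst w, butlast (snd w)) else 0)" for p w
  define \<phi> where "\<phi> p q = (if p \<in> RM \<and> q \<in> NP \<and> (\<exists>w. q = pcat w p \<and> pend w = fst p)
      then h p (THE w. q = pcat w p) else 0)" for p q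
  have \<phi>c: "\<phi> \<in> carrier (E 0)"
    by (auto simp: E_carrier \<phi>_def Lab_simps(1) pend_pcat split: if_splits)
  have ev: "\<phi> p (pcat w p) = (if pcat w p \<in> NP then h p w else 0)" if "p \<in> RM" "pend w = fst p" for p w
    using that by (auto simp: \<phi>_def)
  have "d 0 \<phi> l q = \<psi> l q" for l q
  proof (cases "l \<in> Lab (Suc 0) \<and> q \<in> NP \<and> pend q = fst l")
    case False
    hence "\<psi> l q = 0" using E_outside[OF \<psi>] by simp
    thus ?thesis using False d_outside by simp
  next
    case True
    hence q: "q \<in> NP" "pend q = fst l" and l: "l \<in> Lab (Suc 0)" by auto
    from l show ?thesis
    proof (cases rule: Lab_cases)
      case (1 u)
      have u: "pend q = u" using q 1 by simp
      obtain p' where *: "p' \<in> RM" "fst p' = u" "p' \<noteq> first u" "sg p' = -1" "sg (first u) = 1"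
        "\<And>f. (\<Sum>p\<in>{p \<in> RM. fst p = u}. sg p * f p) = f (first u) - (f p' :: 'k)"
        "\<And>q. q \<in> NP \<Longrightarrow> pend q = u \<Longrightarrow> snd q \<noteq> [] \<Longrightarrow> pcat q p' \<in> NP \<longleftrightarrow> pcat q (first u) \<notin> NP"
        by (rule RM_out_2_sum[OF 1(4,3)]) (rule that; assumption)
      have f: "first u \<in> RM" "fst (first u) = u" using first[OF 1(3)] by auto
      have "d 0 \<phi> l q = \<phi> (first u) (pcat q (first u)) - \<phi> p' (pcat q p')"
        unfolding 1(2) d_0_vertex[OF \<phi>c 1(3,4) q(1) u] using *(6) .
      also have "\<dots> = \<psi> (u, []) q"
      proof (cases "snd q = []")
        case True
        hence "pcat q (first u) = first u" "pcat q p' = p'"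
          using u f *(2) by (auto simp: pcat_def prod_eq_iff pend_empty)
        moreover have "first u \<in> NP" "p' \<in> NP" using f *(1) RM_NP by auto
        ultimately show ?thesis
          using ev[OF f(1), of q] ev[OF *(1), of q] u f *(2,3,5) 1(4) True by (simp add: h_def)
      next
        case False
        thus ?thesis
          using ev[OF f(1), of q] ev[OF *(1), of q] u f *(2,3,4,5) *(7)[OF q(1) u False] 1(4)
          by (auto simp: h_def)
      qed
      finally show ?thesis using 1(2) by simp
    next
      case (2 f)
      have qf: "pend q = tail Q f" using q 2 by simp
      let ?p = "first (head Q f)"
      note p = D_0_first[OF 2(1)]
      have pq: "pend (pcat q (arr f)) = fst ?p" using p(2) qf by (simp add: pend_pcat)
      have "d 0 \<phi> l q = \<phi> ?p (pcat (pcat q (arr f)) ?p)"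
        unfolding 2(2) by (rule d_0_arr[OF \<phi>c 2(1) q(1) qf])
      also have "\<dots> = (if pcat (pcat q (arr f)) ?p \<in> NP then h ?p (pcat q (arr f)) else 0)"
        by (rule ev[OF p(1) pq])
      also have "h ?p (pcat q (arr f)) = \<psi> (arr f) q"
        using D_0_out[OF 2(1)] p(2) by (simp add: h_def)
      also have "(if pcat (pcat q (arr f)) ?p \<in> NP then \<psi> (arr f) q else 0) = \<psi> (arr f) q"
      proof (cases "pcat q (arr f) \<in> NP")
        case True
        hence "pcat (pcat q (arr f)) ?p \<in> NP" using p(3) pq p(2) by (simp add: NP_pcat)
        thus ?thesis by simp
      next
        case False
        thus ?thesis using kernel_d_Suc[OF \<psi> z 2(1) q(1) qf] by simp
      qed
      finally show ?thesis using 2(2) by simp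
    qed
  qed
  hence "d 0 \<phi> = \<psi>" by (intro ext)
  thus ?thesis using \<phi>c by blast
qed

text \<open>Each value of \<open>\<psi>\<close> is read at a path with one more arrow, so the
  preimage strips that arrow. Where the longer path vanishes, the kernel condition makes
  \<open>\<psi>\<close> zero as well.\<close>

lemma kernel_d_Suc_Suc:
  assumes \<psi>: "\<psi> \<in> carrier (E (Suc (Suc n)))" and z: "d (Suc (Suc n)) \<psi> = (\<lambda>_ _. 0)"
  shows "\<psi> \<in> d (Suc n) ` carrier (E (Suc n))"
proof -
  define \<phi> where "\<phi> l w = (if w \<in> NP \<and> snd w \<noteq> [] \<and> last (snd w) \<in> D (Suc n) \<and> l = arr (succ (last (snd w)))
      then \<psi> (arr (last (snd w))) (fst w, butlast (snd w)) else 0)" for l w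
  have \<phi>c: "\<phi> \<in> carrier (E (Suc n))"
    using D_succ relD(3) arr_Lab
    by (auto simp: E_carrier \<phi>_def pend_nonempty split: if_splits)
  have "d (Suc n) \<phi> l q = \<psi> l q" for l q
  proof (cases "l \<in> Lab (Suc (Suc n)) \<and> q \<in> NP \<and> pend q = fst l")
    case False
    hence "\<psi> l q = 0" using E_outside[OF \<psi>] by simp
    thus ?thesis using False d_outside by simp
  next
    case True
    then obtain f where f: "f \<in> D (Suc n)" "l = arr f" by (auto simp: Lab_simps)
    have q: "q \<in> NP" "pend q = tail Q f" using True f by auto
    have "d (Suc n) \<phi> l q = \<phi> (arr (succ f)) (pcat q (arr f))"
      unfolding f(2) by (rule d_Suc[OF \<phi>c f(1) q])
    also have "\<dots> = (if pcat q (arr f) \<in> NP then \<psi> (arr f) q else 0)"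
      using f(1) by (simp add: \<phi>_def)
    also have "\<dots> = \<psi> (arr f) q"
      using kernel_d_Suc[OF \<psi> z f(1) q] by simp
    finally show ?thesis using f(2) by simp
  qed
  hence "d (Suc n) \<phi> = \<psi>" by (intro ext)
  thus ?thesis using \<phi>c by blast
qed

lemma exact_e: "e ` carrier A = {x \<in> carrier (E 0). d 0 x = \<zero>\<^bsub>E 1\<^esub>}"
  using d_0_e kernel_d_0 rmod_homD(1)[OF e_hom] by (auto simp: E_zero regular_simps)

lemma exact_d: "d n ` carrier (E n) = {x \<in> carrier (E (Suc n)). d (Suc n) x = \<zero>\<^bsub>E (Suc (Suc n))\<^esub>}"
proof (intro equalityI subsetI)
  fix x assume x: "x \<in> {x \<in> carrier (E (Suc n)). d (Suc n) x = \<zero>\<^bsub>E (Suc (Suc n))\<^esub>}"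
  show "x \<in> d n ` carrier (E n)"
    using x kernel_d_1 kernel_d_Suc_Suc by (cases n) (auto simp: E_zero)
qed (use d_d rmod_homD(1)[OF d_hom] in \<open>auto simp: E_zero\<close>)

text \<open>The differentials read values at nontrivial paths only; at a vertex label this holds
  because right-maximal paths from a vertex with outgoing arrows are nontrivial. By exactness the
  socle of each term lies in the preceding image, which is minimality.\<close>

lemma socle_kernel:
  assumes \<phi>: "\<phi> \<in> carrier (E n)" and soc: "\<And>l q. \<phi> l q \<noteq> 0 \<Longrightarrow> snd q = []"
  shows "d n \<phi> = (\<lambda>_ _. 0)"
proof (intro ext)
  fix l q
  have nz: "\<phi> l' w = 0" if "snd w \<noteq> []" for l' w using soc that by blast
  show "d n \<phi> l q = 0"
  proof (cases "l \<in> Lab (Suc n) \<and> q \<in> NP \<and> pend q = fst l")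
    case False
    thus ?thesis using d_outside by blast
  next
    case True
    hence q: "q \<in> NP" "pend q = fst l" and "l \<in> Lab (Suc n)" by auto
    from this(3) show ?thesis
    proof (cases rule: Lab_cases)
      case (1 u)
      obtain p' where "snd p' \<noteq> []" "snd (first u) \<noteq> []"
        "\<And>x. x \<in> RM \<Longrightarrow> fst x = u \<Longrightarrow> x = first u \<or> x = p'"
        by (rule RM_out_2_sum[OF 1(4,3)]) (rule that; assumption)
      hence "snd p \<noteq> []" if "p \<in> RM" "fst p = u" for p using that by metis
      thus ?thesis using d_0_vertex[of \<phi> u q] 1 \<phi> q nz by (auto intro!: sum.neutral)
    next
      case (2 f)
      show ?thesis
      proof (cases n)
        case 0
        thus ?thesis using d_0_arr[of \<phi> f q] 2 \<phi> q nz by simp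
      next
        case (Suc k)
        thus ?thesis using d_Suc[of \<phi> k f q] 2 \<phi> q nz by simp
      qed
    qed
  qed
qed

lemma essential_e: "essential_in A (e ` carrier A) (E 0)"
proof -
  have "rsubmodule A (e ` carrier A) (E 0)"
    using A.rsubmodule_image[OF right_module_regular right_module_E e_hom] by (simp add: regular_simps)
  thus ?thesis unfolding E_def
    by (rule essential_in_C) (use socle_kernel[of _ 0] in \<open>auto simp: exact_e E_def C_simps(2)\<close>)
qed

lemma essential_d: "essential_in A (d n ` carrier (E n)) (E (Suc n))"
proof -
  have "rsubmodule A (d n ` carrier (E n)) (E (Suc n))"
    by (rule A.rsubmodule_image[OF right_module_E right_module_E d_hom])
  thus ?thesis unfolding E_def[of "Suc n"]
    by (rule essential_in_C) (use socle_kernel[of _ "Suc n"] in \<open>auto simp: exact_d E_def[of "Suc _"] C_simps(2)\<close>)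
qed

lemma E_eventually_zero: "\<exists>N. \<forall>n>N. carrier (E n) = {\<zero>\<^bsub>E n\<^esub>}"
proof -
  obtain N where N: "\<And>k. k \<ge> N \<Longrightarrow> D k = {}" using D_eventually_empty by blast
  have "carrier (E n) = {\<zero>\<^bsub>E n\<^esub>}" if "n > Suc N" for n
  proof -
    \<comment> \<open>Vertex labels occur in degree 1 only, and layers are shifted by one against
      degrees: degree \<open>k + 2\<close> carries the layer \<open>D (Suc k)\<close>.\<close>
    define k where "k = n - 2"
    have n: "n = Suc (Suc k)" "Suc k \<ge> N" using that by (auto simp: k_def)
    have "Lab n = {}" using N[OF n(2)] by (simp add: n Lab_simps)
    thus ?thesis by (auto simp: E_def C_simps fun_eq_iff)
  qed
  thus ?thesis by blast
qed

end

section \<open>Projective dimensions\<close>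

lemma sum_single:
  assumes "finite S" "x \<in> S" "\<And>y. y \<in> S \<Longrightarrow> y \<noteq> x \<Longrightarrow> f y = 0"
  shows "(\<Sum>y\<in>S. f y) = (f x :: 'a :: comm_monoid_add)"
  using assms by (subst sum.remove[of S x]) (auto intro: sum.neutral)

context gentle_algebra
begin

section \<open>Right ideals generated by a path and their projective resolutions\<close>

definition pre :: "'v \<times> 'a list \<Rightarrow> ('v \<times> 'a list) set" where
  "pre z = {w \<in> NP. \<exists>q. w = pcat z q \<and> pend z = fst q}"

lemma right_closed_pre: "right_closed (pre z)"
  unfolding right_closed_def
proof (intro conjI ballI allI impI)
  fix w r assume w: "w \<in> pre z" and r: "pend w = fst r \<and> pcat w r \<in> NP"
  obtain q where q: "w = pcat z q" "pend z = fst q" using w by (auto simp: pre_def)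
  hence "pcat w r = pcat z (pcat q r)" by (simp add: pcat_assoc)
  thus "pcat w r \<in> pre z" using q r by (auto simp: pre_def intro!: exI[of _ "pcat q r"])
qed (auto simp: pre_def)

lemma pre_trivial: "pre (v, []) = start v"
proof (intro equalityI subsetI)
  fix w assume "w \<in> start v"
  thus "w \<in> pre (v, [])" by (auto simp: start_def pre_def intro!: exI[of _ w])
qed (auto simp: start_def pre_def)

lemma pre_arrI:
  assumes "q \<in> NP" "snd q \<noteq> []"
  shows "q \<in> pre (arr (hd (snd q)))"
proof -
  have "snd q = snd (arr (hd (snd q))) @ tl (snd q)" using assms(2) by simp
  from prefix_pcat[OF assms(1) this] NP_tail[OF assms] assms(1) show ?thesis
    by (auto simp: pre_def intro!: exI[of _ "(head Q (hd (snd q)), tl (snd q))"])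
qed

lemma be_nonzero: "q \<in> NP \<Longrightarrow> be q \<noteq> \<zero>\<^bsub>A\<^esub>"
  using cf_be[of q q] cf_zero[of q] by auto

text \<open>The right ideal generated by \<open>z\<close> is covered by the projective at the end of
  \<open>z\<close>, and the kernel is generated by the one arrow forming a relation with the last
  arrow of \<open>z\<close>, if there is one. Iterating moves along the chain, which stops after at
  most \<open>k\<close> steps. The kernel is indexed by a subset of the same labels, so the label
  type stays fixed in the induction.\<close>

lemma pd_le_F_pre:
  fixes L :: "'l set"
  assumes "finite L" "\<And>l. l \<in> L \<Longrightarrow> z l \<in> NP"
    "\<And>l. l \<in> L \<Longrightarrow> snd (z l) = [] \<or> (\<exists>j\<le>k. last (snd (z l)) \<in> D j)"
  shows "A.pd_le k (F L (\<lambda>l. pre (z l)))"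
  using assms
proof (induction k arbitrary: L z)
  \<comment> \<open>The covering map is left multiplication by \<open>z l\<close>; the base case and
    the induction step both use it.\<close>
  have cover: "\<exists>f L'. f \<in> rmod_hom A (F L (\<lambda>l. start (pend (z l)))) (F L (\<lambda>l. pre (z l))) \<and>
      f ` carrier (F L (\<lambda>l. start (pend (z l)))) = carrier (F L (\<lambda>l. pre (z l))) \<and>
      L' = {l \<in> L. snd (z l) \<noteq> [] \<and> (\<exists>c. rel (last (snd (z l))) c)} \<and>
      carrier (F L' (\<lambda>l. pre (arr (succ (last (snd (z l))))))) =
        {\<phi> \<in> carrier (F L (\<lambda>l. start (pend (z l)))). f \<phi> = \<zero>\<^bsub>F L (\<lambda>l. pre (z l))\<^esub>}"
    if z: "\<And>l. l \<in> L \<Longrightarrow> z l \<in> NP" for L :: "'l set" and z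
  proof -
    let ?P = "F L (\<lambda>l. start (pend (z l)))" and ?M = "F L (\<lambda>l. pre (z l))"
    let ?L = "{l \<in> L. snd (z l) \<noteq> [] \<and> (\<exists>c. rel (last (snd (z l))) c)}"
    let ?K = "F ?L (\<lambda>l. pre (arr (succ (last (snd (z l))))))"
    let ?f = "\<lambda>\<phi> l w. if l \<in> L then cf (be (z l) \<otimes>\<^bsub>A\<^esub> emb (\<phi> l)) w else 0"
    have supp: "w \<in> pre (z l)" if nz: "cf (be (z l) \<otimes>\<^bsub>A\<^esub> emb (\<phi> l)) w \<noteq> 0" for \<phi> l w
    proof -
      obtain w' where "w = pcat (z l) w'" "pend (z l) = fst w'"
        by (rule cf_mult_be_left_nonzero[OF emb_closed nz])
      moreover have "w \<in> NP" using nz cf_outside by blast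
      ultimately show ?thesis by (auto simp: pre_def)
    qed
    have hom: "?f \<in> rmod_hom A ?P ?M" by (rule hom_F_F[where \<sigma> = "\<lambda>l. l"]) (auto intro: supp)
    have ev: "?f \<phi> l (pcat (z l) q) = \<phi> l q"
      if "l \<in> L" "pend (z l) = fst q" "pcat (z l) q \<in> NP" for \<phi> l q
      using that NP_pcat[OF that(2)] by (simp add: cf_mult_be_left cf_emb)
    have ev0: "?f \<phi> l w = 0" if "l \<notin> L \<or> w \<notin> pre (z l)" for \<phi> l w
      using that supp[of l \<phi> w] by auto
    have "\<psi> \<in> ?f ` carrier ?P" if \<psi>: "\<psi> \<in> carrier ?M" for \<psi>
    proof -
      let ?\<phi> = "\<lambda>l q. if q \<in> NP \<and> fst q = pend (z l) then \<psi> l (pcat (z l) q) else 0"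
      have \<psi>D: "l \<in> L \<and> w \<in> pre (z l)" if "\<psi> l w \<noteq> 0" for l w
        using \<psi> that unfolding F_simps by blast
      have \<phi>c: "?\<phi> \<in> carrier ?P" unfolding F_simps start_def using \<psi>D by simp
      have "?f ?\<phi> = \<psi>"
      proof (intro ext)
        fix l w
        show "?f ?\<phi> l w = \<psi> l w"
        proof (cases "l \<in> L \<and> w \<in> pre (z l)")
          case True
          then obtain q where q: "w = pcat (z l) q" "pend (z l) = fst q" "w \<in> NP" by (auto simp: pre_def)
          have "q \<in> NP" using q NP_pcat[OF q(2)] by blast
          thus ?thesis using ev[of l q ?\<phi>] True q by simp
        next
          case False
          hence "\<psi> l w = 0" using \<psi>D by blast
          thus ?thesis using ev0[of l w ?\<phi>] False by simp
        qed
      qed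
      from this[symmetric] show ?thesis using \<phi>c by (rule image_eqI)
    qed
    hence surj: "?f ` carrier ?P = carrier ?M" using rmod_homD(1)[OF hom] by blast
    have ker: "carrier ?K = {\<phi> \<in> carrier ?P. ?f \<phi> = \<zero>\<^bsub>?M\<^esub>}"
    proof (intro equalityI subsetI)
      fix \<phi> assume \<phi>: "\<phi> \<in> carrier ?K"
      have *: "l \<in> L \<and> q \<in> NP \<and> fst q = pend (z l) \<and> pcat (z l) q \<notin> NP" if nz: "\<phi> l q \<noteq> 0" for l q
      proof -
        have l: "l \<in> L" "snd (z l) \<noteq> []" and "\<exists>c. rel (last (snd (z l))) c"
          and q: "q \<in> pre (arr (succ (last (snd (z l)))))"
          using \<phi> nz by (auto simp: F_simps)
        then obtain c where c: "rel (last (snd (z l))) c" "succ (last (snd (z l))) = c" using succ_eq by blast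
        obtain q' where q': "q = pcat (arr c) q'" "q \<in> NP" using q c by (auto simp: pre_def)
        have p: "pend (z l) = fst q" using q' l relD(3)[OF c(1)] by (simp add: pend_nonempty)
        hence "pcat (z l) q \<notin> NP" using NP_pcat[OF p] q' c l by auto
        thus ?thesis using l q' p by auto
      qed
      have "?f \<phi> l w = 0" for l w
      proof (cases "l \<in> L \<and> w \<in> pre (z l)")
        case True
        then obtain q where q: "w = pcat (z l) q" "pend (z l) = fst q" "w \<in> NP" by (auto simp: pre_def)
        thus ?thesis using ev[of l q \<phi>] True *[of l q] by auto
      qed (use ev0[of l w \<phi>] in simp)
      thus "\<phi> \<in> {\<phi> \<in> carrier ?P. ?f \<phi> = \<zero>\<^bsub>?M\<^esub>}"
        using * by (auto simp: F_simps start_def fun_eq_iff)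
    next
      fix \<phi> assume "\<phi> \<in> {\<phi> \<in> carrier ?P. ?f \<phi> = \<zero>\<^bsub>?M\<^esub>}"
      hence \<phi>: "\<phi> \<in> carrier ?P" and fz: "?f \<phi> = (\<lambda>_ _. 0)" by (auto simp: F_simps(2))
      have f0: "?f \<phi> l w = 0" for l w by (rule fun_cong[OF fun_cong[OF fz]])
      have "l \<in> ?L \<and> q \<in> pre (arr (succ (last (snd (z l)))))" if nz: "\<phi> l q \<noteq> 0" for l q
      proof -
        have l: "l \<in> L" "q \<in> NP" "fst q = pend (z l)"
          using \<phi> nz unfolding F_simps start_def by blast+
        have "pcat (z l) q \<notin> NP"
        proof
          assume "pcat (z l) q \<in> NP"
          from trans[OF f0[symmetric] ev[OF l(1) l(3)[symmetric] this, of \<phi>]] nz show False by simp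
        qed
        \<comment> \<open>Both factors are nonzero paths, so their product can vanish only through a
          relation at the junction.\<close>
        hence r: "snd (z l) \<noteq> []" "snd q \<noteq> []" "rel (last (snd (z l))) (hd (snd q))"
          using NP_pcat[OF l(3)[symmetric]] z[OF l(1)] l(2) by auto
        thus ?thesis using pre_arrI[OF l(2) r(2)] succ_eq[OF r(3)] l(1) by auto
      qed
      thus "\<phi> \<in> carrier ?K" unfolding F_simps by blast
    qed
    show ?thesis by (intro exI[of _ ?f] exI[of _ ?L] conjI hom surj ker refl)
  qed
  have step: "A.pd_le (Suc k) (F L (\<lambda>l. pre (z l)))"
    if L: "finite L" and z: "\<And>l. l \<in> L \<Longrightarrow> z l \<in> NP"
      and K: "A.pd_le k (F {l \<in> L. snd (z l) \<noteq> [] \<and> (\<exists>c. rel (last (snd (z l))) c)}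
        (\<lambda>l. pre (arr (succ (last (snd (z l)))))))"
    for L :: "'l set" and z k
  proof -
    let ?P = "F L (\<lambda>l. start (pend (z l)))" and ?M = "F L (\<lambda>l. pre (z l))"
    obtain f L' where f: "f \<in> rmod_hom A ?P ?M" "f ` carrier ?P = carrier ?M"
      and L': "L' = {l \<in> L. snd (z l) \<noteq> [] \<and> (\<exists>c. rel (last (snd (z l))) c)}"
      and ker: "carrier (F L' (\<lambda>l. pre (arr (succ (last (snd (z l))))))) = {\<phi> \<in> carrier ?P. f \<phi> = \<zero>\<^bsub>?M\<^esub>}"
      using cover[of L z, OF z] by blast
    let ?K = "F L' (\<lambda>l. pre (arr (succ (last (snd (z l))))))"
    have P: "projective_module A ?P" using L z NP_pend by (intro projective_F) auto
    have M: "fd_module A ?M" by (rule fd_module_F[OF L right_closed_pre])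
    have \<iota>: "(\<lambda>x. x) \<in> rmod_hom A ?K ?P"
      by (rule rmod_homI) (use ker in \<open>auto simp: F_simps(3,4)\<close>)
    show ?thesis
      by (rule A.pd_le_step[OF P M f \<iota>]) (use ker K L' in auto)
  qed
  {
    case 0
    let ?P = "F L (\<lambda>l. start (pend (z l)))" and ?M = "F L (\<lambda>l. pre (z l))"
    obtain f L' where f: "f \<in> rmod_hom A ?P ?M" "f ` carrier ?P = carrier ?M"
      and L': "L' = {l \<in> L. snd (z l) \<noteq> [] \<and> (\<exists>c. rel (last (snd (z l))) c)}"
      and ker: "carrier (F L' (\<lambda>l. pre (arr (succ (last (snd (z l))))))) = {\<phi> \<in> carrier ?P. f \<phi> = \<zero>\<^bsub>?M\<^esub>}"
      using cover[of L z, OF "0.prems"(2)] by blast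
    have P: "projective_module A ?P" using 0 NP_pend by (intro projective_F) auto
    have M: "right_module A ?M" by (rule right_module_F[OF right_closed_pre])
    have Pr: "right_module A ?P" by (rule right_module_F[OF right_closed_start])
    have "L' = {}" using "0.prems"(3) unfolding L' by auto
    hence "x = \<zero>\<^bsub>?P\<^esub>" if "x \<in> carrier ?P" "f x = \<zero>\<^bsub>?M\<^esub>" for x
    proof -
      have "x \<in> carrier (F L' (\<lambda>l. pre (arr (succ (last (snd (z l)))))))" using ker that by blast
      thus ?thesis using \<open>L' = {}\<close> by (auto simp: F_simps fun_eq_iff)
    qed
    hence "inj_on f (carrier ?P)" by (rule rmod_hom_inj[OF f(1) Pr M])
    thus ?case using A.pd_le_0[OF P M f(1)] f(2) by (simp add: bij_betw_def)
  next
    case (Suc k)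
    show ?case
    proof (rule step[OF Suc.prems(1,2)])
      show "A.pd_le k (F {l \<in> L. snd (z l) \<noteq> [] \<and> (\<exists>c. rel (last (snd (z l))) c)}
          (\<lambda>l. pre (arr (succ (last (snd (z l)))))))"
      proof (rule Suc.IH)
        fix l assume "l \<in> {l \<in> L. snd (z l) \<noteq> [] \<and> (\<exists>c. rel (last (snd (z l))) c)}"
        then obtain c where l: "l \<in> L" "snd (z l) \<noteq> []" and c: "rel (last (snd (z l))) c" by blast
        show "arr (succ (last (snd (z l)))) \<in> NP" using relD(2)[OF c] succ_eq[OF c] by simp
        obtain j where j: "j \<le> Suc k" "last (snd (z l)) \<in> D j" using Suc.prems(3)[OF l(1)] l(2) by blast
        then obtain j' where "j = Suc j'" "c \<in> D j'" using c D_Suc[OF c] by (cases j) auto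
        thus "snd (arr (succ (last (snd (z l))))) = [] \<or> (\<exists>j\<le>k. last (snd (arr (succ (last (snd (z l)))))) \<in> D j)"
          using j succ_eq[OF c] by auto
      qed (use Suc.prems(1) in auto)
    qed
  }
qed

section \<open>Left-maximal paths into a vertex\<close>

lemma LM_unique':
  assumes "p \<in> LM" "p' \<in> LM" "pend p = pend p'" "in_degree Q (pend p) \<noteq> 2"
  shows "p = p'"
proof (cases "snd p = [] \<or> snd p' = []")
  case True
  have "x = y" if "x \<in> LM" "y \<in> LM" "pend x = pend y" "snd x = []" for x y
  proof (cases "snd y = []")
    case False
    have "last (snd y) \<in> arcs Q" "head Q (last (snd y)) = pend y"
      using NP_arcs[OF LM_NP[OF that(2)]] False by (auto simp: pend_nonempty)
    thus ?thesis using LM_rel[OF that(1), of "last (snd y)"] that by (simp add: pend_empty)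
  qed (use that in \<open>simp add: prod_eq_iff pend_empty\<close>)
  thus ?thesis using assms True by metis
next
  case False
  have "last (snd p) \<in> arcs Q" "last (snd p') \<in> arcs Q"
    using NP_arcs[OF LM_NP[OF assms(1)]] NP_arcs[OF LM_NP[OF assms(2)]] False by auto
  moreover have "head Q (last (snd p)) = pend p" "head Q (last (snd p')) = pend p"
    using False assms(3) by (simp_all add: pend_nonempty)
  ultimately have "last (snd p) = last (snd p')" using in_degree_2I assms(4) by metis
  thus ?thesis using LM_unique assms False by blast
qed

definition final :: "'v \<Rightarrow> 'v \<times> 'a list" where
  "final u = (SOME p. p \<in> LM \<and> pend p = u)"

lemma final: "u \<in> verts Q \<Longrightarrow> final u \<in> LM \<and> pend (final u) = u"
  unfolding final_def
proof (rule someI_ex)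
  assume "u \<in> verts Q"
  then obtain q where "pcat q (u, []) \<in> LM" "pend q = fst (u, [] :: 'a list)"
    using LM_extend[of "(u, [])"] by (metis NP_trivial)
  thus "\<exists>p. p \<in> LM \<and> pend p = u" by auto
qed

text \<open>Counterpart of \<open>sg\<close> for the cover of \<open>I(v)\<close>: the functionals
  of two left-maximal paths lead to the same trivial path, so a signed difference lies in the
  kernel.\<close>

definition sgl :: "'v \<times> 'a list \<Rightarrow> 'k" where
  "sgl p = (if p = final (pend p) then 1 else - 1)"

lemma sgl_square [simp]: "sgl p * sgl p = 1"
  by (simp add: sgl_def)

lemma sgl_nonzero [simp]: "sgl p \<noteq> 0"
  by (simp add: sgl_def)

lemma LM_in_2:
  assumes "in_degree Q u = 2" "u \<in> verts Q"
  obtains p where "{p \<in> LM. pend p = u} = {final u, p}" "p \<noteq> final u" "sgl p = -1" "sgl (final u) = 1"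
    "\<And>q. q \<in> NP \<Longrightarrow> fst q = u \<Longrightarrow> snd q \<noteq> [] \<Longrightarrow> pcat p q \<in> NP \<longleftrightarrow> pcat (final u) q \<notin> NP"
proof -
  obtain a b where ab: "in_arcs Q u = {a, b}" "a \<noteq> b" using in_degree_2[OF assms(1)] .
  have arcs: "a \<in> arcs Q" "b \<in> arcs Q" "head Q a = u" "head Q b = u" using ab(1) by (auto simp: set_eq_iff)
  have nt: "snd p \<noteq> [] \<and> last (snd p) \<in> {a, b}" if p: "p \<in> LM" "pend p = u" for p
  proof
    show ne: "snd p \<noteq> []" using LM_rel[OF p(1) arcs(1)] p arcs by (cases "snd p = []") (auto simp: pend_empty)
    show "last (snd p) \<in> {a, b}"
      using NP_arcs[OF LM_NP[OF p(1)]] ne p unfolding ab(1)[symmetric] by (auto simp: pend_nonempty)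
  qed
  have ex: "\<exists>p\<in>LM. pend p = u \<and> last (snd p) = c" if c: "c \<in> {a, b}" for c
  proof -
    have "arr c \<in> NP" using c arcs by auto
    then obtain q where "pcat q (arr c) \<in> LM" "pend q = fst (arr c)" using LM_extend by blast
    thus ?thesis using c arcs by (intro bexI[of _ "pcat q (arr c)"]) (auto simp: pend_pcat)
  qed
  have f: "final u \<in> LM" "pend (final u) = u" using final[OF assms(2)] by auto
  obtain c where c: "c \<in> {a, b}" "c \<noteq> last (snd (final u))" using ab(2) by blast
  obtain p where p: "p \<in> LM" "pend p = u" "last (snd p) = c" using ex[OF c(1)] by blast
  have "x = final u \<or> x = p" if x: "x \<in> LM" "pend x = u" for x
  proof -
    have "last (snd x) = last (snd (final u)) \<or> last (snd x) = last (snd p)"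
      using nt[OF x] nt[OF f] nt[OF p(1,2)] p(3) c by auto
    thus ?thesis using LM_unique[OF x(1) f(1)] LM_unique[OF x(1) p(1)] nt[OF x] nt[OF f] nt[OF p(1,2)] by metis
  qed
  hence set: "{p \<in> LM. pend p = u} = {final u, p}" using f p by auto
  have ne: "p \<noteq> final u" using c p by auto
  have s: "sgl p = -1" "sgl (final u) = 1" using ne p f by (auto simp: sgl_def)
  have "pcat p q \<in> NP \<longleftrightarrow> pcat (final u) q \<notin> NP" if q: "q \<in> NP" "fst q = u" "snd q \<noteq> []" for q
  proof -
    have h: "hd (snd q) \<in> arcs Q" "tail Q (hd (snd q)) = u"
      using NP_arcs[OF q(1)] NP_tail[OF q(1,3)] q by auto
    have l: "last (snd p) \<in> arcs Q" "last (snd (final u)) \<in> arcs Q" "last (snd p) \<noteq> last (snd (final u))"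
      "head Q (last (snd p)) = u" "head Q (last (snd (final u))) = u"
      using nt[OF f] nt[OF p(1,2)] arcs c p by auto
    show ?thesis
      using gentle_left[OF h(1) l(1,2,3)] l(4,5) h(2) q f p nt[OF f] nt[OF p(1,2)] LM_NP by (simp add: NP_pcat)
  qed
  thus ?thesis by (rule that[OF set ne s])
qed

end

context balanced_gentle_algebra
begin

text \<open>By the degree condition at most one arrow leaves the start of \<open>r\<close>, so the
  nonzero paths from there are ordered by the prefix relation.\<close>

lemma LM_prefix:
  assumes r: "r \<in> LM" and w: "w \<in> NP" "fst w = fst r"
  obtains q where "r = pcat w q" "pend w = fst q" "q \<in> NP" "snd q \<noteq> []"
  | q where "w = pcat r q" "pend r = fst q" "q \<in> NP"
proof -
  have "\<exists>s. snd w = snd r @ s \<or> snd r = snd w @ s"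
  proof (cases "snd r = [] \<or> snd w = []")
    case False
    have "hd (snd r) \<in> arcs Q" "hd (snd w) \<in> arcs Q" "tail Q (hd (snd r)) = fst r" "tail Q (hd (snd w)) = fst r"
      using False NP_arcs[OF LM_NP[OF r]] NP_arcs[OF w(1)] NP_tail[OF LM_NP[OF r]] NP_tail[OF w(1)] w(2) by auto
    hence "hd (snd r) = hd (snd w)" using LM_out_unique[OF r] by blast
    moreover have "(fst r, snd r) \<in> NP" "(fst r, snd w) \<in> NP" using LM_NP[OF r] w by (auto, metis prod.collapse)
    ultimately show ?thesis using prefix_comparable[of "fst r" "snd r" "snd w"] False by auto
  qed auto
  then obtain s where "snd w = snd r @ s \<or> (snd r = snd w @ s \<and> s \<noteq> [])" by (metis append_Nil2)
  thus ?thesis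
  proof (elim disjE conjE)
    assume "snd w = snd r @ s"
    from prefix_pcat[OF w(1) this w(2)] show ?thesis by (intro that(2)[of "(pend r, s)"]) simp_all
  next
    assume "snd r = snd w @ s" "s \<noteq> []"
    from prefix_pcat[OF LM_NP[OF r] this(1) w(2)[symmetric]] this(2) show ?thesis
      by (intro that(1)[of "(pend w, s)"]) simp_all
  qed
qed

text \<open>These paths label a basis of the kernel of the projective cover of \<open>I(v)\<close>.\<close>

definition Wd :: "'v \<Rightarrow> ('v \<times> 'a list) set" where
  "Wd v = {q \<in> NP. fst q = v \<and> (\<exists>r\<in>LM. pend r = v \<and> pcat r q \<in> NP) \<and> (in_degree Q v = 2 \<or> snd q \<noteq> [])}"

text \<open>The delicate case is the trivial path: it belongs to \<open>Wd v\<close> only if two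
  arrows enter \<open>v\<close>, and then every nontrivial nonzero path from \<open>v\<close>
  prolongs one of the two left-maximal paths.\<close>

lemma right_closed_Wd: "right_closed (Wd v)"
  unfolding right_closed_def
proof (intro conjI ballI allI impI)
  fix w r assume w: "w \<in> Wd v" and r: "pend w = fst r \<and> pcat w r \<in> NP"
  obtain s where s: "s \<in> LM" "pend s = v" "pcat s w \<in> NP" using w by (auto simp: Wd_def)
  have wv: "fst w = v" "w \<in> NP" using w by (auto simp: Wd_def)
  show "pcat w r \<in> Wd v"
  proof (cases "snd w = []")
    case False
    have "pcat s (pcat w r) \<in> NP"
      using s wv r False NP_pcat[of s w] by (subst NP_pcat) auto
    thus ?thesis using w r s False by (auto simp: Wd_def)
  next
    case True
    hence "pcat w r = r" using r by (simp add: pcat_def prod_eq_iff pend_empty)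
    moreover have "\<exists>s\<in>LM. pend s = v \<and> pcat s r \<in> NP"
    proof (cases "snd r = []")
      case True
      hence "pcat s r = s" by (simp add: pcat_def)
      thus ?thesis using s LM_NP[OF s(1)] by (intro bexI[of _ s]) auto
    next
      case ne: False
      have in2: "in_degree Q v = 2" "v \<in> verts Q" using w True NP_fst[OF wv(2)] wv by (auto simp: Wd_def)
      obtain p where p: "{p \<in> LM. pend p = v} = {final v, p}"
        "\<And>q. q \<in> NP \<Longrightarrow> fst q = v \<Longrightarrow> snd q \<noteq> [] \<Longrightarrow> pcat p q \<in> NP \<longleftrightarrow> pcat (final v) q \<notin> NP"
        by (rule LM_in_2[OF in2]) (rule that; assumption)
      have "r \<in> NP" "fst r = v" using r wv True NP_pcat[of w r] by (auto simp: pend_empty)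
      thus ?thesis using p(2)[of r] ne p(1) by blast
    qed
    ultimately show ?thesis using w r True by (auto simp: Wd_def pend_empty)
  qed
qed (auto simp: Wd_def)

section \<open>Projective cover of a sum of indecomposable injectives, and its kernel\<close>

context
  fixes L :: "'l set" and \<tau> :: "'l \<Rightarrow> 'v"
  assumes L: "finite L" and \<tau>: "\<And>l. l \<in> L \<Longrightarrow> \<tau> l \<in> verts Q"
begin

text \<open>\<open>I(v)\<close> is generated by the functionals dual to the left-maximal paths into
  \<open>v\<close>, hence one projective summand for each of them.\<close>

definition covL :: "('l \<times> 'v \<times> 'a list) set" where
  "covL = {(l, r). l \<in> L \<and> r \<in> LM \<and> pend r = \<tau> l}"

definition cov :: "(('v \<times> 'a list \<Rightarrow> 'k) set, 'l \<times> 'v \<times> 'a list \<Rightarrow> 'v \<times> 'a list \<Rightarrow> 'k) rmod" where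
  "cov = F covL (\<lambda>x. start (fst (snd x)))"

text \<open>The generator of the summand \<open>(l, r)\<close> is sent to the functional dual to
  \<open>r\<close>.\<close>

definition cmap :: "('l \<times> 'v \<times> 'a list \<Rightarrow> 'v \<times> 'a list \<Rightarrow> 'k) \<Rightarrow> 'l \<Rightarrow> 'v \<times> 'a list \<Rightarrow> 'k" where
  "cmap \<phi> l q = (if l \<in> L \<and> q \<in> NP \<and> pend q = \<tau> l
     then \<Sum>r\<in>{r \<in> LM. pend r = \<tau> l}. (\<phi> \<triangleleft>\<^bsub>cov\<^esub> be q) (l, r) r else 0)"

text \<open>A path \<open>q\<close> of \<open>Wd v\<close> becomes the signed family of products
  \<open>r q\<close>. For nontrivial \<open>q\<close> a single product is nonzero; for trivial
  \<open>q\<close> the family is the signed difference of the two paths \<open>r\<close>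
  themselves.\<close>

definition kmap :: "('l \<Rightarrow> 'v \<times> 'a list \<Rightarrow> 'k) \<Rightarrow> 'l \<times> 'v \<times> 'a list \<Rightarrow> 'v \<times> 'a list \<Rightarrow> 'k" where
  "kmap m x w = (if x \<in> covL then cf ((sgl (snd x) \<odot>\<^bsub>A\<^esub> be (snd x)) \<otimes>\<^bsub>A\<^esub> emb (m (fst x))) w else 0)"

lemma finite_LM: "finite {r \<in> LM. P r}"
  using finite_NP by (rule finite_subset[rotated]) (auto simp: LM_def)

lemma finite_covL: "finite covL"
proof -
  have "covL \<subseteq> L \<times> {r \<in> LM. True}" by (auto simp: covL_def)
  thus ?thesis by (rule finite_subset) (rule finite_cartesian_product[OF L finite_LM])
qed

lemma projective_cov: "projective_module A cov"
  unfolding cov_def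
  by (rule projective_F[OF finite_covL]) (auto simp: covL_def dest!: LM_NP NP_fst)

lemma right_module_cov: "right_module A cov"
  unfolding cov_def by (rule right_module_F[OF right_closed_start])

lemma cov_carrier: "\<phi> \<in> carrier cov \<longleftrightarrow>
    (\<forall>l r w. \<phi> (l, r) w \<noteq> 0 \<longrightarrow> l \<in> L \<and> r \<in> LM \<and> pend r = \<tau> l \<and> w \<in> NP \<and> fst w = fst r)"
  using split_paired_All[of "\<lambda>x. \<forall>w. \<phi> x w \<noteq> 0 \<longrightarrow> x \<in> covL \<and> w \<in> start (fst (snd x))"]
  by (simp add: cov_def F_simps covL_def start_def)

lemma cmap_hom: "cmap \<in> rmod_hom A cov (C L \<tau>)"
proof -
  have "A.linear_on cov (carrier cov) (\<lambda>\<phi>. \<Sum>r\<in>{r \<in> LM. pend r = \<tau> l}. \<phi> (l, r) r)" for l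
  proof (rule A.linear_onI)
    fix x y assume "x \<in> carrier cov" "y \<in> carrier cov"
    show "(\<Sum>r\<in>{r \<in> LM. pend r = \<tau> l}. (x \<oplus>\<^bsub>cov\<^esub> y) (l, r) r) =
        (\<Sum>r\<in>{r \<in> LM. pend r = \<tau> l}. x (l, r) r) + (\<Sum>r\<in>{r \<in> LM. pend r = \<tau> l}. y (l, r) r)"
      by (simp add: cov_def F_simps sum.distrib)
  next
    fix x c assume "x \<in> carrier cov"
    hence "A.scal cov x c = (\<lambda>l q. c * x l q)"
      unfolding cov_def by (rule scal_F) (auto simp: start_def)
    thus "(\<Sum>r\<in>{r \<in> LM. pend r = \<tau> l}. A.scal cov x c (l, r) r) = c * (\<Sum>r\<in>{r \<in> LM. pend r = \<tau> l}. x (l, r) r)"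
      by (simp add: sum_distrib_left)
  qed
  from hom_to_C[OF right_module_cov, where L = L and \<tau> = \<tau> and
      lam = "\<lambda>l \<phi>. \<Sum>r\<in>{r \<in> LM. pend r = \<tau> l}. \<phi> (l, r) r", OF this]
  show ?thesis by (simp add: cmap_def[abs_def])
qed

lemma cov_be:
  assumes "pend w = fst q" "pcat w q \<in> NP" "r = pcat w q"
  shows "(\<phi> \<triangleleft>\<^bsub>cov\<^esub> be q) (l, r) r = \<phi> (l, r) w"
  using assms NP_pcat[OF assms(1)] by (simp add: cov_def F_simps cf_mult_be_right cf_emb)

lemma cov_be_0:
  assumes "\<And>w. pend w = fst q \<Longrightarrow> r = pcat w q \<Longrightarrow> w \<in> NP \<Longrightarrow> \<phi> (l, r) w = 0"
  shows "(\<phi> \<triangleleft>\<^bsub>cov\<^esub> be q) (l, r) r = 0"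
proof (rule ccontr)
  assume nz: "(\<phi> \<triangleleft>\<^bsub>cov\<^esub> be q) (l, r) r \<noteq> 0"
  hence nz': "cf (emb (\<phi> (l, r)) \<otimes>\<^bsub>A\<^esub> be q) r \<noteq> 0" by (simp add: cov_def F_simps)
  obtain w where w: "r = pcat w q" "pend w = fst q" "w \<in> NP"
    by (rule cf_mult_be_right_nonzero[OF emb_closed nz'])
  moreover have "r \<in> NP" using nz' cf_outside by blast
  ultimately show False using nz assms[of w] cov_be[of w q r \<phi> l] by simp
qed

text \<open>A left-maximal path is determined by its last arrow, so only one summand of the cover
  contributes at a nontrivial \<open>q\<close>.\<close>

lemma cmap_nontrivial:
  assumes "l \<in> L" "r \<in> LM" "pend r = \<tau> l" "r = pcat w q" "pend w = fst q" "snd q \<noteq> []"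
  shows "cmap \<phi> l q = \<phi> (l, r) w"
proof -
  have r: "pcat w q \<in> NP" using LM_NP[OF assms(2)] assms(4) by simp
  have q: "q \<in> NP" "pend q = \<tau> l" using NP_pcat[OF assms(5)] r assms pend_pcat[OF assms(5)] by auto
  have "(\<Sum>r\<in>{r \<in> LM. pend r = \<tau> l}. (\<phi> \<triangleleft>\<^bsub>cov\<^esub> be q) (l, r) r) = (\<phi> \<triangleleft>\<^bsub>cov\<^esub> be q) (l, r) r"
  proof (rule sum_single[OF finite_LM])
    fix r' assume r': "r' \<in> {r \<in> LM. pend r = \<tau> l}" "r' \<noteq> r"
    show "(\<phi> \<triangleleft>\<^bsub>cov\<^esub> be q) (l, r') r' = 0"
    proof (rule cov_be_0)
      fix w' assume "r' = pcat w' q"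
      hence "r' = r" using LM_unique[of r' r] r' assms by simp
      thus "\<phi> (l, r') w' = 0" using r' by simp
    qed
  qed (use assms in auto)
  thus ?thesis using cov_be[OF assms(5) r assms(4)] assms(1) q by (simp add: cmap_def)
qed

lemma cmap_trivial:
  assumes "l \<in> L"
  shows "cmap \<phi> l (\<tau> l, []) = (\<Sum>r\<in>{r \<in> LM. pend r = \<tau> l}. \<phi> (l, r) r)"
proof -
  have "(\<phi> \<triangleleft>\<^bsub>cov\<^esub> be (\<tau> l, [])) (l, r) r = \<phi> (l, r) r" if "r \<in> LM" "pend r = \<tau> l" for r
    using that LM_NP by (intro cov_be) auto
  thus ?thesis using assms \<tau> by (simp add: cmap_def)
qed

lemma cmap_surj: "cmap ` carrier cov = carrier (C L \<tau>)"
proof (intro equalityI subsetI)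
  fix \<psi> assume \<psi>: "\<psi> \<in> carrier (C L \<tau>)"
  \<comment> \<open>The value of \<open>\<psi>\<close> at \<open>q\<close> is placed in the summand
    of a left-maximal prolongation \<open>w q\<close>. For trivial \<open>q\<close> all left-maximal
    paths qualify; selecting \<open>final\<close> makes the value count once.\<close>
  define \<phi> where "\<phi> x w = (if x \<in> covL \<and> w \<in> NP \<and> (\<exists>q. snd x = pcat w q \<and> pend w = fst q \<and> (snd q \<noteq> [] \<or> snd x = final (\<tau> (fst x))))
      then \<psi> (fst x) (THE q. snd x = pcat w q \<and> pend w = fst q) else 0)" for x w
  have "\<phi> \<in> carrier cov" by (auto simp: cov_carrier \<phi>_def covL_def split: if_splits)
  moreover have ev: "\<phi> (l, r) w = \<psi> l q"
    if "(l, r) \<in> covL" "w \<in> NP" "r = pcat w q" "pend w = fst q" "snd q \<noteq> [] \<or> r = final (\<tau> l)" for l r w q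
  proof -
    have "(THE q'. r = pcat w q' \<and> pend w = fst q') = q"
      using that by (intro the_equality) (auto simp: pcat_def prod_eq_iff)
    thus ?thesis using that unfolding \<phi>_def by auto
  qed
  have "cmap \<phi> l q = \<psi> l q" for l q
  proof (cases "l \<in> L \<and> q \<in> NP \<and> pend q = \<tau> l")
    case False
    thus ?thesis using \<psi> by (auto simp: cmap_def C_simps)
  next
    case True
    hence l: "l \<in> L" and q: "q \<in> NP" "pend q = \<tau> l" by auto
    show ?thesis
    proof (cases "snd q = []")
      case False
      obtain w where w: "pcat w q \<in> LM" "pend w = fst q" "w \<in> NP" using LM_extend[OF q(1)] by blast
      have p: "pend (pcat w q) = \<tau> l" using w q by (simp add: pend_pcat)
      have "cmap \<phi> l q = \<phi> (l, pcat w q) w" by (rule cmap_nontrivial[OF l w(1) p refl w(2) False])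
      thus ?thesis using ev[of l "pcat w q" w q] w False l p by (simp add: covL_def)
    next
      case triv: True
      hence qe: "q = (\<tau> l, [])" using q by (simp add: prod_eq_iff pend_empty)
      have f: "final (\<tau> l) \<in> LM" "pend (final (\<tau> l)) = \<tau> l" using final[OF \<tau>[OF l]] by auto
      have "(\<Sum>r\<in>{r \<in> LM. pend r = \<tau> l}. \<phi> (l, r) r) = \<phi> (l, final (\<tau> l)) (final (\<tau> l))"
      proof (rule sum_single[OF finite_LM])
        fix r assume r: "r \<in> {r \<in> LM. pend r = \<tau> l}" "r \<noteq> final (\<tau> l)"
        show "\<phi> (l, r) r = 0"
          using r by (auto simp: \<phi>_def pcat_def prod_eq_iff)
      qed (use f in auto)
      also have "\<dots> = \<psi> l q"
        by (rule ev) (use f l qe LM_NP in \<open>auto simp: covL_def\<close>)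
      finally show ?thesis using cmap_trivial[OF l, of \<phi>] by (simp add: qe)
    qed
  qed
  hence "\<psi> = cmap \<phi>" by (intro ext) simp
  thus "\<psi> \<in> cmap ` carrier cov" using calculation by blast
qed (use rmod_homD(1)[OF cmap_hom] in auto)

lemma kmap_eval:
  assumes "(l, r) \<in> covL" "pend r = fst q" "pcat r q \<in> NP"
  shows "kmap m (l, r) (pcat r q) = sgl r * m l q"
  using assms NP_pcat[OF assms(2)]
  by (simp add: kmap_def A.smult_lmult cf_smult cf_mult_be_left cf_emb)

lemma kmap_nonzero:
  assumes "kmap m (l, r) w \<noteq> 0"
  obtains q where "(l, r) \<in> covL" "w = pcat r q" "pend r = fst q" "q \<in> NP" "w \<in> NP"
proof -
  have l: "(l, r) \<in> covL" and nz: "cf (be r \<otimes>\<^bsub>A\<^esub> emb (m l)) w \<noteq> 0"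
    using assms by (auto simp: kmap_def A.smult_lmult cf_smult split: if_splits)
  have "w \<in> NP" using nz cf_outside by blast
  thus ?thesis using cf_mult_be_left_nonzero[OF emb_closed nz] l that by blast
qed

lemma kmap_hom: "kmap \<in> rmod_hom A (F L (\<lambda>l. Wd (\<tau> l))) cov"
proof -
  have "(\<lambda>\<phi> x w. if x \<in> covL then cf (sgl (snd x) \<odot>\<^bsub>A\<^esub> be (snd x) \<otimes>\<^bsub>A\<^esub> emb (\<phi> (fst x))) w else 0)
      \<in> rmod_hom A (F L (\<lambda>l. Wd (\<tau> l))) (F covL (\<lambda>x. start (fst (snd x))))"
  proof (rule hom_F_F)
    fix \<phi> x w assume x: "x \<in> covL" and "cf (sgl (snd x) \<odot>\<^bsub>A\<^esub> be (snd x) \<otimes>\<^bsub>A\<^esub> emb (\<phi> (fst x))) w \<noteq> 0"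
    hence "kmap \<phi> (fst x, snd x) w \<noteq> 0" by (simp add: kmap_def)
    then obtain q where "w = pcat (snd x) q" "w \<in> NP" by (rule kmap_nonzero)
    thus "w \<in> start (fst (snd x))" by (simp add: start_def)
  qed simp
  thus ?thesis by (simp add: kmap_def[abs_def] cov_def)
qed

lemma kmap_inj: "inj_on kmap (carrier (F L (\<lambda>l. Wd (\<tau> l))))"
proof (rule rmod_hom_inj[OF kmap_hom right_module_F right_module_cov])
  fix m assume m: "m \<in> carrier (F L (\<lambda>l. Wd (\<tau> l)))" and "kmap m = \<zero>\<^bsub>cov\<^esub>"
  hence z: "kmap m x w = 0" for x w by (simp add: cov_def F_simps(2))
  have "m l q = 0" for l q
  proof (rule ccontr)
    assume nz: "m l q \<noteq> 0"
    hence l: "l \<in> L" "q \<in> Wd (\<tau> l)" using m by (auto simp: F_simps)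
    then obtain r where r: "r \<in> LM" "pend r = \<tau> l" "pcat r q \<in> NP" "fst q = \<tau> l" by (auto simp: Wd_def)
    have "kmap m (l, r) (pcat r q) = sgl r * m l q"
      by (rule kmap_eval) (use l r in \<open>auto simp: covL_def\<close>)
    thus False using z nz by simp
  qed
  thus "m = \<zero>\<^bsub>F L (\<lambda>l. Wd (\<tau> l))\<^esub>" by (simp add: F_simps fun_eq_iff)
qed (rule right_closed_Wd)

text \<open>The image of \<open>kmap\<close> lives on paths beginning with the whole of
  \<open>r\<close>, whereas \<open>cmap\<close> at a nontrivial \<open>q\<close> reads proper
  prefixes of \<open>r\<close>. At the trivial path the signs cancel, or that path is not in
  \<open>Wd\<close>.\<close>

lemma cmap_kmap:
  assumes m: "m \<in> carrier (F L (\<lambda>l. Wd (\<tau> l)))"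
  shows "cmap (kmap m) = (\<lambda>_ _. 0)"
proof (intro ext)
  fix l q
  show "cmap (kmap m) l q = 0"
  proof (cases "l \<in> L \<and> q \<in> NP \<and> pend q = \<tau> l")
    case False
    thus ?thesis by (auto simp: cmap_def)
  next
    case True
    hence l: "l \<in> L" and q: "q \<in> NP" "pend q = \<tau> l" by auto
    show ?thesis
    proof (cases "snd q = []")
      case False
      have "(kmap m \<triangleleft>\<^bsub>cov\<^esub> be q) (l, r) r = 0" for r
      proof (rule cov_be_0, rule ccontr)
        fix w assume w: "r = pcat w q" "kmap m (l, r) w \<noteq> 0"
        then obtain q' where "w = pcat r q'" using kmap_nonzero by metis
        hence "w = pcat (pcat w q) q'" using w(1) by simp
        hence "snd w = snd (pcat (pcat w q) q')" by (rule arg_cong)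
        thus False using False by simp
      qed
      thus ?thesis by (simp add: cmap_def)
    next
      case triv: True
      hence qe: "q = (\<tau> l, [])" using q by (simp add: prod_eq_iff pend_empty)
      have k: "kmap m (l, r) r = sgl r * m l (\<tau> l, [])" if r: "r \<in> LM" "pend r = \<tau> l" for r
        using kmap_eval[of l r "(\<tau> l, [])" m] r l LM_NP by (simp add: covL_def)
      have "cmap (kmap m) l q = (\<Sum>r\<in>{r \<in> LM. pend r = \<tau> l}. sgl r * m l (\<tau> l, []))"
        unfolding qe cmap_trivial[OF l] by (rule sum.cong) (auto simp: k)
      also have "\<dots> = 0"
      proof (cases "in_degree Q (\<tau> l) = 2")
        case True
        obtain p where p: "{p \<in> LM. pend p = \<tau> l} = {final (\<tau> l), p}" "p \<noteq> final (\<tau> l)"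
          "sgl p = -1" "sgl (final (\<tau> l)) = 1"
          by (rule LM_in_2[OF True \<tau>[OF l]]) (rule that; assumption)
        show ?thesis unfolding p(1) using p(2,3,4) by simp
      next
        case False
        hence "(\<tau> l, []) \<notin> Wd (\<tau> l)" by (simp add: Wd_def)
        hence "m l (\<tau> l, []) = 0" using m unfolding F_simps by blast
        thus ?thesis by simp
      qed
      finally show ?thesis .
    qed
  qed
qed

text \<open>Coefficients at proper prefixes of \<open>r\<close> vanish by the kernel condition. The
  remaining paths are of the form \<open>r q\<close>, and the coefficient at \<open>q\<close> is
  taken from one chosen \<open>r\<close> with \<open>r q\<close> nonzero.\<close>

lemma kernel_cmap:
  assumes \<phi>: "\<phi> \<in> carrier cov" and z: "cmap \<phi> = (\<lambda>_ _. 0)"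
  shows "\<phi> \<in> kmap ` carrier (F L (\<lambda>l. Wd (\<tau> l)))"
proof -
  define \<rho> where "\<rho> l q = (SOME r. r \<in> LM \<and> pend r = \<tau> l \<and> pcat r q \<in> NP)" for l q
  define m where "m l q = (if l \<in> L \<and> q \<in> Wd (\<tau> l) then sgl (\<rho> l q) * \<phi> (l, \<rho> l q) (pcat (\<rho> l q) q) else 0)" for l q
  have \<rho>: "\<rho> l q \<in> LM \<and> pend (\<rho> l q) = \<tau> l \<and> pcat (\<rho> l q) q \<in> NP" if "q \<in> Wd (\<tau> l)" for l q
    unfolding \<rho>_def by (rule someI_ex) (use that in \<open>auto simp: Wd_def\<close>)
  have mc: "m \<in> carrier (F L (\<lambda>l. Wd (\<tau> l)))" by (auto simp: F_simps m_def split: if_splits)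
  have "kmap m x w = \<phi> x w" for x w
  proof -
    obtain l r where x: "x = (l, r)" by (cases x)
    show ?thesis
    proof (cases "(l, r) \<in> covL \<and> w \<in> NP \<and> fst w = fst r")
      case False
      hence "\<phi> (l, r) w = 0" using \<phi> by (auto simp: cov_carrier covL_def)
      moreover have "kmap m (l, r) w = 0"
      proof (rule ccontr)
        assume "kmap m (l, r) w \<noteq> 0"
        then obtain q where "(l, r) \<in> covL" "w = pcat r q" "w \<in> NP" using kmap_nonzero by metis
        thus False using False by simp
      qed
      ultimately show ?thesis by (simp add: x)
    next
      case True
      hence l: "l \<in> L" and r: "r \<in> LM" "pend r = \<tau> l" and w: "w \<in> NP" "fst w = fst r"
        and c: "(l, r) \<in> covL" by (auto simp: covL_def)
      from r(1) w show ?thesis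
      proof (cases rule: LM_prefix)
        case (1 q)
        have "kmap m (l, r) w = 0"
        proof (rule ccontr)
          assume "kmap m (l, r) w \<noteq> 0"
          then obtain q' where "w = pcat r q'" using kmap_nonzero by metis
          hence "w = pcat (pcat w q) q'" using 1(1) by simp
          hence "snd w = snd (pcat (pcat w q) q')" by (rule arg_cong)
          thus False using 1(4) by simp
        qed
        moreover have "\<phi> (l, r) w = 0"
          using cmap_nontrivial[OF l r 1(1,2,4), of \<phi>] z by simp
        ultimately show ?thesis by (simp add: x)
      next
        case (2 q)
        have NP: "pcat r q \<in> NP" using w 2 by simp
        have k: "kmap m (l, r) w = sgl r * m l q"
          unfolding 2(1) by (rule kmap_eval[OF c 2(2) NP])
        have fq: "fst q = \<tau> l" using 2(2) r by simp
        have qt: "q = (\<tau> l, [])" "w = r" if "snd q = []"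
          using that fq 2(1) by (auto simp: prod_eq_iff pcat_def)
        have zt: "(\<Sum>r\<in>{r \<in> LM. pend r = \<tau> l}. \<phi> (l, r) r) = 0"
          using cmap_trivial[OF l, of \<phi>] z by simp
        show ?thesis
        proof (cases "q \<in> Wd (\<tau> l)")
          case True
          note \<rho>q = \<rho>[OF True]
          have mq: "m l q = sgl (\<rho> l q) * \<phi> (l, \<rho> l q) (pcat (\<rho> l q) q)" using l True by (simp add: m_def)
          show ?thesis
          proof (cases "\<rho> l q = r")
            case True
            have "sgl r * (sgl r * y) = y" for y by (simp add: mult.assoc[symmetric])
            thus ?thesis using k mq 2(1) True by (simp add: x)
          next
            case False
            have in2: "in_degree Q (\<tau> l) = 2" using LM_unique'[of "\<rho> l q" r] \<rho>q r False by auto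
            obtain p where p: "{p \<in> LM. pend p = \<tau> l} = {final (\<tau> l), p}" "p \<noteq> final (\<tau> l)"
              "sgl p = -1" "sgl (final (\<tau> l)) = 1"
              "\<And>q. q \<in> NP \<Longrightarrow> fst q = \<tau> l \<Longrightarrow> snd q \<noteq> [] \<Longrightarrow> pcat p q \<in> NP \<longleftrightarrow> pcat (final (\<tau> l)) q \<notin> NP"
              by (rule LM_in_2[OF in2 \<tau>[OF l]]) (rule that; assumption)
            have rr: "r = p \<and> \<rho> l q = final (\<tau> l) \<or> r = final (\<tau> l) \<and> \<rho> l q = p"
            proof -
              have "r \<in> {final (\<tau> l), p}" "\<rho> l q \<in> {final (\<tau> l), p}"
                using r \<rho>q unfolding p(1)[symmetric] by auto
              thus ?thesis using False by auto
            qed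
            \<comment> \<open>A nontrivial \<open>q\<close> would prolong only one of the two
              left-maximal paths.\<close>
            have "snd q = []"
            proof (rule ccontr)
              assume "snd q \<noteq> []"
              from p(5)[OF 2(3) fq this] rr \<rho>q NP show False by auto
            qed
            note qt = qt[OF this]
            \<comment> \<open>The kernel condition at the trivial path makes the two coefficients
              opposite, matching the signs in \<open>kmap\<close>.\<close>
            have "\<phi> (l, final (\<tau> l)) (final (\<tau> l)) + \<phi> (l, p) p = 0"
              using zt p(2) unfolding p(1) by simp
            hence "\<phi> (l, p) p = - \<phi> (l, final (\<tau> l)) (final (\<tau> l))" by (simp add: eq_neg_iff_add_eq_0 add.commute)
            thus ?thesis using k mq rr p(3,4) qt by (auto simp: x)
          qed
        next
          case False
          hence s: "snd q = []" "in_degree Q (\<tau> l) \<noteq> 2"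
            using 2(3) fq r NP by (auto simp: Wd_def)
          \<comment> \<open>With a single left-maximal path the sum in the kernel condition has one
            term.\<close>
          have "r' = r" if "r' \<in> LM" "pend r' = \<tau> l" for r'
            by (rule LM_unique') (use that r s(2) in auto)
          hence "{r \<in> LM. pend r = \<tau> l} = {r}" using r by blast
          hence "\<phi> (l, r) r = 0" using zt by simp
          thus ?thesis using k qt[OF s(1)] False by (simp add: x m_def)
        qed
      qed
    qed
  qed
  hence "\<phi> = kmap m" by (intro ext) simp
  thus ?thesis using mc by blast
qed

lemma exact_cmap: "kmap ` carrier (F L (\<lambda>l. Wd (\<tau> l))) = {x \<in> carrier cov. cmap x = \<zero>\<^bsub>C L \<tau>\<^esub>}"
  using kernel_cmap cmap_kmap rmod_homD(1)[OF kmap_hom] by (auto simp: C_simps(2))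

text \<open>The kernel of the cover is a sum of right ideals generated by single paths, and
  \<open>pd_le_F_pre\<close> bounds its dimension by chain length. Summands with empty
  \<open>Wd\<close> have no generator and leave the index set.\<close>

lemma pd_le_C_Suc:
  assumes W: "\<And>l. l \<in> L \<Longrightarrow> Wd (\<tau> l) = {} \<or> (\<exists>z\<in>NP. Wd (\<tau> l) = pre z \<and> (snd z = [] \<or> (\<exists>j\<le>k. last (snd z) \<in> D j)))"
  shows "A.pd_le (Suc k) (C L \<tau>)"
proof -
  let ?L = "{l \<in> L. Wd (\<tau> l) \<noteq> {}}"
  have "\<forall>l\<in>?L. \<exists>z. z \<in> NP \<and> Wd (\<tau> l) = pre z \<and> (snd z = [] \<or> (\<exists>j\<le>k. last (snd z) \<in> D j))"
    using W by blast
  from bchoice[OF this] obtain z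
    where *: "\<forall>l\<in>?L. z l \<in> NP \<and> Wd (\<tau> l) = pre (z l) \<and> (snd (z l) = [] \<or> (\<exists>j\<le>k. last (snd (z l)) \<in> D j))" ..
  have z: "z l \<in> NP" "Wd (\<tau> l) = pre (z l)" "snd (z l) = [] \<or> (\<exists>j\<le>k. last (snd (z l)) \<in> D j)"
    if "l \<in> ?L" for l
    using bspec[OF * that] by blast+
  have "l \<in> L \<and> q \<in> Wd (\<tau> l) \<longleftrightarrow> l \<in> ?L \<and> q \<in> pre (z l)" for l q
    using z(2)[of l] by (cases "Wd (\<tau> l) = {}") auto
  hence "carrier (F L (\<lambda>l. Wd (\<tau> l))) = carrier (F ?L (\<lambda>l. pre (z l)))"
    by (simp only: F_simps)
  hence "F L (\<lambda>l. Wd (\<tau> l)) = F ?L (\<lambda>l. pre (z l))" by (simp add: F_def fmod_def)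
  moreover have "finite ?L" using L by simp
  from pd_le_F_pre[of ?L z k, OF this z(1,3)] have "A.pd_le k (F ?L (\<lambda>l. pre (z l)))" .
  ultimately have "A.pd_le k (F L (\<lambda>l. Wd (\<tau> l)))" by simp
  thus ?thesis
    by (rule A.pd_le_step[OF projective_cov fd_module_C[OF L] cmap_hom cmap_surj kmap_hom kmap_inj exact_cmap])
qed

lemma pd_le_C_0:
  assumes W: "\<And>l. l \<in> L \<Longrightarrow> Wd (\<tau> l) = {}"
  shows "A.pd_le 0 (C L \<tau>)"
proof -
  have "carrier (F L (\<lambda>l. Wd (\<tau> l))) = {\<zero>\<^bsub>F L (\<lambda>l. Wd (\<tau> l))\<^esub>}"
    using W by (fastforce simp: F_simps fun_eq_iff)
  moreover have "kmap \<zero>\<^bsub>F L (\<lambda>l. Wd (\<tau> l))\<^esub> = \<zero>\<^bsub>cov\<^esub>"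
    by (rule rmod_hom_zero[OF kmap_hom right_module_F right_module_cov]) (rule right_closed_Wd)
  ultimately have "{x \<in> carrier cov. cmap x = \<zero>\<^bsub>C L \<tau>\<^esub>} = {\<zero>\<^bsub>cov\<^esub>}" using exact_cmap by simp
  hence "inj_on cmap (carrier cov)"
    by (intro rmod_hom_inj[OF cmap_hom right_module_cov right_module_C]) blast
  thus ?thesis
    using A.pd_le_0[OF projective_cov right_module_C cmap_hom] cmap_surj by (simp add: bij_betw_def)
qed

end

text \<open>In degree 0 every arrow leaving the end of \<open>p\<close> is annihilated by the last
  arrow of \<open>p\<close>, the only arrow entering there, so the kernel of the cover vanishes. In
  degree \<open>k + 1\<close> the kernel at a vertex of in-degree 2 is projective; elsewhere it is
  zero or generated by the label \<open>f \<in> D k\<close>, so that the layer fixes both the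
  position and the length of the remaining chain.\<close>

lemma pd_le_E: "A.pd_le n (E n)"
proof (cases n)
  case 0
  have "Wd (pend p) = {}" if p: "p \<in> RM" for p
  proof (rule ccontr)
    assume "Wd (pend p) \<noteq> {}"
    then obtain q r where q: "q \<in> NP" "fst q = pend p" "in_degree Q (pend p) = 2 \<or> snd q \<noteq> []"
      and r: "r \<in> LM" "pend r = pend p" "pcat r q \<in> NP" by (auto simp: Wd_def)
    have "in_degree Q (pend p) \<noteq> 2"
    proof
      assume "in_degree Q (pend p) = 2"
      then obtain a b where ab: "in_arcs Q (pend p) = {a, b}" "a \<noteq> b" using in_degree_2 by metis
      have "a \<in> arcs Q" "b \<in> arcs Q" "head Q a = pend p" "head Q b = pend p" using ab(1) by (auto simp: set_eq_iff)
      thus False using RM_in_unique[OF p] ab(2) by blast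
    qed
    hence ne: "snd q \<noteq> []" using q by blast
    have c: "hd (snd q) \<in> arcs Q" "tail Q (hd (snd q)) = pend p"
      using NP_arcs[OF q(1)] NP_tail[OF q(1) ne] q(2) ne by auto
    have pr: "snd p \<noteq> []" "rel (last (snd p)) (hd (snd q))" using RM_rel[OF p c] by auto
    have pl: "last (snd p) \<in> arcs Q" "head Q (last (snd p)) = pend p"
      using relD(1)[OF pr(2)] pr(1) by (simp_all add: pend_nonempty)
    have rn: "snd r \<noteq> []"
    proof
      assume "snd r = []"
      thus False using LM_rel[OF r(1) pl(1)] pl(2) r(2) by (simp add: pend_empty)
    qed
    have "last (snd r) \<in> arcs Q" "head Q (last (snd r)) = pend p"
      using NP_arcs[OF LM_NP[OF r(1)]] rn r(2) by (auto simp: pend_nonempty)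
    hence "last (snd r) = last (snd p)" using RM_in_unique[OF p _ _ _ pl(2)] pl(1) by blast
    thus False using r(3) NP_pcat[of r q] r(2) q(2) pr(2) rn ne by simp
  qed
  thus ?thesis
    unfolding 0 E_def by (intro pd_le_C_0[OF finite_Lab tgt_verts]) (auto simp: Lab_simps(1))
next
  case (Suc k)
  have "Wd (fst l) = {} \<or> (\<exists>z\<in>NP. Wd (fst l) = pre z \<and> (snd z = [] \<or> (\<exists>j\<le>k. last (snd z) \<in> D j)))"
    if l: "l \<in> Lab (Suc k)" for l
  proof -
    have v: "fst l \<in> verts Q" using tgt_verts[OF l] by simp
    show ?thesis
    proof (cases "in_degree Q (fst l) = 2")
      case True
      obtain p where p: "{p \<in> LM. pend p = fst l} = {final (fst l), p}"
        "\<And>q. q \<in> NP \<Longrightarrow> fst q = fst l \<Longrightarrow> snd q \<noteq> [] \<Longrightarrow> pcat p q \<in> NP \<longleftrightarrow> pcat (final (fst l)) q \<notin> NP"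
        by (rule LM_in_2[OF True v]) (rule that; assumption)
      have f: "final (fst l) \<in> LM" "pend (final (fst l)) = fst l" using final[OF v] by auto
      have "\<exists>r\<in>LM. pend r = fst l \<and> pcat r q \<in> NP" if q: "q \<in> NP" "fst q = fst l" for q
      proof (cases "snd q = []")
        case True
        hence "pcat (final (fst l)) q = final (fst l)" by (simp add: pcat_def)
        thus ?thesis using f LM_NP by metis
      next
        case False
        thus ?thesis using p q by blast
      qed
      hence "Wd (fst l) = pre (fst l, [])"
        using True unfolding pre_trivial Wd_def start_def by blast
      thus ?thesis using v by (intro disjI2 bexI[of _ "(fst l, [])"]) auto
    next
      case False
      from l obtain f where f: "f \<in> D k" "l = arr f"
      proof (cases rule: Lab_cases)
        case (1 u)
        thus ?thesis using False balanced by simp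
      qed (use that in blast)
      have fa: "f \<in> arcs Q" using D_arcs[OF f(1)] .
      have o: "out_degree Q (fst l) \<noteq> 2" using False balanced v by blast
      have hd: "hd (snd q) = f" if q: "q \<in> NP" "fst q = fst l" "snd q \<noteq> []" for q
      proof -
        have h: "hd (snd q) \<in> arcs Q" "tail Q (hd (snd q)) = fst l"
          using NP_arcs[OF q(1)] NP_tail[OF q(1,3)] q by auto
        show ?thesis
        proof (rule ccontr)
          assume "hd (snd q) \<noteq> f"
          from out_degree_2I[OF h(1) fa this h(2)] o f(2) show False by simp
        qed
      qed
      show ?thesis
      proof (cases "Wd (fst l) = {}")
        case ne: False
        then obtain q0 r where q0: "q0 \<in> NP" "fst q0 = fst l" "snd q0 \<noteq> []"
          and r: "r \<in> LM" "pend r = fst l" "pcat r q0 \<in> NP" using False by (auto simp: Wd_def)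
        have nr: "snd r = [] \<or> \<not> rel (last (snd r)) f"
          using r q0 NP_pcat[of r q0] hd[OF q0] by simp
        have "Wd (fst l) = pre (arr f)"
        proof (intro equalityI subsetI)
          fix q assume "q \<in> Wd (fst l)"
          hence q: "q \<in> NP" "fst q = fst l" "snd q \<noteq> []" using False by (auto simp: Wd_def)
          show "q \<in> pre (arr f)" using pre_arrI[OF q(1,3)] hd[OF q] by simp
        next
          fix q assume "q \<in> pre (arr f)"
          then obtain q' where q: "q \<in> NP" "q = pcat (arr f) q'" by (auto simp: pre_def)
          have "fst q = fst l" "snd q \<noteq> []" "hd (snd q) = f" using q f(2) by auto
          moreover from this have "pcat r q \<in> NP" using r nr q(1) LM_NP by (subst NP_pcat) auto
          ultimately show "q \<in> Wd (fst l)" using q(1) r by (auto simp: Wd_def)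
        qed
        thus ?thesis using fa f(1) by (intro disjI2 bexI[of _ "arr f"]) auto
      qed simp
    qed
  qed
  thus ?thesis
    unfolding Suc E_def by (intro pd_le_C_Suc[OF finite_Lab tgt_verts]) auto
qed

text \<open>The resolution does not depend on \<open>n\<close>, so one coordinate copy witnesses all
  the conditions at once.\<close>

lemma auslander_gorenstein: "auslander_gorenstein A"
proof -
  obtain E' :: "nat \<Rightarrow> ('k, ('v \<times> 'a list \<Rightarrow> 'k) set) coord_rmod" and e' d' \<phi>
    where min: "minimal_injective_resolution A (regular_module A) E' e' d'"
    and \<phi>: "\<And>i. \<phi> i \<in> rmod_hom A (E i) (E' i)" "\<And>i. bij_betw (\<phi> i) (carrier (E i)) (carrier (E' i))"
  proof (rule A.minimal_injective_resolution_copy[of "regular_module A" E e d])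
    show "inj_on e (carrier (regular_module A))" using e_inj by (simp add: regular_simps)
    show "e ` carrier (regular_module A) = {x \<in> carrier (E 0). d 0 x = \<zero>\<^bsub>E 1\<^esub>}"
      using exact_e by (simp add: regular_simps)
    show "essential_in A (e ` carrier (regular_module A)) (E 0)" using essential_e by (simp add: regular_simps)
  qed (use fd_module_regular injective_E e_hom d_hom exact_d essential_d in auto)
  have res: "injective_resolution A (regular_module A) E' e' d'"
    using min by (simp add: minimal_injective_resolution_def)
  have E'r: "right_module A (E' i)" for i
    using res by (simp add: injective_resolution_def injective_module_def fd_module_def)
  have "pdim A (E' i) \<le> enat i" for i
    by (rule A.pdim_le, rule A.pd_le_bij[OF pd_le_E E'r \<phi>])
  hence "n_gorenstein n A" for n
    unfolding n_gorenstein_def using min by blast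
  moreover have "idim A (regular_module A) < \<infinity>"
  proof -
    obtain N where N: "\<And>n. n > N \<Longrightarrow> carrier (E n) = {\<zero>\<^bsub>E n\<^esub>}" using E_eventually_zero by blast
    have "carrier (E' n) = {\<zero>\<^bsub>E' n\<^esub>}" if "n > N" for n
      using \<phi>(2)[of n] N[OF that] rmod_hom_zero[OF \<phi>(1) right_module_E E'r, of n]
      by (auto simp: bij_betw_def)
    hence "idim A (regular_module A) \<le> enat N"
      unfolding idim_def using res by (intro Inf_lower) blast
    thus ?thesis by (rule le_less_trans) simp
  qed
  ultimately show ?thesis by (simp add: auslander_gorenstein_def)
qed

end

section \<open>The degree condition is necessary\<close>

context gentle_algebra
begin

text \<open>A spanning set gives a surjection from a free module, which splits. The embedding lets
  elements of \<open>E\<close> be examined through their coefficients at paths.\<close>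

lemma projective_embeds:
  fixes E :: "('k, ('v \<times> 'a list \<Rightarrow> 'k) set) coord_rmod"
  assumes E: "projective_module A E"
  obtains B s where "s \<in> rmod_hom A E (F (B :: (nat \<Rightarrow> 'k) set) (\<lambda>_. NP))" "inj_on s (carrier E)"
proof -
  have fdE: "fd_module A E" using E by (simp add: projective_module_def)
  hence Er: "right_module A E" by (simp add: fd_module_def)
  interpret E: right_module A E by (rule Er)
  obtain B where B: "B \<subseteq> carrier E" "finite B"
    and gen: "\<And>m. m \<in> carrier E \<Longrightarrow> \<exists>c. m = (\<Oplus>\<^bsub>E\<^esub>b\<in>B. b \<triangleleft>\<^bsub>E\<^esub> (c b \<odot>\<^bsub>A\<^esub> \<one>\<^bsub>A\<^esub>))"
    using fdE unfolding fd_module_def by blast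
  let ?F = "F B (\<lambda>_. NP)"
  let ?p = "\<lambda>\<phi>. \<Oplus>\<^bsub>E\<^esub>b\<in>B. b \<triangleleft>\<^bsub>E\<^esub> emb (\<phi> b)"
  have p: "?p \<in> rmod_hom A ?F E" by (rule hom_from_F[OF Er B(2)]) (use B in auto)
  have "m \<in> ?p ` carrier ?F" if m: "m \<in> carrier E" for m
  proof -
    obtain c where c: "m = (\<Oplus>\<^bsub>E\<^esub>b\<in>B. b \<triangleleft>\<^bsub>E\<^esub> (c b \<odot>\<^bsub>A\<^esub> \<one>\<^bsub>A\<^esub>))" using gen[OF m] by blast
    let ?\<phi> = "\<lambda>b w. if b \<in> B then cf (c b \<odot>\<^bsub>A\<^esub> \<one>\<^bsub>A\<^esub>) w else 0"
    have \<phi>c: "?\<phi> \<in> carrier ?F" using cf_outside by (auto simp: F_simps)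
    have "m = ?p ?\<phi>"
      unfolding c by (rule E.M.finsum_cong') (use B in \<open>auto intro!: E.ract_closed simp: emb_cf\<close>)
    thus ?thesis using \<phi>c by (rule image_eqI)
  qed
  hence surj: "?p ` carrier ?F = carrier E" using rmod_homD(1)[OF p] by blast
  have "(\<lambda>x. x) \<in> rmod_hom A E E" by (rule rmod_homI) auto
  then obtain s where s: "s \<in> rmod_hom A E ?F" "\<And>m. m \<in> carrier E \<Longrightarrow> ?p (s m) = m"
    by (rule A.projective_lift[OF E fd_module_F[OF B(2) right_closed_NP] fdE p surj]) (rule that; assumption)
  have "inj_on s (carrier E)" by (rule inj_on_inverseI[of _ ?p]) (rule s(2))
  thus ?thesis using that s(1) by blast
qed

section \<open>An injective and projective module containing the regular module\<close>

context
  fixes E :: "('k, ('v \<times> 'a list \<Rightarrow> 'k) set) coord_rmod" and e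
  assumes inj: "injective_module A E" and proj: "projective_module A E"
    and e: "e \<in> rmod_hom A (regular_module A) E" "inj_on e (carrier A)"
begin

lemma Er: "right_module A E"
  using proj by (simp add: projective_module_def fd_module_def)

lemma e_one: "a \<in> carrier A \<Longrightarrow> e \<one>\<^bsub>A\<^esub> \<triangleleft>\<^bsub>E\<^esub> a = e a"
  using rmod_homD(3)[OF e(1), of "\<one>\<^bsub>A\<^esub>" a] by (simp add: regular_simps)

lemma e_one_closed: "e \<one>\<^bsub>A\<^esub> \<in> carrier E"
  using rmod_homD(1)[OF e(1)] by (simp add: regular_simps)

lemma e_be_nonzero: "q \<in> NP \<Longrightarrow> e (be q) \<noteq> \<zero>\<^bsub>E\<^esub>"
proof
  assume q: "q \<in> NP" and z: "e (be q) = \<zero>\<^bsub>E\<^esub>"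
  have "e \<zero>\<^bsub>A\<^esub> = \<zero>\<^bsub>E\<^esub>" using rmod_hom_zero[OF e(1) right_module_regular Er] by (simp add: regular_simps)
  hence "be q = \<zero>\<^bsub>A\<^esub>" using z e(2) by (auto simp: inj_on_def)
  thus False using be_nonzero[OF q] by simp
qed

lemma hom_regular:
  assumes "h \<in> rmod_hom A (regular_module A) E" "a \<in> carrier A"
  shows "h a = h \<one>\<^bsub>A\<^esub> \<triangleleft>\<^bsub>E\<^esub> a" "h \<one>\<^bsub>A\<^esub> \<in> carrier E"
  using rmod_homD(3)[OF assms(1), of "\<one>\<^bsub>A\<^esub>" a] rmod_homD(1)[OF assms(1)] assms(2)
  by (simp_all add: regular_simps)

text \<open>In a free module a multiple \<open>y a\<close> is supported on paths with last arrow
  \<open>a\<close>, and for distinct arrows these supports are disjoint.\<close>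

lemma common_multiple_zero:
  assumes y: "y \<in> carrier E" and z: "z \<in> carrier E" and ab: "a \<noteq> b"
    and eq: "y \<triangleleft>\<^bsub>E\<^esub> be (arr a) = z \<triangleleft>\<^bsub>E\<^esub> be (arr b)"
  shows "z \<triangleleft>\<^bsub>E\<^esub> be (arr b) = \<zero>\<^bsub>E\<^esub>"
proof -
  obtain B s where s: "s \<in> rmod_hom A E (F (B :: (nat \<Rightarrow> 'k) set) (\<lambda>_. NP))" "inj_on s (carrier E)"
    using projective_embeds[OF proj] .
  let ?F = "F B (\<lambda>_. NP)"
  interpret E: right_module A E by (rule Er)
  have Fr: "right_module A ?F" by (rule right_module_F[OF right_closed_NP])
  have sa: "s (y \<triangleleft>\<^bsub>E\<^esub> be (arr a)) = (\<lambda>l. cf (emb (s y l) \<otimes>\<^bsub>A\<^esub> be (arr a)))"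
    using rmod_homD(3)[OF s(1) y be_closed] by (simp add: F_simps)
  have sb: "s (z \<triangleleft>\<^bsub>E\<^esub> be (arr b)) = (\<lambda>l. cf (emb (s z l) \<otimes>\<^bsub>A\<^esub> be (arr b)))"
    using rmod_homD(3)[OF s(1) z be_closed] by (simp add: F_simps)
  have "s (z \<triangleleft>\<^bsub>E\<^esub> be (arr b)) l w = 0" for l w
  proof (rule ccontr)
    assume nz: "s (z \<triangleleft>\<^bsub>E\<^esub> be (arr b)) l w \<noteq> 0"
    hence "cf (emb (s z l) \<otimes>\<^bsub>A\<^esub> be (arr b)) w \<noteq> 0" by (simp add: sb)
    then obtain w1 where w1: "w = pcat w1 (arr b)" by (rule cf_mult_be_right_nonzero[OF emb_closed])
    have "cf (emb (s y l) \<otimes>\<^bsub>A\<^esub> be (arr a)) w \<noteq> 0" using nz by (simp add: eq[symmetric] sa)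
    then obtain w2 where "w = pcat w2 (arr a)" by (rule cf_mult_be_right_nonzero[OF emb_closed])
    hence "last (snd w) = a" by simp
    moreover have "last (snd w) = b" using w1 by simp
    ultimately show False using ab by simp
  qed
  hence "s (z \<triangleleft>\<^bsub>E\<^esub> be (arr b)) = s \<zero>\<^bsub>E\<^esub>"
    using rmod_hom_zero[OF s(1) Er Fr] by (simp add: F_simps fun_eq_iff)
  thus ?thesis by (rule inj_onD[OF s(2) _ E.ract_closed[OF z be_closed] E.M.zero_closed])
qed

text \<open>If at most one arrow leaves \<open>v\<close>, one of the entering arrows,
  \<open>a\<close>, is annihilated by every arrow leaving \<open>v\<close> and spans a simple right
  ideal. Sending the other one, \<open>b\<close>, to the image of \<open>a\<close> is then well
  defined on the right ideal of \<open>b\<close>. Its extension to \<open>A\<close> gives a common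
  multiple of \<open>a\<close> and \<open>b\<close> in \<open>E\<close>, which must be zero.\<close>

lemma in_2_out_2:
  assumes v: "v \<in> verts Q" "in_degree Q v = 2"
  shows "out_degree Q v = 2"
proof (rule ccontr)
  assume o: "out_degree Q v \<noteq> 2"
  obtain a0 b0 where "in_arcs Q v = {a0, b0}" "a0 \<noteq> b0" using in_degree_2[OF v(2)] .
  hence ab0: "a0 \<in> arcs Q" "b0 \<in> arcs Q" "head Q a0 = v" "head Q b0 = v" "a0 \<noteq> b0" by (auto simp: set_eq_iff)
  \<comment> \<open>If one arrow leaves \<open>v\<close>, gentleness makes it form a relation with
    one of the two entering arrows; if none leaves, the claim is vacuous.\<close>
  have "(\<forall>c\<in>arcs Q. tail Q c = v \<longrightarrow> rel a0 c) \<or> (\<forall>c\<in>arcs Q. tail Q c = v \<longrightarrow> rel b0 c)"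
    using gentle_left[OF _ ab0(1,2,5)] ab0(3,4) o out_degree_2I by metis
  then obtain a b where ab: "a \<in> arcs Q" "b \<in> arcs Q" "head Q a = v" "head Q b = v" "a \<noteq> b"
    and soc: "\<And>c. c \<in> arcs Q \<Longrightarrow> tail Q c = v \<Longrightarrow> rel a c"
    using ab0 by metis
  interpret E: right_module A E by (rule Er)
  have be_a: "be (arr a) \<otimes>\<^bsub>A\<^esub> r = cf r (v, []) \<odot>\<^bsub>A\<^esub> be (arr a)" if r: "r \<in> carrier A" for r
  proof (rule cf_eqI)
    fix w assume w: "w \<in> NP"
    show "cf (be (arr a) \<otimes>\<^bsub>A\<^esub> r) w = cf (cf r (v, []) \<odot>\<^bsub>A\<^esub> be (arr a)) w"
    proof (cases "w = arr a")
      case True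
      have "cf (be (arr a) \<otimes>\<^bsub>A\<^esub> r) (pcat (arr a) (v, [])) = cf r (v, [])"
        using r ab by (intro cf_mult_be_left) auto
      thus ?thesis using True ab by (simp add: cf_smult cf_be)
    next
      case False
      have "cf (be (arr a) \<otimes>\<^bsub>A\<^esub> r) w = 0"
      proof (rule ccontr)
        assume nz: "cf (be (arr a) \<otimes>\<^bsub>A\<^esub> r) w \<noteq> 0"
        obtain w' where w': "w = pcat (arr a) w'" "pend (arr a) = fst w'" "w' \<in> NP"
          by (rule cf_mult_be_left_nonzero[OF r nz])
        have ne: "snd w' \<noteq> []" using w' False by (auto simp: pcat_def prod_eq_iff)
        have "hd (snd w') \<in> arcs Q" "tail Q (hd (snd w')) = v"
          using NP_arcs[OF w'(3)] NP_tail[OF w'(3) ne] ne w'(2) ab(3) by auto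
        hence "rel a (hd (snd w'))" by (rule soc)
        thus False using w w'(1) NP_pcat[OF w'(2)] ne by simp
      qed
      thus ?thesis using False by (simp add: cf_smult cf_be)
    qed
  qed (use r in auto)
  let ?X = "F {()} (\<lambda>_. pre (arr b))"
  \<comment> \<open>The map \<open>?g\<close> projects the right ideal of \<open>b\<close> onto its
    top and identifies that with the simple ideal spanned by \<open>a\<close>.\<close>
  let ?f = "\<lambda>\<phi>. emb (\<phi> ())" and ?g = "\<lambda>\<phi>. e (\<phi> () (arr b) \<odot>\<^bsub>A\<^esub> be (arr a))"
  have fdX: "fd_module A ?X" by (rule fd_module_F) (auto simp: right_closed_pre)
  have X_cf: "cf (emb (\<phi> ())) = \<phi> ()" if "\<phi> \<in> carrier ?X" for \<phi>
    by (rule F_supp[OF that]) (auto simp: pre_def)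
  have f: "?f \<in> rmod_hom A ?X (regular_module A)"
    by (rule rmod_homI) (auto simp: F_simps regular_simps emb_add emb_cf)
  have f_inj: "inj_on ?f (carrier ?X)"
  proof (rule inj_onI)
    fix x y assume x: "x \<in> carrier ?X" and y: "y \<in> carrier ?X" and eq: "?f x = ?f y"
    have "x () = y ()"
      by (rule trans[OF X_cf[OF x, symmetric] trans[OF arg_cong[where f = cf, OF eq] X_cf[OF y]]])
    thus "x = y" by (simp add: fun_eq_iff)
  qed
  have g: "?g \<in> rmod_hom A ?X E"
  proof (rule rmod_homI)
    fix x assume "x \<in> carrier ?X"
    show "?g x \<in> carrier E" using rmod_homD(1)[OF e(1)] by (simp add: regular_simps)
  next
    fix x y assume "x \<in> carrier ?X"
    show "?g (x \<oplus>\<^bsub>?X\<^esub> y) = ?g x \<oplus>\<^bsub>E\<^esub> ?g y"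
      using rmod_homD(2)[OF e(1)] by (simp add: regular_simps F_simps A.smult_add_left)
  next
    fix x r assume x: "x \<in> carrier ?X" and r: "r \<in> carrier A"
    \<comment> \<open>The coefficient of \<open>b\<close> in a product could also arise from the
      trivial path at its source, but this path is outside the ideal.\<close>
    have x0: "x () (tail Q b, []) = 0" using x by (auto simp: F_simps pre_def pcat_def)
    have "cf (emb (x ()) \<otimes>\<^bsub>A\<^esub> r) (tail Q b, [b]) = x () (arr b) * cf r (v, [])"
      using r ab X_cf[OF x] by (subst cf_mult) (auto simp: x0 arr_def)
    hence "?g (x \<triangleleft>\<^bsub>?X\<^esub> r) = e ((x () (arr b) * cf r (v, [])) \<odot>\<^bsub>A\<^esub> be (arr a))"
      by (simp add: F_simps arr_def)
    also have "\<dots> = e ((x () (arr b) \<odot>\<^bsub>A\<^esub> be (arr a)) \<otimes>\<^bsub>A\<^esub> r)"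
      using r by (simp add: A.smult_lmult be_a A.smult_smult)
    also have "\<dots> = ?g x \<triangleleft>\<^bsub>E\<^esub> r"
      using rmod_homD(3)[OF e(1), of "x () (arr b) \<odot>\<^bsub>A\<^esub> be (arr a)" r] r by (simp add: regular_simps)
    finally show "?g (x \<triangleleft>\<^bsub>?X\<^esub> r) = ?g x \<triangleleft>\<^bsub>E\<^esub> r" .
  qed
  obtain h where h: "h \<in> rmod_hom A (regular_module A) E" "\<And>x. x \<in> carrier ?X \<Longrightarrow> h (?f x) = ?g x"
    by (rule A.injective_extend[OF inj fdX fd_module_regular f f_inj g]) (rule that; assumption)
  let ?u = "unit_fun () (arr b)"
  have "arr b \<in> pre (arr b)" using ab pre_arrI[of "arr b"] by simp
  hence u: "?u \<in> carrier ?X" by (simp add: F_simps unit_fun_def)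
  have "?u () = path_elem (arr b)" by (auto simp: unit_fun_def path_elem_def)
  hence "?f ?u = be (arr b)" by (simp add: be_def)
  moreover have "?g ?u = e (be (arr a))" by (simp add: unit_fun_def)
  ultimately have "h (be (arr b)) = e (be (arr a))" using h(2)[OF u] by metis
  hence eq: "e \<one>\<^bsub>A\<^esub> \<triangleleft>\<^bsub>E\<^esub> be (arr a) = h \<one>\<^bsub>A\<^esub> \<triangleleft>\<^bsub>E\<^esub> be (arr b)"
    using hom_regular(1)[OF h(1) be_closed] e_one by simp
  have "h \<one>\<^bsub>A\<^esub> \<triangleleft>\<^bsub>E\<^esub> be (arr b) = \<zero>\<^bsub>E\<^esub>"
    by (rule common_multiple_zero[OF e_one_closed hom_regular(2)[OF h(1) be_closed] ab(5) eq])
  hence "e (be (arr a)) = \<zero>\<^bsub>E\<^esub>" using eq e_one by simp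
  thus False using e_be_nonzero ab(1) by simp
qed

text \<open>If at most one arrow enters \<open>v\<close>, one of the leaving arrows,
  \<open>c\<close>, is annihilated from the left by every arrow entering \<open>v\<close>. On the
  sum of the right ideals of \<open>c\<close> and \<open>d\<close>, the map that embeds the first
  and kills the second extends to \<open>A\<close> and gives \<open>y\<close> with
  \<open>y c \<noteq> 0\<close> and \<open>y d = 0\<close>. In a free module \<open>y c\<close> can
  only stem from the coefficient at the trivial path of \<open>v\<close>, which would show up in
  \<open>y d\<close> too.\<close>

lemma out_2_in_2:
  assumes v: "v \<in> verts Q" "out_degree Q v = 2"
  shows "in_degree Q v = 2"
proof (rule ccontr)
  assume o: "in_degree Q v \<noteq> 2"
  obtain a0 b0 where "out_arcs Q v = {a0, b0}" "a0 \<noteq> b0" using out_degree_2[OF v(2)] .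
  hence ab0: "a0 \<in> arcs Q" "b0 \<in> arcs Q" "tail Q a0 = v" "tail Q b0 = v" "a0 \<noteq> b0" by (auto simp: set_eq_iff)
  have "(\<forall>a\<in>arcs Q. head Q a = v \<longrightarrow> rel a a0) \<or> (\<forall>a\<in>arcs Q. head Q a = v \<longrightarrow> rel a b0)"
    using gentle_right[OF _ ab0(1,2,5)] ab0(3,4) o in_degree_2I by metis
  then obtain c d where cd: "c \<in> arcs Q" "d \<in> arcs Q" "tail Q c = v" "tail Q d = v" "c \<noteq> d"
    and top: "\<And>a. a \<in> arcs Q \<Longrightarrow> head Q a = v \<Longrightarrow> rel a c"
    using ab0 by metis
  interpret E: right_module A E by (rule Er)
  interpret reg: right_module A "regular_module A" by (rule right_module_regular)
  let ?X = "F {c, d} (\<lambda>x. pre (arr x))"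
  have fdX: "fd_module A ?X" by (rule fd_module_F) (auto simp: right_closed_pre)
  have Xr: "right_module A ?X" by (rule right_module_F[OF right_closed_pre])
  let ?f = "\<lambda>\<phi>. \<Oplus>\<^bsub>regular_module A\<^esub>l\<in>{c, d}. \<one>\<^bsub>A\<^esub> \<triangleleft>\<^bsub>regular_module A\<^esub> emb (\<phi> l)"
  let ?x = "\<lambda>l. if l = c then e \<one>\<^bsub>A\<^esub> else \<zero>\<^bsub>E\<^esub>"
  let ?g = "\<lambda>\<phi>. \<Oplus>\<^bsub>E\<^esub>l\<in>{c, d}. ?x l \<triangleleft>\<^bsub>E\<^esub> emb (\<phi> l)"
  have f: "?f \<in> rmod_hom A ?X (regular_module A)"
    by (rule hom_from_F[OF right_module_regular]) (auto simp: regular_simps)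
  have g: "?g \<in> rmod_hom A ?X E"
    by (rule hom_from_F[OF Er]) (auto simp: e_one_closed)
  have f_eq: "?f \<phi> = emb (\<phi> c) \<oplus>\<^bsub>A\<^esub> emb (\<phi> d)" for \<phi>
  proof -
    have "?f \<phi> = (\<one>\<^bsub>A\<^esub> \<triangleleft>\<^bsub>regular_module A\<^esub> emb (\<phi> c)) \<oplus>\<^bsub>regular_module A\<^esub>
        (\<Oplus>\<^bsub>regular_module A\<^esub>l\<in>{d}. \<one>\<^bsub>A\<^esub> \<triangleleft>\<^bsub>regular_module A\<^esub> emb (\<phi> l))"
      using cd(5) by (intro reg.M.finsum_insert) (auto simp: regular_simps)
    also have "(\<Oplus>\<^bsub>regular_module A\<^esub>l\<in>{d}. \<one>\<^bsub>A\<^esub> \<triangleleft>\<^bsub>regular_module A\<^esub> emb (\<phi> l)) =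
        (\<one>\<^bsub>A\<^esub> \<triangleleft>\<^bsub>regular_module A\<^esub> emb (\<phi> d)) \<oplus>\<^bsub>regular_module A\<^esub>
        (\<Oplus>\<^bsub>regular_module A\<^esub>l\<in>{}. \<one>\<^bsub>A\<^esub> \<triangleleft>\<^bsub>regular_module A\<^esub> emb (\<phi> l))"
      by (intro reg.M.finsum_insert) (auto simp: regular_simps)
    finally show ?thesis by (simp add: regular_simps)
  qed
  have g_eq: "?g \<phi> = e \<one>\<^bsub>A\<^esub> \<triangleleft>\<^bsub>E\<^esub> emb (\<phi> c)" for \<phi>
  proof -
    have "?g \<phi> = (?x c \<triangleleft>\<^bsub>E\<^esub> emb (\<phi> c)) \<oplus>\<^bsub>E\<^esub> (\<Oplus>\<^bsub>E\<^esub>l\<in>{d}. ?x l \<triangleleft>\<^bsub>E\<^esub> emb (\<phi> l))"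
      using cd(5) by (intro E.M.finsum_insert) (auto intro!: E.ract_closed simp: e_one_closed)
    also have "(\<Oplus>\<^bsub>E\<^esub>l\<in>{d}. ?x l \<triangleleft>\<^bsub>E\<^esub> emb (\<phi> l)) =
        (?x d \<triangleleft>\<^bsub>E\<^esub> emb (\<phi> d)) \<oplus>\<^bsub>E\<^esub> (\<Oplus>\<^bsub>E\<^esub>l\<in>{}. ?x l \<triangleleft>\<^bsub>E\<^esub> emb (\<phi> l))"
      by (intro E.M.finsum_insert) (auto intro!: E.ract_closed simp: e_one_closed)
    finally show ?thesis using cd(5) by (auto simp: E.ract_zero_left E.ract_closed e_one_closed)
  qed
  \<comment> \<open>The sum of the two right ideals is direct because their paths begin with
    different arrows.\<close>
  have f_inj: "inj_on ?f (carrier ?X)"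
  proof (rule rmod_hom_inj[OF f Xr right_module_regular])
    fix \<phi> assume \<phi>: "\<phi> \<in> carrier ?X" and f0: "?f \<phi> = \<zero>\<^bsub>regular_module A\<^esub>"
    have z: "emb (\<phi> c) \<oplus>\<^bsub>A\<^esub> emb (\<phi> d) = \<zero>\<^bsub>A\<^esub>"
      using trans[OF f_eq[symmetric] f0] by (simp only: regular_simps(2))
    have sum0: "\<phi> c w + \<phi> d w = 0" if "w \<in> NP" for w
      using arg_cong[OF z, of "\<lambda>x. cf x w"] that by (simp add: cf_add cf_emb cf_zero)
    have supp: "l \<in> {c, d} \<and> w \<in> NP \<and> hd (snd w) = l" if "\<phi> l w \<noteq> 0" for l w
    proof -
      have "l \<in> {c, d} \<and> w \<in> pre (arr l)" using \<phi> that unfolding F_simps by blast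
      thus ?thesis by (auto simp: pre_def)
    qed
    have "\<phi> l w = 0" for l w
    proof (rule ccontr)
      assume nz: "\<phi> l w \<noteq> 0"
      have "\<phi> c w = 0 \<or> \<phi> d w = 0" using supp[of c w] supp[of d w] cd(5) by blast
      hence "\<phi> c w = 0 \<and> \<phi> d w = 0" using sum0[of w] supp[OF nz] by auto
      thus False using supp[OF nz] nz by auto
    qed
    thus "\<phi> = \<zero>\<^bsub>?X\<^esub>" by (simp add: F_simps fun_eq_iff)
  qed
  obtain h where h: "h \<in> rmod_hom A (regular_module A) E" "\<And>x. x \<in> carrier ?X \<Longrightarrow> h (?f x) = ?g x"
    by (rule A.injective_extend[OF inj fdX fd_module_regular f f_inj g]) (rule that; assumption)
  have u: "unit_fun l (arr l) \<in> carrier ?X" if "l \<in> {c, d}" for l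
    using that cd pre_arrI[of "arr l"] by (auto simp: F_simps unit_fun_def split: if_splits)
  have u_eq: "emb (unit_fun l (arr l) l') = (if l' = l then be (arr l) else \<zero>\<^bsub>A\<^esub>)" for l l'
    unfolding be_def emb_0[symmetric] by (auto simp: unit_fun_def path_elem_def intro!: arg_cong[where f = emb])
  let ?y = "h \<one>\<^bsub>A\<^esub>"
  have y: "?y \<in> carrier E" by (rule hom_regular(2)[OF h(1) be_closed])
  have hfg: "h (emb (\<phi> c) \<oplus>\<^bsub>A\<^esub> emb (\<phi> d)) = e \<one>\<^bsub>A\<^esub> \<triangleleft>\<^bsub>E\<^esub> emb (\<phi> c)" if "\<phi> \<in> carrier ?X" for \<phi>
    using h(2)[OF that] by (simp only: f_eq g_eq)
  note hy = hom_regular(1)[OF h(1) be_closed, symmetric]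
  have yc: "?y \<triangleleft>\<^bsub>E\<^esub> be (arr c) = e (be (arr c))"
    unfolding hy using hfg[OF u[of c]] cd(5) by (simp add: u_eq e_one)
  have yd: "?y \<triangleleft>\<^bsub>E\<^esub> be (arr d) = \<zero>\<^bsub>E\<^esub>"
    unfolding hy using hfg[OF u[of d]] cd(5) by (simp add: u_eq E.ract_zero_right e_one_closed)
  obtain B s where s: "s \<in> rmod_hom A E (F (B :: (nat \<Rightarrow> 'k) set) (\<lambda>_. NP))" "inj_on s (carrier E)"
    using projective_embeds[OF proj] .
  let ?F = "F B (\<lambda>_. NP)"
  have Fr: "right_module A ?F" by (rule right_module_F[OF right_closed_NP])
  have s0: "s \<zero>\<^bsub>E\<^esub> = (\<lambda>_ _. 0)" using rmod_hom_zero[OF s(1) Er Fr] by (simp add: F_simps)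
  have sx: "s (?y \<triangleleft>\<^bsub>E\<^esub> be q) = (\<lambda>l. cf (emb (s ?y l) \<otimes>\<^bsub>A\<^esub> be q))" for q
    using rmod_homD(3)[OF s(1) y be_closed] by (simp add: F_simps)
  have "s (?y \<triangleleft>\<^bsub>E\<^esub> be (arr c)) \<noteq> s \<zero>\<^bsub>E\<^esub>"
  proof
    assume "s (?y \<triangleleft>\<^bsub>E\<^esub> be (arr c)) = s \<zero>\<^bsub>E\<^esub>"
    hence "?y \<triangleleft>\<^bsub>E\<^esub> be (arr c) = \<zero>\<^bsub>E\<^esub>"
      by (rule inj_onD[OF s(2) _ E.ract_closed[OF y be_closed] E.M.zero_closed])
    thus False using yc e_be_nonzero[of "arr c"] cd(1) by simp
  qed
  then obtain l w where nz: "cf (emb (s ?y l) \<otimes>\<^bsub>A\<^esub> be (arr c)) w \<noteq> 0"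
    unfolding sx s0 by (auto simp: fun_eq_iff)
  obtain w' where w': "w = pcat w' (arr c)" "pend w' = fst (arr c)" "w' \<in> NP"
    by (rule cf_mult_be_right_nonzero[OF emb_closed nz])
  have w: "w \<in> NP" using nz cf_outside by blast
  \<comment> \<open>An arrow before \<open>c\<close> would form a relation with it.\<close>
  have "snd w' = []"
  proof (rule ccontr)
    assume ne: "snd w' \<noteq> []"
    have "last (snd w') \<in> arcs Q" "head Q (last (snd w')) = v"
      using NP_arcs[OF w'(3)] ne w'(2) cd(3) by (auto simp: pend_nonempty)
    hence "rel (last (snd w')) c" by (rule top)
    thus False using w w'(1) NP_pcat[OF w'(2)] ne by simp
  qed
  hence wv: "w' = (v, [])" using w'(2) cd(3) by (simp add: prod_eq_iff pend_empty)
  have "cf (emb (s ?y l)) (v, []) \<noteq> 0"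
    using nz w w' wv cf_mult_be_right[OF emb_closed, of w' "arr c" "s ?y l"] by simp
  \<comment> \<open>The coefficient at the trivial path reappears at the path
    \<open>d\<close>.\<close>
  moreover have "cf (emb (s ?y l) \<otimes>\<^bsub>A\<^esub> be (arr d)) (pcat (v, []) (arr d)) = cf (emb (s ?y l)) (v, [])"
    using cd by (intro cf_mult_be_right) (auto simp: NP_pcat)
  moreover have "cf (emb (s ?y l) \<otimes>\<^bsub>A\<^esub> be (arr d)) (pcat (v, []) (arr d)) = 0"
    using fun_cong[OF fun_cong[OF sx[of "arr d"]]] s0 yd by simp
  ultimately show False by simp
qed

end

text \<open>For \<open>n = 1\<close> the condition says that the first term of the resolution is
  projective; it is injective and contains \<open>A\<close> by construction.\<close>

lemma auslander_gorenstein_balanced: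
  assumes "auslander_gorenstein A" "v \<in> verts Q"
  shows "in_degree Q v = 2 \<longleftrightarrow> out_degree Q v = 2"
proof -
  have "n_gorenstein 1 A" using assms(1) by (simp add: auslander_gorenstein_def)
  then obtain E e d where min: "minimal_injective_resolution A (regular_module A) E e d"
    and pd: "pdim A (E 0) \<le> enat 0" by (auto simp: n_gorenstein_def)
  have res: "injective_module A (E 0)" "e \<in> rmod_hom A (regular_module A) (E 0)" "inj_on e (carrier A)"
    using min by (auto simp: minimal_injective_resolution_def injective_resolution_def regular_simps)
  have "projective_module A (E 0)" by (rule A.pdim_0_projective) (use pd in \<open>simp add: zero_enat_def\<close>)
  thus ?thesis using in_2_out_2[OF res(1) _ res(2,3) assms(2)] out_2_in_2[OF res(1) _ res(2,3) assms(2)] by blast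
qed

end

theorem theorem3p3:
  fixes Q :: "('v, 'a) pre_digraph" and I :: "('v \<times> 'a list \<Rightarrow> 'k::field) set"
  assumes "fin_digraph Q"
    and "admissible_ideal Q I"
    and "gentle Q I"
  shows "auslander_gorenstein (bound_quiver_algebra Q I) \<longleftrightarrow>
         (\<forall>v\<in>verts Q. in_degree Q v = 2 \<longleftrightarrow> out_degree Q v = 2)"
proof
  interpret gentle_algebra Q I
    using assms by (intro gentle_algebra.intro gentle_algebra_axioms.intro)
  show "\<forall>v\<in>verts Q. in_degree Q v = 2 \<longleftrightarrow> out_degree Q v = 2"
    if "auslander_gorenstein (bound_quiver_algebra Q I)"
    using auslander_gorenstein_balanced that by (simp add: A_def)
  show "auslander_gorenstein (bound_quiver_algebra Q I)"
    if deg: "\<forall>v\<in>verts Q. in_degree Q v = 2 \<longleftrightarrow> out_degree Q v = 2"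
  proof -
    interpret balanced_gentle_algebra Q I by unfold_locales (use deg in blast)
    show ?thesis using auslander_gorenstein by (simp add: A_def)
  qed
qed

end
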